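(* Let $\Omega,B_D,B_N,\tilde g,g,\sigma,\varepsilon,T$ be as in the standing hypothesis given in the context. Then there exists a unique weak solution $V\in C^1([0,T];H^1(\Omega))$ (in the sense defined in the context) of the problem $$\varepsilon\,\partial_t\Delta V+\operatorname{div}(\sigma\nabla V)=0\ \text{ in }[0,T]\times\Omega,\quad V(0,\cdot)=\tilde g\ \text{ in }\overline\Omega,\quad V=g\ \text{ on }[0,T]\times B_D,\quad \partial_\nu V=0\ \text{ on }[0,T]\times B_N .$$ Moreover, writing $V(t,x)=\omega(x)+u(t,x)$ with $\omega,u$ as in the definition of weak solution, $$\|V\|_{C^1([0,T];H^1(\Omega))}\le \|\omega\|_{H^1(\Omega)}+c_\Omega\|u\|_{C^1([0,T];X)}\le 2\max\{1,c_\Omega^2\}\max\{1,T\}\left(1+\frac{\|\sigma\|_{L^\infty(\Omega)}}{\varepsilon}\right)^2\|\tilde g\|_{H^1(\Omega)}.$$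
   Context: **Standing hypothesis.** $T>0$. $\Omega\subseteq\mathbb R^n$ is a connected bounded open set with the uniform $C^d$-regularity property for some $d\ge2$, with outward normal $\nu$. $B_D$ and $B_N$ are non-empty disjoint open regular subsets of $\partial\Omega$ (the Dirichlet and Neumann boundaries) with $B_N=\partial\Omega\setminus\overline{B_D}$, so $\partial\Omega=\overline{B_D}\cup B_N$. $\tilde g\in H^2(\Omega)$ satisfies $\gamma_1(\tilde g)|_{B_N}=0$, and $g=\gamma_0(\tilde g)\in H^{3/2}(\partial\Omega)$, where $\gamma_0$ is the trace operator and $\gamma_1$ is the generalized normal trace operator (continuous extension of $u\mapsto\partial_\nu u|_{\partial\Omega}$ to $H^2(\Omega)\to H^{1/2}(\partial\Omega)$). $\sigma\in L^\infty(\Omega)$ is non-negative and independent of time; $\varepsilon>0$ is a constant. **Uniform $C^d$-regularity property.** There exist a locally finite open covering $\{U_j\}_{j\in\mathbb N}$ of $\partial\Omega$ and injective $C^d$ maps $\Phi_j:U_j\to B_1(0)\subseteq\mathbb R^n$ with inverses $\Phi_j^{-1}$ such that: (i) for some $\delta>0$, $\bigcup_j\Phi_j^{-1}(\{|y|<1/2\})\supset\{x\in\Omega:\operatorname{dist}(x,\partial\Omega)<\delta\}$; (ii) for some $R\in\mathbb N$ every collection of $R+1$ of the sets $U_j$ has empty intersection; (iii) $\Phi_j(U_j\cap\Omega)=\{y\in B_1(0):y_n>0\}$ for each $j$; (iv) there is $M>0$ bounding in absolute value all partial derivatives of order $\le d$ of all components of all $\Phi_j$ and $\Phi_j^{-1}$.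 **Spaces.** $(\cdot,\cdot)_0$ is the $L^2(\Omega)$ inner product. $X:=\{u\in H^1(\Omega): (\gamma_0u)|_{B_D}=0\}$ with norm $\|u\|_X:=\|\nabla u\|_{L^2(\Omega)}$; $X^*$ is its dual with the operator norm. $c_\Omega>0$ is a constant such that $\frac1{c_\Omega}\|\varphi\|_{H^1(\Omega)}\le\|\nabla\varphi\|_{L^2(\Omega)}\le c_\Omega\|\varphi\|_{H^1(\Omega)}$ for all $\varphi\in X$. For a Banach space $Y$, $\|v\|_{C^1([0,T];Y)}=\sup_t\|v(t)\|_Y+\sup_t\|v'(t)\|_Y$. For $v\in H^1(\Omega)$, $\Delta v\in X^*$ is defined by $\langle-\Delta v|\varphi\rangle_{X^*,X}:=(\nabla v,\nabla\varphi)_0$ for $\varphi\in X$. **Operator $(-\Delta_{ND})^{-1}:X^*\to X$.** For $\zeta\in X^*$, $\psi=(-\Delta_{ND})^{-1}\zeta$ is the unique element of $X$ with $(\nabla\psi,\nabla\varphi)_0=\langle\zeta|\varphi\rangle_{X^*,X}$ for all $\varphi\in X$. **Weak solution.** $V\in C^1([0,T];H^1(\Omega))$ is a weak solution if there exist $\omega\in H^1(\Omega)$ and $u\in C^1([0,T];H^1(\Omega))$ with $V(t,x)=\omega(x)+u(t,x)$ for every $t\in[0,T]$ and a.e. $x\in\Omega$, such that: - $\omega-\tilde g\in X$ and $\int_\Omega\left(\frac{\sigma(x)}{\varepsilon}+1\right)\langle\nabla\omega,\nabla\varphi\rangle\,dx=0$ for every $\varphi\in X$; - $u(t,\cdot)=(-\Delta_{ND})^{-1}w(t,\cdot)$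 for every $t\in[0,T]$, where $w\in C^1([0,T];X^* )$ is the unique solution of $$\langle w'(t,\cdot)|\varphi\rangle_{X^*,X}+\int_\Omega\frac{\sigma(x)}{\varepsilon}\langle\nabla(-\Delta_{ND})^{-1}w(t,\cdot),\nabla\varphi\rangle\,dx=\int_\Omega\langle\nabla\omega,\nabla\varphi\rangle\,dx\quad\forall\varphi\in X,\ t\in[0,T],$$ with initial condition $w(0,\cdot)=\Delta(\omega-\tilde g)$ in $X^*$. *)

theory Defs
  imports "HOL-Analysis.Analysis" "HOL-Probability.Essential_Supremum"
begin

section \<open>Classical derivatives\<close>

definition partial_deriv :: "'n \<Rightarrow> (real^'n \<Rightarrow> real) \<Rightarrow> real^'n \<Rightarrow> real" where
  "partial_deriv i f x = frechet_derivative f (at x) (axis i 1)"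

definition partial_derivs :: "'n list \<Rightarrow> (real^'n \<Rightarrow> real) \<Rightarrow> real^'n \<Rightarrow> real" where
  "partial_derivs is f = foldr partial_deriv is f"

text \<open>Only used for open \<open>S\<close>.\<close>

primrec Ck_on :: "nat \<Rightarrow> (real^'n \<Rightarrow> 'b::real_normed_vector) \<Rightarrow> (real^'n) set \<Rightarrow> bool" where
  "Ck_on 0 f S = continuous_on S f"
| "Ck_on (Suc k) f S =
     (f differentiable_on S \<and>
      (\<forall>i. Ck_on k (\<lambda>x. frechet_derivative f (at x) (axis i 1)) S))"

definition smooth :: "(real^'n \<Rightarrow> real) \<Rightarrow> bool" where
  "smooth f \<longleftrightarrow> (\<forall>k. Ck_on k f UNIV)"

definition test_functions :: "(real^'n) set \<Rightarrow> (real^'n \<Rightarrow> real) set" where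
  "test_functions \<Omega> = {\<phi>. smooth \<phi> \<and> (\<exists>K. compact K \<and> K \<subseteq> \<Omega> \<and> (\<forall>x. x \<notin> K \<longrightarrow> \<phi> x = 0))}"


section \<open>Regularity of the domain and its boundary\<close>

text \<open>The charts are indexed by a subset \<open>J\<close> of the naturals: because of the bounded overlap, the
  common half-ball image and the bound \<open>M\<close> on the derivatives (hence on the Jacobians), a bounded
  \<open>\<Omega>\<close> only admits finitely many charts, so insisting on \<open>J = UNIV\<close> would make the property
  unsatisfiable. Which coordinate \<open>k\<close> plays the role of the last one is immaterial (permute the
  coordinates of the charts).\<close>

definition uniform_Cd_regular :: "nat \<Rightarrow> (real^'n) set \<Rightarrow> bool" where
  "uniform_Cd_regular d \<Omega> \<longleftrightarrow>
     (\<exists>(J::nat set) U (\<Phi> :: nat \<Rightarrow> real^'n \<Rightarrow> real^'n) (k::'n).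
        (\<forall>j\<in>J. open (U j)) \<and> frontier \<Omega> \<subseteq> (\<Union>j\<in>J. U j) \<and>
        (\<forall>x\<in>frontier \<Omega>. \<exists>W. open W \<and> x \<in> W \<and> finite {j\<in>J. U j \<inter> W \<noteq> {}}) \<and>
        (\<forall>j\<in>J. inj_on (\<Phi> j) (U j) \<and> \<Phi> j ` U j \<subseteq> ball 0 1 \<and>
               Ck_on d (\<Phi> j) (U j) \<and> Ck_on d (inv_into (U j) (\<Phi> j)) (\<Phi> j ` U j)) \<and>
        (\<exists>\<delta>>0. {x\<in>\<Omega>. infdist x (frontier \<Omega>) < \<delta>} \<subseteq> (\<Union>j\<in>J. {x\<in>U j. norm (\<Phi> j x) < 1/2})) \<and>
        (\<exists>R::nat. \<forall>I\<subseteq>J. finite I \<and> card I = R + 1 \<longrightarrow> (\<Inter>j\<in>I. U j) = {}) \<and>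
        (\<forall>j\<in>J. \<Phi> j ` (U j \<inter> \<Omega>) = {y \<in> ball 0 1. y $ k > 0}) \<and>
        (\<exists>M>0. \<forall>j\<in>J. \<forall>is i. length is \<le> d \<longrightarrow>
           (\<forall>x\<in>U j. \<bar>partial_derivs is (\<lambda>x. \<Phi> j x $ i) x\<bar> \<le> M) \<and>
           (\<forall>y\<in>\<Phi> j ` U j. \<bar>partial_derivs is (\<lambda>y. inv_into (U j) (\<Phi> j) y $ i) y\<bar> \<le> M)))"

text \<open>A unit vector orthogonal to every tangent vector of the boundary at \<open>x\<close> and pointing out of
  \<open>\<Omega>\<close>.\<close>

definition outward_unit_normal :: "(real^'n) set \<Rightarrow> real^'n \<Rightarrow> real^'n \<Rightarrow> bool" where
  "outward_unit_normal \<Omega> x v \<longleftrightarrow>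
     norm v = 1 \<and>
     (\<forall>\<gamma> w. \<gamma> 0 = x \<and> (\<forall>\<^sub>F t in at (0::real). \<gamma> t \<in> frontier \<Omega>) \<and> (\<gamma> has_vector_derivative w) (at 0)
        \<longrightarrow> v \<bullet> w = 0) \<and>
     (\<forall>\<^sub>F t in at_right (0::real). x - t *\<^sub>R v \<in> \<Omega> \<and> x + t *\<^sub>R v \<notin> closure \<Omega>)"

definition regular_open_in :: "'a topology \<Rightarrow> 'a set \<Rightarrow> bool" where
  "regular_open_in X B \<longleftrightarrow> openin X B \<and> X interior_of (X closure_of B) = B"

text \<open>\<open>k\<close>-dimensional Hausdorff measure, normalized to agree with \<open>k\<close>-dimensional surface area; for
  \<open>k = 0\<close> it is the counting measure (note \<open>0 ^ 0 = 1\<close>).\<close>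

definition hausdorff_outer :: "nat \<Rightarrow> 'a::metric_space set \<Rightarrow> ennreal" where
  "hausdorff_outer k A =
     (SUP \<delta>\<in>{0<..}. INF C\<in>{C :: nat \<Rightarrow> 'a set. A \<subseteq> (\<Union>i. C i) \<and> (\<forall>i. bounded (C i) \<and> diameter (C i) \<le> \<delta>)}.
        (\<Sum>i. if C i = {} then 0 else ennreal (unit_ball_vol k * (diameter (C i) / 2) ^ k)))"

definition hausdorff_measure :: "nat \<Rightarrow> 'a::metric_space measure" where
  "hausdorff_measure k = measure_of UNIV (sets borel) (hausdorff_outer k)"

definition surface_measure :: "(real^'n) set \<Rightarrow> (real^'n) measure" where
  "surface_measure \<Omega> = restrict_space (hausdorff_measure (CARD('n) - 1)) (frontier \<Omega>)"


section \<open>Function spaces\<close>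

text \<open>Elements of the Lebesgue and Sobolev spaces are represented by functions; equality in these
  spaces is equality almost everywhere.\<close>

definition L2 :: "'a measure \<Rightarrow> ('a \<Rightarrow> 'b::euclidean_space) set" where
  "L2 M = {f \<in> borel_measurable M. integrable M (\<lambda>x. (norm (f x))\<^sup>2)}"

definition L2_inner :: "'a measure \<Rightarrow> ('a \<Rightarrow> 'b::euclidean_space) \<Rightarrow> ('a \<Rightarrow> 'b) \<Rightarrow> real" where
  "L2_inner M f g = (LINT x|M. f x \<bullet> g x)"

definition L2_norm :: "'a measure \<Rightarrow> ('a \<Rightarrow> 'b::euclidean_space) \<Rightarrow> real" where
  "L2_norm M f = sqrt (L2_inner M f f)"

definition Linf :: "'a measure \<Rightarrow> ('a \<Rightarrow> real) set" where
  "Linf M = {f \<in> borel_measurable M. esssup M (\<lambda>x. ereal \<bar>f x\<bar>) < \<infinity>}"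

definition Linf_norm :: "'a measure \<Rightarrow> ('a \<Rightarrow> real) \<Rightarrow> real" where
  "Linf_norm M f = real_of_ereal (esssup M (\<lambda>x. ereal \<bar>f x\<bar>))"

definition has_weak_grad :: "(real^'n) set \<Rightarrow> (real^'n \<Rightarrow> real) \<Rightarrow> (real^'n \<Rightarrow> real^'n) \<Rightarrow> bool" where
  "has_weak_grad \<Omega> u G \<longleftrightarrow>
     (\<forall>i. \<forall>\<phi>\<in>test_functions \<Omega>.
        (LINT x|lebesgue_on \<Omega>. u x * partial_deriv i \<phi> x) = - (LINT x|lebesgue_on \<Omega>. G x $ i * \<phi> x))"

definition H1 :: "(real^'n) set \<Rightarrow> (real^'n \<Rightarrow> real) set" where
  "H1 \<Omega> = {u \<in> L2 (lebesgue_on \<Omega>). \<exists>G \<in> L2 (lebesgue_on \<Omega>). has_weak_grad \<Omega> u G}"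

text \<open>A representative of the (almost everywhere unique) weak gradient.\<close>

definition wgrad :: "(real^'n) set \<Rightarrow> (real^'n \<Rightarrow> real) \<Rightarrow> real^'n \<Rightarrow> real^'n" where
  "wgrad \<Omega> u = (SOME G. G \<in> L2 (lebesgue_on \<Omega>) \<and> has_weak_grad \<Omega> u G)"

definition H1_norm :: "(real^'n) set \<Rightarrow> (real^'n \<Rightarrow> real) \<Rightarrow> real" where
  "H1_norm \<Omega> u = sqrt ((L2_norm (lebesgue_on \<Omega>) u)\<^sup>2 + (L2_norm (lebesgue_on \<Omega>) (wgrad \<Omega> u))\<^sup>2)"

definition H2 :: "(real^'n) set \<Rightarrow> (real^'n \<Rightarrow> real) set" where
  "H2 \<Omega> = {u \<in> H1 \<Omega>. \<forall>i. (\<lambda>x. wgrad \<Omega> u x $ i) \<in> H1 \<Omega>}"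

definition H2_norm :: "(real^'n) set \<Rightarrow> (real^'n \<Rightarrow> real) \<Rightarrow> real" where
  "H2_norm \<Omega> u =
     sqrt ((L2_norm (lebesgue_on \<Omega>) u)\<^sup>2 + (\<Sum>i\<in>UNIV. (H1_norm \<Omega> (\<lambda>x. wgrad \<Omega> u x $ i))\<^sup>2))"

text \<open>\<open>H\<^sup>1\<^sup>/\<^sup>2\<close> of the \<open>(n-1)\<close>-dimensional boundary, with the Sobolev--Slobodeckij (Gagliardo) norm:
  the exponent of the kernel is \<open>(n - 1) + 2 * (1/2) = n\<close>.\<close>

definition gagliardo_half :: "(real^'n) set \<Rightarrow> (real^'n \<Rightarrow> real) \<Rightarrow> ennreal" where
  "gagliardo_half \<Omega> f =
     (\<integral>\<^sup>+x. \<integral>\<^sup>+y. ennreal ((f x - f y)\<^sup>2 / norm (x - y) ^ CARD('n))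
        \<partial>surface_measure \<Omega> \<partial>surface_measure \<Omega>)"

definition H_half :: "(real^'n) set \<Rightarrow> (real^'n \<Rightarrow> real) set" where
  "H_half \<Omega> = {f \<in> L2 (surface_measure \<Omega>). gagliardo_half \<Omega> f < \<infinity>}"

definition H_half_norm :: "(real^'n) set \<Rightarrow> (real^'n \<Rightarrow> real) \<Rightarrow> real" where
  "H_half_norm \<Omega> f =
     sqrt ((L2_norm (surface_measure \<Omega>) f)\<^sup>2 + enn2real (gagliardo_half \<Omega> f))"


section \<open>Trace operators\<close>

text \<open>The continuous linear extensions of \<open>u \<mapsto> u\<bar>\<^bsub>\<partial>\<Omega>\<^esub>\<close> and of \<open>u \<mapsto> \<partial>\<^bsub>\<nu>\<^esub>u\<bar>\<^bsub>\<partial>\<Omega>\<^esub>\<close> from (restrictions to \<open>\<Omega>\<close> of)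
  smooth functions. Since those are dense, each predicate determines its operator up to null sets
  of the boundary.\<close>

definition trace_operator ::
  "(real^'n) set \<Rightarrow> ((real^'n \<Rightarrow> real) \<Rightarrow> real^'n \<Rightarrow> real) \<Rightarrow> bool" where
  "trace_operator \<Omega> \<gamma>0 \<longleftrightarrow>
     (\<forall>u\<in>H1 \<Omega>. \<gamma>0 u \<in> L2 (surface_measure \<Omega>)) \<and>
     (\<forall>u\<in>H1 \<Omega>. \<forall>v\<in>H1 \<Omega>. \<forall>a b. AE y in surface_measure \<Omega>.
        \<gamma>0 (\<lambda>x. a * u x + b * v x) y = a * \<gamma>0 u y + b * \<gamma>0 v y) \<and>
     (\<exists>C. \<forall>u\<in>H1 \<Omega>. L2_norm (surface_measure \<Omega>) (\<gamma>0 u) \<le> C * H1_norm \<Omega> u) \<and>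
     (\<forall>u. smooth u \<longrightarrow> (AE y in surface_measure \<Omega>. \<gamma>0 u y = u y))"

definition normal_trace_operator ::
  "(real^'n) set \<Rightarrow> (real^'n \<Rightarrow> real^'n) \<Rightarrow> ((real^'n \<Rightarrow> real) \<Rightarrow> real^'n \<Rightarrow> real) \<Rightarrow> bool" where
  "normal_trace_operator \<Omega> \<nu> \<gamma>1 \<longleftrightarrow>
     (\<forall>u\<in>H2 \<Omega>. \<gamma>1 u \<in> H_half \<Omega>) \<and>
     (\<forall>u\<in>H2 \<Omega>. \<forall>v\<in>H2 \<Omega>. \<forall>a b. AE y in surface_measure \<Omega>.
        \<gamma>1 (\<lambda>x. a * u x + b * v x) y = a * \<gamma>1 u y + b * \<gamma>1 v y) \<and>
     (\<exists>C. \<forall>u\<in>H2 \<Omega>. H_half_norm \<Omega> (\<gamma>1 u) \<le> C * H2_norm \<Omega> u) \<and>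
     (\<forall>u. smooth u \<longrightarrow>
        (AE y in surface_measure \<Omega>. \<gamma>1 u y = frechet_derivative u (at y) (\<nu> y)))"


section \<open>The space \<open>X\<close>, its dual, and the Laplacian\<close>

definition X_space ::
  "(real^'n) set \<Rightarrow> (real^'n) set \<Rightarrow> ((real^'n \<Rightarrow> real) \<Rightarrow> real^'n \<Rightarrow> real) \<Rightarrow> (real^'n \<Rightarrow> real) set" where
  "X_space \<Omega> BD \<gamma>0 = {u \<in> H1 \<Omega>. AE y in surface_measure \<Omega>. y \<in> BD \<longrightarrow> \<gamma>0 u y = 0}"

definition X_norm :: "(real^'n) set \<Rightarrow> (real^'n \<Rightarrow> real) \<Rightarrow> real" where
  "X_norm \<Omega> u = L2_norm (lebesgue_on \<Omega>) (wgrad \<Omega> u)"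

text \<open>From here on \<open>X\<close> stands for \<open>X_space \<Omega> BD \<gamma>0\<close>. A functional on \<open>X\<close> is only relevant through its
  values on \<open>X\<close>.\<close>

definition X_dual :: "(real^'n) set \<Rightarrow> (real^'n \<Rightarrow> real) set \<Rightarrow> ((real^'n \<Rightarrow> real) \<Rightarrow> real) set" where
  "X_dual \<Omega> X = {\<zeta>.
     (\<forall>u\<in>X. \<forall>v\<in>X. \<forall>a b. \<zeta> (\<lambda>x. a * u x + b * v x) = a * \<zeta> u + b * \<zeta> v) \<and>
     (\<exists>C. \<forall>u\<in>X. \<bar>\<zeta> u\<bar> \<le> C * X_norm \<Omega> u)}"

definition X_dual_norm :: "(real^'n) set \<Rightarrow> (real^'n \<Rightarrow> real) set \<Rightarrow> ((real^'n \<Rightarrow> real) \<Rightarrow> real) \<Rightarrow> real" where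
  "X_dual_norm \<Omega> X \<zeta> = (SUP u\<in>{u\<in>X. X_norm \<Omega> u \<le> 1}. \<bar>\<zeta> u\<bar>)"

definition weak_laplacian :: "(real^'n) set \<Rightarrow> (real^'n \<Rightarrow> real) \<Rightarrow> (real^'n \<Rightarrow> real) \<Rightarrow> real" where
  "weak_laplacian \<Omega> v \<phi> = - L2_inner (lebesgue_on \<Omega>) (wgrad \<Omega> v) (wgrad \<Omega> \<phi>)"

text \<open>The operator \<open>(- \<Delta>\<^bsub>ND\<^esub>)\<^sup>-\<^sup>1\<close>; the function chosen is unique up to equality almost everywhere.\<close>

definition ND_inverse ::
  "(real^'n) set \<Rightarrow> (real^'n \<Rightarrow> real) set \<Rightarrow> ((real^'n \<Rightarrow> real) \<Rightarrow> real) \<Rightarrow> real^'n \<Rightarrow> real" where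
  "ND_inverse \<Omega> X \<zeta> =
     (SOME \<psi>. \<psi> \<in> X \<and> (\<forall>\<phi>\<in>X. L2_inner (lebesgue_on \<Omega>) (wgrad \<Omega> \<psi>) (wgrad \<Omega> \<phi>) = \<zeta> \<phi>))"


section \<open>Continuously differentiable curves\<close>

text \<open>\<open>v \<in> C\<^sup>1([0,T];Y)\<close> with derivative \<open>v'\<close>, where \<open>Y\<close> is a space of real-valued functions with norm
  \<open>N\<close>. It is used both for \<open>H\<^sup>1\<close> and \<open>X\<close> (functions on \<open>\<Omega>\<close>) and for \<open>X\<^sup>*\<close> (functions on \<open>X\<close>).
  Continuity of \<open>v\<close> follows from its differentiability.\<close>

definition has_C1_deriv ::
  "real \<Rightarrow> ('a \<Rightarrow> real) set \<Rightarrow> (('a \<Rightarrow> real) \<Rightarrow> real) \<Rightarrow> (real \<Rightarrow> 'a \<Rightarrow> real) \<Rightarrow> (real \<Rightarrow> 'a \<Rightarrow> real) \<Rightarrow> bool" where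
  "has_C1_deriv T Y N v v' \<longleftrightarrow>
     (\<forall>t\<in>{0..T}. v t \<in> Y \<and> v' t \<in> Y \<and>
        ((\<lambda>s. N (\<lambda>x. (v s x - v t x) / (s - t) - v' t x)) \<longlongrightarrow> 0) (at t within {0..T}) \<and>
        ((\<lambda>s. N (\<lambda>x. v' s x - v' t x)) \<longlongrightarrow> 0) (at t within {0..T}))"

definition C1_curves :: "real \<Rightarrow> ('a \<Rightarrow> real) set \<Rightarrow> (('a \<Rightarrow> real) \<Rightarrow> real) \<Rightarrow> (real \<Rightarrow> 'a \<Rightarrow> real) set" where
  "C1_curves T Y N = {v. \<exists>v'. has_C1_deriv T Y N v v'}"

text \<open>The value does not depend on the chosen derivative, which is unique up to elements of norm
  zero.\<close>

definition C1_norm ::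
  "real \<Rightarrow> ('a \<Rightarrow> real) set \<Rightarrow> (('a \<Rightarrow> real) \<Rightarrow> real) \<Rightarrow> (real \<Rightarrow> 'a \<Rightarrow> real) \<Rightarrow> real" where
  "C1_norm T Y N v =
     (SUP t\<in>{0..T}. N (v t)) + (SUP t\<in>{0..T}. N ((SOME v'. has_C1_deriv T Y N v v') t))"


section \<open>Weak solutions\<close>

definition evolution_solution ::
  "(real^'n) set \<Rightarrow> (real^'n \<Rightarrow> real) set \<Rightarrow> (real^'n \<Rightarrow> real) \<Rightarrow> real \<Rightarrow> real \<Rightarrow>
   (real^'n \<Rightarrow> real) \<Rightarrow> (real^'n \<Rightarrow> real) \<Rightarrow> (real \<Rightarrow> (real^'n \<Rightarrow> real) \<Rightarrow> real) \<Rightarrow> bool" where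
  "evolution_solution \<Omega> X \<sigma> \<epsilon> T gt \<omega> w \<longleftrightarrow>
     (\<exists>w'. has_C1_deriv T (X_dual \<Omega> X) (X_dual_norm \<Omega> X) w w' \<and>
        (\<forall>\<phi>\<in>X. \<forall>t\<in>{0..T}.
           w' t \<phi> + (LINT x|lebesgue_on \<Omega>. \<sigma> x / \<epsilon> * (wgrad \<Omega> (ND_inverse \<Omega> X (w t)) x \<bullet> wgrad \<Omega> \<phi> x))
           = (LINT x|lebesgue_on \<Omega>. wgrad \<Omega> \<omega> x \<bullet> wgrad \<Omega> \<phi> x))) \<and>
     (\<forall>\<phi>\<in>X. w 0 \<phi> = weak_laplacian \<Omega> (\<lambda>x. \<omega> x - gt x) \<phi>)"

text \<open>\<open>V\<close> is a weak solution and \<open>V = \<omega> + u\<close> is a decomposition as required of weak solutions.\<close>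

definition weak_solution_decomp ::
  "(real^'n) set \<Rightarrow> (real^'n \<Rightarrow> real) set \<Rightarrow> (real^'n \<Rightarrow> real) \<Rightarrow> real \<Rightarrow> real \<Rightarrow> (real^'n \<Rightarrow> real) \<Rightarrow>
   (real \<Rightarrow> real^'n \<Rightarrow> real) \<Rightarrow> (real^'n \<Rightarrow> real) \<Rightarrow> (real \<Rightarrow> real^'n \<Rightarrow> real) \<Rightarrow> bool" where
  "weak_solution_decomp \<Omega> X \<sigma> \<epsilon> T gt V \<omega> u \<longleftrightarrow>
     V \<in> C1_curves T (H1 \<Omega>) (H1_norm \<Omega>) \<and> \<omega> \<in> H1 \<Omega> \<and> u \<in> C1_curves T (H1 \<Omega>) (H1_norm \<Omega>) \<and>
     (\<forall>t\<in>{0..T}. AE x in lebesgue_on \<Omega>. V t x = \<omega> x + u t x) \<and>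
     (\<lambda>x. \<omega> x - gt x) \<in> X \<and>
     (\<forall>\<phi>\<in>X. (LINT x|lebesgue_on \<Omega>. (\<sigma> x / \<epsilon> + 1) * (wgrad \<Omega> \<omega> x \<bullet> wgrad \<Omega> \<phi> x)) = 0) \<and>
     (\<exists>w. evolution_solution \<Omega> X \<sigma> \<epsilon> T gt \<omega> w \<and>
          (\<forall>z. evolution_solution \<Omega> X \<sigma> \<epsilon> T gt \<omega> z \<longrightarrow> (\<forall>t\<in>{0..T}. \<forall>\<phi>\<in>X. z t \<phi> = w t \<phi>)) \<and>
          (\<forall>t\<in>{0..T}. AE x in lebesgue_on \<Omega>. u t x = ND_inverse \<Omega> X (w t) x))"

definition weak_solution ::
  "(real^'n) set \<Rightarrow> (real^'n \<Rightarrow> real) set \<Rightarrow> (real^'n \<Rightarrow> real) \<Rightarrow> real \<Rightarrow> real \<Rightarrow> (real^'n \<Rightarrow> real) \<Rightarrow>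
   (real \<Rightarrow> real^'n \<Rightarrow> real) \<Rightarrow> bool" where
  "weak_solution \<Omega> X \<sigma> \<epsilon> T gt V \<longleftrightarrow> (\<exists>\<omega> u. weak_solution_decomp \<Omega> X \<sigma> \<epsilon> T gt V \<omega> u)"

end

theory Submission
  imports Defs
begin

text \<open>Write \<open>s = \<sigma> / \<epsilon>\<close> and \<open>a = s + 1\<close>. The problem lives in the Hilbert space \<open>X\<close> with the inner
  product \<open>(\<nabla>u, \<nabla>v)\<close>, which is complete because \<open>H\<^sup>1\<close> is (\<open>H1_complete\<close>, resting on the
  Riesz--Fischer theorem \<open>L2_complete\<close>), because the trace is continuous (\<open>X_closed\<close>), and because the
  gradient norm controls the \<open>H\<^sup>1\<close> norm on \<open>X\<close>. That weak gradients are unique, so that \<open>wgrad\<close> is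
  linear up to null sets, is the fundamental lemma of the calculus of variations
  (\<open>fundamental_lemma_variations\<close>), proved with explicit smooth bump functions.

  The stationary part \<open>\<omega>\<close> comes from the Riesz representation theorem (\<open>riesz_exists\<close>) for the inner
  product \<open>\<integral> a \<nabla>u \<bullet> \<nabla>v\<close>, which is equivalent to the first one. For the evolution part,
  identify \<open>X\<^sup>*\<close> with \<open>X\<close>; the equation becomes \<open>u' + A u = f\<close> where \<open>A\<close> is the bounded, positive,
  self-adjoint operator given by \<open>(\<nabla>A u, \<nabla>\<phi>) = \<integral> s \<nabla>u \<bullet> \<nabla>\<phi>\<close>. Since \<open>A\<close> is
  self-adjoint, applying it to the solution is the same as applying it to the test function, so for
  each fixed \<open>\<phi>\<close> the solution is an explicit scalar power series (\<open>exp_curve\<close>, \<open>coeff\<close>,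
  \<open>evolution_exists\<close>). Since \<open>A\<close> is positive, the norm of a solution of the homogeneous equation
  does not increase (\<open>energy_decreases\<close>). Applied to the difference of two solutions this is
  uniqueness; applied to \<open>w'\<close>, which solves the homogeneous equation, it bounds \<open>w'\<close> by its initial
  value.

  For the estimate, let \<open>h = \<omega> - gt\<close>. The equation for \<open>\<omega>\<close> says that \<open>\<omega>\<close> is orthogonal to \<open>h\<close> in the
  \<open>a\<close>-weighted inner product, so the weighted energies of \<open>\<omega>\<close> and \<open>h\<close> add up to that of \<open>gt\<close>; keeping
  this Pythagorean identity, instead of bounding \<open>\<omega>\<close> and \<open>h\<close> separately by the triangle inequality,
  is what yields the constant \<open>2\<close> (\<open>stationary_bounds\<close>). The initial velocity of \<open>w\<close> simplifies to the functional
  \<open>\<phi> \<mapsto> - \<integral> s \<nabla>gt \<bullet> \<nabla>\<phi>\<close>, whose norm is at most \<open>\<parallel>s\<parallel>\<close> times \<open>\<parallel>\<nabla>gt\<parallel>\<close>, and the mean value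
  inequality turns this into a bound of \<open>u\<close>.\<close>

section \<open>Hilbert spaces of functions with a semi-definite inner product\<close>

text \<open>Functions stand for their classes modulo equality almost everywhere, so \<open>B\<close> is only semi-definite,
  and \<open>S\<close> is a set of functions closed under pointwise linear combinations.\<close>

locale semi_inner_space =
  fixes S :: "('a \<Rightarrow> real) set" and B :: "('a \<Rightarrow> real) \<Rightarrow> ('a \<Rightarrow> real) \<Rightarrow> real"
  assumes nonempty: "S \<noteq> {}"
    and lincomb: "u \<in> S \<Longrightarrow> v \<in> S \<Longrightarrow> (\<lambda>x. a * u x + b * v x) \<in> S"
    and B_lincomb: "u \<in> S \<Longrightarrow> v \<in> S \<Longrightarrow> w \<in> S \<Longrightarrow> B (\<lambda>x. a * u x + b * v x) w = a * B u w + b * B v w"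
    and B_sym: "u \<in> S \<Longrightarrow> v \<in> S \<Longrightarrow> B u v = B v u"
    and B_nonneg: "u \<in> S \<Longrightarrow> B u u \<ge> 0"
begin

definition nm :: "('a \<Rightarrow> real) \<Rightarrow> real" where
  "nm u = sqrt (B u u)"

lemma zero_mem: "(\<lambda>x. 0) \<in> S"
proof -
  obtain u where "u \<in> S" using nonempty by blast
  from lincomb[OF this this, of 0 0] show ?thesis by simp
qed

lemma scale_mem: "u \<in> S \<Longrightarrow> (\<lambda>x. a * u x) \<in> S"
  using lincomb[of u u a 0] by simp

lemma diff_mem: "u \<in> S \<Longrightarrow> v \<in> S \<Longrightarrow> (\<lambda>x. u x - v x) \<in> S"
  using lincomb[of u v 1 "-1"] by simp

lemma add_mem: "u \<in> S \<Longrightarrow> v \<in> S \<Longrightarrow> (\<lambda>x. u x + v x) \<in> S"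
  using lincomb[of u v 1 "1"] by simp

lemma B_lincomb_right:
  "u \<in> S \<Longrightarrow> v \<in> S \<Longrightarrow> w \<in> S \<Longrightarrow> B w (\<lambda>x. a * u x + b * v x) = a * B w u + b * B w v"
  using B_sym[of w "\<lambda>x. a * u x + b * v x"] B_sym[of w u] B_sym[of w v] by (simp add: lincomb B_lincomb)

lemma B_scale: "u \<in> S \<Longrightarrow> w \<in> S \<Longrightarrow> B (\<lambda>x. a * u x) w = a * B u w"
  using B_lincomb[of u u w a 0] by simp

lemma B_add: "u \<in> S \<Longrightarrow> v \<in> S \<Longrightarrow> w \<in> S \<Longrightarrow> B (\<lambda>x. u x + v x) w = B u w + B v w"
  using B_lincomb[of u v w 1 1] by simp

lemma B_diff: "u \<in> S \<Longrightarrow> v \<in> S \<Longrightarrow> w \<in> S \<Longrightarrow> B (\<lambda>x. u x - v x) w = B u w - B v w"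
  using B_lincomb[of u v w 1 "-1"] by simp

lemma B_zero: "w \<in> S \<Longrightarrow> B (\<lambda>x. 0) w = 0"
  using B_scale[OF zero_mem, of w 0] by simp

lemma nm_nonneg: "u \<in> S \<Longrightarrow> nm u \<ge> 0"
  by (simp add: nm_def B_nonneg)

lemma nm_square: "u \<in> S \<Longrightarrow> (nm u)\<^sup>2 = B u u"
  by (simp add: nm_def B_nonneg)

lemma nm_zero: "nm (\<lambda>x. 0) = 0"
  by (simp add: nm_def B_zero zero_mem)

lemma B_square:
  assumes "u \<in> S" "v \<in> S"
  shows "B (\<lambda>x. a * u x + b * v x) (\<lambda>x. a * u x + b * v x) = a\<^sup>2 * B u u + 2 * a * b * B u v + b\<^sup>2 * B v v"
  using assms by (simp add: B_lincomb B_lincomb_right lincomb B_sym[of v u] algebra_simps power2_eq_square)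

text \<open>Evaluating at \<open>t = - b / (a + 1)\<close> rather than at the minimizer \<open>- b / a\<close> covers \<open>a = 0\<close> as well.\<close>

lemma quadratic_nonneg_imp_linear_zero:
  fixes a b :: real
  assumes "\<And>t. t\<^sup>2 * a + 2 * t * b \<ge> 0" "a \<ge> 0"
  shows "b = 0"
proof (rule ccontr)
  assume "b \<noteq> 0"
  have "(-b/(a+1))\<^sup>2 * a + 2 * (-b/(a+1)) * b = - (b\<^sup>2 * (a+2)) / (a+1)\<^sup>2"
    using assms(2) by (simp add: field_simps power2_eq_square add_nonneg_eq_0_iff)
  also have "\<dots> < 0"
    using \<open>b \<noteq> 0\<close> assms(2) by (simp add: divide_less_0_iff add_pos_nonneg zero_less_mult_iff)
  finally show False using assms(1)[of "-b/(a+1)"] by simp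
qed

lemma Cauchy_Schwarz:
  assumes uv: "u \<in> S" "v \<in> S"
  shows "\<bar>B u v\<bar> \<le> nm u * nm v"
proof -
  have q: "a\<^sup>2 * B u u + 2 * a * b * B u v + b\<^sup>2 * B v v \<ge> 0" for a b
    using B_square[OF uv] B_nonneg[OF lincomb[OF uv]] by metis
  have "(B u v)\<^sup>2 \<le> B u u * B v v"
  proof (cases "B u u = 0")
    case True
    have "B u v = 0"
    proof (rule ccontr)
      assume "B u v \<noteq> 0"
      \<comment> \<open>The quadratic form degenerates to a linear function, which takes the value \<open>-1\<close> here.\<close>
      then show False using q[of "- (B v v + 1) / (2 * B u v)" 1] True by (simp add: field_simps)
    qed
    then show ?thesis using True by simp
  next
    case False
    then have pos: "B u u > 0" using B_nonneg[OF uv(1)] by simp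
    have "0 \<le> (B u v)\<^sup>2 * B u u + 2 * (B u v) * (- B u u) * B u v + (- B u u)\<^sup>2 * B v v" by (rule q)
    also have "\<dots> = B u u * (B u u * B v v - (B u v)\<^sup>2)" by (simp add: power2_eq_square algebra_simps)
    finally show ?thesis using pos by (simp add: zero_le_mult_iff)
  qed
  then have "sqrt ((B u v)\<^sup>2) \<le> sqrt (B u u * B v v)" by (rule real_sqrt_le_mono)
  then show ?thesis by (simp add: nm_def real_sqrt_mult)
qed

lemma nm_lincomb_le:
  assumes uv: "u \<in> S" "v \<in> S"
  shows "nm (\<lambda>x. a * u x + b * v x) \<le> \<bar>a\<bar> * nm u + \<bar>b\<bar> * nm v"
proof (rule power2_le_imp_le)
  have "(nm (\<lambda>x. a * u x + b * v x))\<^sup>2 = a\<^sup>2 * B u u + 2 * (a * b * B u v) + b\<^sup>2 * B v v"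
    by (simp add: nm_square[OF lincomb[OF uv]] B_square[OF uv])
  also have "a * b * B u v \<le> \<bar>a\<bar> * \<bar>b\<bar> * (nm u * nm v)"
    using mult_left_mono[OF Cauchy_Schwarz[OF uv], of "\<bar>a\<bar> * \<bar>b\<bar>"] abs_ge_self[of "a * b * B u v"]
    by (simp add: abs_mult)
  finally show "(nm (\<lambda>x. a * u x + b * v x))\<^sup>2 \<le> (\<bar>a\<bar> * nm u + \<bar>b\<bar> * nm v)\<^sup>2"
    by (simp add: nm_square[OF uv(1), symmetric] nm_square[OF uv(2), symmetric] power2_eq_square algebra_simps)
  show "0 \<le> \<bar>a\<bar> * nm u + \<bar>b\<bar> * nm v" by (simp add: nm_nonneg uv)
qed

lemma nm_add_le: "u \<in> S \<Longrightarrow> v \<in> S \<Longrightarrow> nm (\<lambda>x. u x + v x) \<le> nm u + nm v"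
  using nm_lincomb_le[of u v 1 1] by simp

lemma nm_diff_le: "u \<in> S \<Longrightarrow> v \<in> S \<Longrightarrow> nm (\<lambda>x. u x - v x) \<le> nm u + nm v"
  using nm_lincomb_le[of u v 1 "-1"] by simp

lemma nm_minus: "nm (\<lambda>x. - u x) = nm u" if "u \<in> S"
  using B_square[OF that that, of "-1" 0] by (simp add: nm_def)

lemma nm_minus_commute: "nm (\<lambda>x. u x - v x) = nm (\<lambda>x. v x - u x)" if "u \<in> S" "v \<in> S"
  using nm_minus[OF diff_mem[OF that]] by simp

lemma nm_triangle: "u \<in> S \<Longrightarrow> v \<in> S \<Longrightarrow> nm u \<le> nm v + nm (\<lambda>x. u x - v x)"
  using nm_add_le[of v "\<lambda>x. u x - v x"] by (simp add: diff_mem)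

lemma nm_eq_if_nm_diff_0:
  assumes "u \<in> S" "v \<in> S" "nm (\<lambda>x. u x - v x) = 0"
  shows "nm u = nm v"
  using nm_triangle[of u v] nm_triangle[of v u] nm_minus_commute[of u v] assms by simp

text \<open>Two derivatives of the same curve agree up to a function of seminorm zero: both are limits of
  the same difference quotients, and no point of \<open>[0,T]\<close> is isolated.\<close>

lemma C1_deriv_unique:
  assumes T: "T > 0" and v1: "has_C1_deriv T S nm v v1" and v2: "has_C1_deriv T S nm v v2" and t: "t \<in> {0..T}"
  shows "nm (v1 t) = nm (v2 t)"
proof (rule nm_eq_if_nm_diff_0)
  show m: "v1 t \<in> S" "v2 t \<in> S" using v1 v2 t unfolding has_C1_deriv_def by auto
  define q where "q s = (\<lambda>x. (v s x - v t x) / (s - t))" for s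
  have qS: "q s \<in> S" if "s \<in> {0..T}" for s
    using lincomb[of "v s" "v t" "1/(s-t)" "-1/(s-t)"] v1 t that
    unfolding has_C1_deriv_def q_def by (simp add: diff_divide_distrib)
  have l1: "((\<lambda>s. nm (\<lambda>x. q s x - v1 t x)) \<longlongrightarrow> 0) (at t within {0..T})"
   and l2: "((\<lambda>s. nm (\<lambda>x. q s x - v2 t x)) \<longlongrightarrow> 0) (at t within {0..T})"
    using v1 v2 t unfolding has_C1_deriv_def q_def by auto
  have "((\<lambda>s. nm (\<lambda>x. v1 t x - v2 t x)) \<longlongrightarrow> 0) (at t within {0..T})"
  proof (rule tendsto_sandwich)
    show "\<forall>\<^sub>F s in at t within {0..T}. 0 \<le> nm (\<lambda>x. v1 t x - v2 t x)"
      by (simp add: nm_nonneg diff_mem m)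
    show "\<forall>\<^sub>F s in at t within {0..T}. nm (\<lambda>x. v1 t x - v2 t x)
       \<le> nm (\<lambda>x. q s x - v2 t x) + nm (\<lambda>x. q s x - v1 t x)"
      unfolding eventually_at_filter
    proof (rule always_eventually, intro allI impI)
      fix s assume "s \<in> {0..T}"
      from qS[OF this] m show "nm (\<lambda>x. v1 t x - v2 t x) \<le> nm (\<lambda>x. q s x - v2 t x) + nm (\<lambda>x. q s x - v1 t x)"
        using nm_diff_le[of "\<lambda>x. q s x - v2 t x" "\<lambda>x. q s x - v1 t x"] by (simp add: diff_mem)
    qed
    show "((\<lambda>s. nm (\<lambda>x. q s x - v2 t x) + nm (\<lambda>x. q s x - v1 t x)) \<longlongrightarrow> 0) (at t within {0..T})"
      using tendsto_add[OF l2 l1] by simp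
  qed simp
  moreover have "at t within {0..T} \<noteq> bot"
    using t T by (simp add: trivial_limit_within islimpt_Icc)
  ultimately show "nm (\<lambda>x. v1 t x - v2 t x) = 0"
    using tendsto_unique[OF _ tendsto_const] by blast
qed

end

locale semi_hilbert = semi_inner_space +
  assumes complete: "(\<And>n::nat. f n \<in> S) \<Longrightarrow>
      (\<And>e. e > 0 \<Longrightarrow> \<exists>N. \<forall>m\<ge>N. \<forall>n\<ge>N. B (\<lambda>x. f m x - f n x) (\<lambda>x. f m x - f n x) < e) \<Longrightarrow>
      \<exists>l\<in>S. (\<lambda>n. B (\<lambda>x. f n x - l x) (\<lambda>x. f n x - l x)) \<longlonglongrightarrow> 0"
begin

definition dual :: "(('a \<Rightarrow> real) \<Rightarrow> real) set" where
  "dual = {\<zeta>. (\<forall>u\<in>S. \<forall>v\<in>S. \<forall>a b. \<zeta> (\<lambda>x. a * u x + b * v x) = a * \<zeta> u + b * \<zeta> v) \<and>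
     (\<exists>C. \<forall>u\<in>S. \<bar>\<zeta> u\<bar> \<le> C * nm u)}"

definition dnorm :: "(('a \<Rightarrow> real) \<Rightarrow> real) \<Rightarrow> real" where
  "dnorm \<zeta> = (SUP u\<in>{u\<in>S. nm u \<le> 1}. \<bar>\<zeta> u\<bar>)"

text \<open>The representing element is determined up to functions of seminorm zero, whence the choice.\<close>

definition riesz :: "(('a \<Rightarrow> real) \<Rightarrow> real) \<Rightarrow> 'a \<Rightarrow> real" where
  "riesz \<zeta> = (SOME \<psi>. \<psi> \<in> S \<and> (\<forall>\<phi>\<in>S. B \<psi> \<phi> = \<zeta> \<phi>))"

lemma dualI:
  assumes "\<And>u v a b. u \<in> S \<Longrightarrow> v \<in> S \<Longrightarrow> \<zeta> (\<lambda>x. a * u x + b * v x) = a * \<zeta> u + b * \<zeta> v"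
    and "\<And>u. u \<in> S \<Longrightarrow> \<bar>\<zeta> u\<bar> \<le> C * nm u"
  shows "\<zeta> \<in> dual"
  using assms unfolding dual_def by blast

lemma dual_lincomb_arg:
  "\<zeta> \<in> dual \<Longrightarrow> u \<in> S \<Longrightarrow> v \<in> S \<Longrightarrow> \<zeta> (\<lambda>x. a * u x + b * v x) = a * \<zeta> u + b * \<zeta> v"
  unfolding dual_def by blast

lemma dual_bound:
  assumes "\<zeta> \<in> dual" obtains C where "C \<ge> 0" "\<And>u. u \<in> S \<Longrightarrow> \<bar>\<zeta> u\<bar> \<le> C * nm u"
proof -
  from assms obtain C where C: "\<And>u. u \<in> S \<Longrightarrow> \<bar>\<zeta> u\<bar> \<le> C * nm u" unfolding dual_def by blast
  have "\<bar>\<zeta> u\<bar> \<le> max C 0 * nm u" if "u \<in> S" for u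
    by (rule order_trans[OF C[OF that]]) (simp add: mult_right_mono nm_nonneg that)
  then show ?thesis using that[of "max C 0"] by simp
qed

lemma dual_B: "u \<in> S \<Longrightarrow> B u \<in> dual"
  by (rule dualI[of _ "nm u"]) (auto simp: B_lincomb_right Cauchy_Schwarz)

text \<open>The minimizer of \<open>J u = B u u - 2 * \<zeta> u\<close> represents \<open>\<zeta>\<close>. The parallelogram law shows that a minimizing
  sequence is Cauchy; the Euler equation is obtained by letting \<open>n\<close> tend to infinity in the inequality
  \<open>J (f n + t \<phi>) \<ge> J (f n) - 1 / (n + 1)\<close>.\<close>

lemma riesz_exists:
  assumes \<zeta>: "\<zeta> \<in> dual"
  shows "\<exists>\<psi>\<in>S. \<forall>\<phi>\<in>S. B \<psi> \<phi> = \<zeta> \<phi>"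
proof -
  obtain C where C: "C \<ge> 0" "\<And>u. u \<in> S \<Longrightarrow> \<bar>\<zeta> u\<bar> \<le> C * nm u" using dual_bound[OF \<zeta>] by blast
  define J where "J u = B u u - 2 * \<zeta> u" for u
  have lower: "J u \<ge> - C\<^sup>2" if "u \<in> S" for u
  proof -
    have "\<zeta> u \<le> C * nm u" using C(2)[OF that] by simp
    moreover have "0 \<le> (nm u - C)\<^sup>2" by simp
    ultimately show ?thesis unfolding J_def nm_square[OF that, symmetric]
      by (simp add: power2_diff) (simp add: algebra_simps)
  qed
  define d where "d = (INF u\<in>S. J u)"
  have bdd: "bdd_below (J ` S)" using lower by (auto intro!: bdd_belowI[of _ "-C\<^sup>2"])
  have dle: "d \<le> J u" if "u \<in> S" for u unfolding d_def using bdd that by (rule cINF_lower)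
  have "\<exists>u\<in>S. J u < d + 1 / (real n + 1)" for n
  proof (rule ccontr)
    assume "\<not> ?thesis"
    then have "d + 1 / (real n + 1) \<le> d"
      unfolding d_def by (intro cINF_greatest[OF nonempty]) (auto simp: not_less d_def)
    then show False by (simp add: divide_le_0_iff)
  qed
  then obtain f where f: "\<And>n. f n \<in> S" "\<And>n. J (f n) < d + 1 / (real n + 1)" by metis
  have parallelogram: "B (\<lambda>x. u x - v x) (\<lambda>x. u x - v x) = 2 * J u + 2 * J v - 4 * J (\<lambda>x. (1/2) * u x + (1/2) * v x)"
    if "u \<in> S" "v \<in> S" for u v
    using B_square[OF that, of 1 "-1"] B_square[OF that, of "1/2" "1/2"]
      dual_lincomb_arg[OF \<zeta> that, of "1/2" "1/2"]
    by (simp add: J_def power2_eq_square algebra_simps)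
  have le: "B (\<lambda>x. f m x - f n x) (\<lambda>x. f m x - f n x) \<le> 2 / (real m + 1) + 2 / (real n + 1)" for m n
    using parallelogram[OF f(1) f(1), of m n] f(2)[of m] f(2)[of n]
      dle[OF lincomb[OF f(1) f(1)], of "1/2" m "1/2" n] by simp
  have "\<exists>l\<in>S. (\<lambda>n. B (\<lambda>x. f n x - l x) (\<lambda>x. f n x - l x)) \<longlonglongrightarrow> 0"
  proof (rule complete[OF f(1)])
    fix e :: real assume "e > 0"
    then obtain N :: nat where N: "4 / e < real N" using reals_Archimedean2 by blast
    have tail: "2 / (real m + 1) < e / 2" if "m \<ge> N" for m
    proof -
      have "4 / e < real m + 1" using N that by linarith
      then show ?thesis using \<open>e > 0\<close> by (simp add: field_simps)
    qed
    have "B (\<lambda>x. f m x - f n x) (\<lambda>x. f m x - f n x) < e" if "m \<ge> N" "n \<ge> N" for m n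
      
      using le[of m n] tail[OF that(1)] tail[OF that(2)] by linarith
    then show "\<exists>N. \<forall>m\<ge>N. \<forall>n\<ge>N. B (\<lambda>x. f m x - f n x) (\<lambda>x. f m x - f n x) < e" by blast
  qed
  then obtain l where l: "l \<in> S" "(\<lambda>n. B (\<lambda>x. f n x - l x) (\<lambda>x. f n x - l x)) \<longlonglongrightarrow> 0" by blast
  have "B l \<phi> = \<zeta> \<phi>" if \<phi>: "\<phi> \<in> S" for \<phi>
  proof -
    have lim: "(\<lambda>n. B (f n) \<phi>) \<longlonglongrightarrow> B l \<phi>"
    proof (rule LIM_zero_cancel, rule Lim_null_comparison)
      show "\<forall>\<^sub>F n in sequentially. norm (B (f n) \<phi> - B l \<phi>) \<le> sqrt (B (\<lambda>x. f n x - l x) (\<lambda>x. f n x - l x)) * nm \<phi>"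
        using Cauchy_Schwarz[OF diff_mem[OF f(1) l(1)] \<phi>]
        by (intro always_eventually allI) (simp add: B_diff[OF f(1) l(1) \<phi>] nm_def)
      show "(\<lambda>n. sqrt (B (\<lambda>x. f n x - l x) (\<lambda>x. f n x - l x)) * nm \<phi>) \<longlonglongrightarrow> 0"
        using tendsto_mult[OF tendsto_real_sqrt[OF l(2)] tendsto_const] by simp
    qed
    have "B l \<phi> - \<zeta> \<phi> = 0"
    proof (rule quadratic_nonneg_imp_linear_zero)
      fix t :: real
      have "t\<^sup>2 * B \<phi> \<phi> + 2 * t * (B (f n) \<phi> - \<zeta> \<phi>) + 1 / (real n + 1) \<ge> 0" for n
        using dle[OF lincomb[OF f(1) \<phi>], of 1 n t] f(2)[of n]
          B_square[OF f(1) \<phi>, of 1 n t] dual_lincomb_arg[OF \<zeta> f(1) \<phi>, of 1 n t]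
        by (simp add: J_def algebra_simps)
      moreover have "(\<lambda>n. t\<^sup>2 * B \<phi> \<phi> + 2 * t * (B (f n) \<phi> - \<zeta> \<phi>) + 1 / (real n + 1))
          \<longlonglongrightarrow> t\<^sup>2 * B \<phi> \<phi> + 2 * t * (B l \<phi> - \<zeta> \<phi>) + 0"
        using LIMSEQ_inverse_real_of_nat
        by (intro tendsto_intros lim) (simp add: inverse_eq_divide add.commute)
      ultimately show "t\<^sup>2 * B \<phi> \<phi> + 2 * t * (B l \<phi> - \<zeta> \<phi>) \<ge> 0"
        by (metis (no_types, lifting) LIMSEQ_le_const add_0_right)
    qed (rule B_nonneg[OF \<phi>])
    then show ?thesis by simp
  qed
  with l(1) show ?thesis by blast
qed

lemma riesz:
  assumes "\<zeta> \<in> dual"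
  shows riesz_mem: "riesz \<zeta> \<in> S" and B_riesz: "\<phi> \<in> S \<Longrightarrow> B (riesz \<zeta>) \<phi> = \<zeta> \<phi>"
proof -
  have "\<exists>\<psi>. \<psi> \<in> S \<and> (\<forall>\<phi>\<in>S. B \<psi> \<phi> = \<zeta> \<phi>)" using riesz_exists[OF assms] by blast
  from someI_ex[OF this] show "riesz \<zeta> \<in> S" "\<phi> \<in> S \<Longrightarrow> B (riesz \<zeta>) \<phi> = \<zeta> \<phi>"
    unfolding riesz_def by blast+
qed

lemma riesz_cong: "(\<And>\<phi>. \<phi> \<in> S \<Longrightarrow> \<zeta> \<phi> = \<eta> \<phi>) \<Longrightarrow> riesz \<zeta> = riesz \<eta>"
  unfolding riesz_def by (rule arg_cong[where f = Eps]) auto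

text \<open>The supremum defining the dual norm is attained at the normalized representing element.\<close>

lemma dnorm_eq_nm:
  assumes "\<psi> \<in> S" "\<And>\<phi>. \<phi> \<in> S \<Longrightarrow> B \<psi> \<phi> = \<zeta> \<phi>"
  shows "dnorm \<zeta> = nm \<psi>"
proof -
  have le: "\<bar>\<zeta> u\<bar> \<le> nm \<psi> * nm u" if "u \<in> S" for u
    using Cauchy_Schwarz[OF assms(1) that] assms(2)[OF that] by simp
  have le1: "\<bar>\<zeta> u\<bar> \<le> nm \<psi>" if "u \<in> S" "nm u \<le> 1" for u
    using le[OF that(1)] mult_left_mono[OF that(2) nm_nonneg[OF assms(1)]] by simp
  show ?thesis
  proof (rule antisym)
    show "dnorm \<zeta> \<le> nm \<psi>" unfolding dnorm_def
      using zero_mem nm_zero le1 by (intro cSUP_least) auto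
    show "nm \<psi> \<le> dnorm \<zeta>"
    proof (cases "nm \<psi> = 0")
      case True
      have "\<bar>\<zeta> (\<lambda>x. 0)\<bar> \<le> dnorm \<zeta>" unfolding dnorm_def
        using zero_mem nm_zero le1 by (intro cSUP_upper) (auto intro!: bdd_aboveI[of _ "nm \<psi>"])
      then show ?thesis using True by simp
    next
      case False
      then have pos: "nm \<psi> > 0" using nm_nonneg[OF assms(1)] by simp
      define u where "u = (\<lambda>x. (1 / nm \<psi>) * \<psi> x)"
      have u: "u \<in> S" unfolding u_def by (rule scale_mem[OF assms(1)])
      have "B u u = 1" using B_square[OF assms(1) assms(1), of "1/nm \<psi>" 0] pos nm_square[OF assms(1)]
        unfolding u_def by (simp add: power_divide) (metis less_irrefl zero_eq_power2)
      then have n1: "nm u = 1" by (simp add: nm_def)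
      have "\<zeta> u = (1 / nm \<psi>) * B \<psi> \<psi>"
        using assms(2)[OF u] B_sym[OF assms(1) u] B_scale[OF assms(1) assms(1), of "1/nm \<psi>"]
        unfolding u_def by simp
      then have "\<zeta> u = nm \<psi>"
        using pos by (simp add: nm_square[OF assms(1), symmetric] power2_eq_square)
      moreover have "\<bar>\<zeta> u\<bar> \<le> dnorm \<zeta>" unfolding dnorm_def
        using u n1 le1 by (intro cSUP_upper) (auto intro!: bdd_aboveI[of _ "nm \<psi>"])
      ultimately show ?thesis by simp
    qed
  qed
qed

lemma dnorm_riesz: "\<zeta> \<in> dual \<Longrightarrow> dnorm \<zeta> = nm (riesz \<zeta>)"
  by (rule dnorm_eq_nm) (auto simp: riesz)

lemma dnorm_nonneg: "\<zeta> \<in> dual \<Longrightarrow> dnorm \<zeta> \<ge> 0"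
  by (simp add: dnorm_riesz nm_nonneg riesz)

lemma dual_le_dnorm: "\<zeta> \<in> dual \<Longrightarrow> u \<in> S \<Longrightarrow> \<bar>\<zeta> u\<bar> \<le> dnorm \<zeta> * nm u"
  using Cauchy_Schwarz[OF riesz_mem, of \<zeta> u] by (simp add: dnorm_riesz riesz)

lemma dnorm_le:
  assumes "\<And>u. u \<in> S \<Longrightarrow> \<bar>\<zeta> u\<bar> \<le> C * nm u" "C \<ge> 0"
  shows "dnorm \<zeta> \<le> C"
  unfolding dnorm_def
proof (rule cSUP_least)
  show "{u \<in> S. nm u \<le> 1} \<noteq> {}" using zero_mem nm_zero by auto
  fix u assume "u \<in> {u \<in> S. nm u \<le> 1}"
  then show "\<bar>\<zeta> u\<bar> \<le> C" using assms(1)[of u] mult_left_mono[of "nm u" 1 C] assms(2) by auto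
qed

lemma dual_lincomb: "\<zeta> \<in> dual \<Longrightarrow> \<eta> \<in> dual \<Longrightarrow> (\<lambda>\<phi>. a * \<zeta> \<phi> + b * \<eta> \<phi>) \<in> dual"
proof (rule dualI[of _ "\<bar>a\<bar> * dnorm \<zeta> + \<bar>b\<bar> * dnorm \<eta>"])
  fix u assume *: "u \<in> S" "\<zeta> \<in> dual" "\<eta> \<in> dual"
  have "\<bar>a * \<zeta> u + b * \<eta> u\<bar> \<le> \<bar>a\<bar> * \<bar>\<zeta> u\<bar> + \<bar>b\<bar> * \<bar>\<eta> u\<bar>" by (metis abs_mult abs_triangle_ineq)
  also have "\<dots> \<le> \<bar>a\<bar> * (dnorm \<zeta> * nm u) + \<bar>b\<bar> * (dnorm \<eta> * nm u)"
    by (intro add_mono mult_left_mono dual_le_dnorm *) auto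
  finally show "\<bar>a * \<zeta> u + b * \<eta> u\<bar> \<le> (\<bar>a\<bar> * dnorm \<zeta> + \<bar>b\<bar> * dnorm \<eta>) * nm u" by (simp add: algebra_simps)
qed (auto simp: dual_lincomb_arg algebra_simps)

lemma dual_diff: "\<zeta> \<in> dual \<Longrightarrow> \<eta> \<in> dual \<Longrightarrow> (\<lambda>\<phi>. \<zeta> \<phi> - \<eta> \<phi>) \<in> dual"
  using dual_lincomb[of \<zeta> \<eta> 1 "-1"] by simp

lemma dual_quotient:
  "\<zeta> \<in> dual \<Longrightarrow> \<eta> \<in> dual \<Longrightarrow> \<xi> \<in> dual \<Longrightarrow> (\<lambda>\<phi>. (\<zeta> \<phi> - \<eta> \<phi>) / c - \<xi> \<phi>) \<in> dual"
  using dual_lincomb[OF dual_diff, of \<zeta> \<eta> \<xi> "1/c" "-1"] by simp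

lemma quotient_mem:
  "u \<in> S \<Longrightarrow> v \<in> S \<Longrightarrow> w \<in> S \<Longrightarrow> (\<lambda>x. (u x - v x) / c - w x) \<in> S"
  using lincomb[OF diff_mem, of u v w "1/c" "-1"] by simp

lemma B_quotient:
  "u \<in> S \<Longrightarrow> v \<in> S \<Longrightarrow> w \<in> S \<Longrightarrow> \<phi> \<in> S \<Longrightarrow> B (\<lambda>x. (u x - v x) / c - w x) \<phi> = (B u \<phi> - B v \<phi>) / c - B w \<phi>"
  using B_lincomb[OF diff_mem, of u v w \<phi> "1/c" "-1"] by (simp add: B_diff)

lemma nm_riesz_diff:
  "\<zeta> \<in> dual \<Longrightarrow> \<eta> \<in> dual \<Longrightarrow> nm (\<lambda>x. riesz \<zeta> x - riesz \<eta> x) = dnorm (\<lambda>\<phi>. \<zeta> \<phi> - \<eta> \<phi>)"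
  by (rule dnorm_eq_nm[symmetric]) (auto simp: riesz diff_mem B_diff)

text \<open>Since the Riesz map is a linear isometry, it carries \<open>C\<^sup>1\<close> curves to \<open>C\<^sup>1\<close> curves.\<close>

lemma riesz_C1:
  assumes w: "has_C1_deriv T dual dnorm w w'"
  shows "has_C1_deriv T S nm (\<lambda>t. riesz (w t)) (\<lambda>t. riesz (w' t))"
  unfolding has_C1_deriv_def
proof (intro ballI conjI)
  fix t assume t: "t \<in> {0..T}"
  have d: "w s \<in> dual" "w' s \<in> dual" if "s \<in> {0..T}" for s
    using w that unfolding has_C1_deriv_def by auto
  show "riesz (w t) \<in> S" "riesz (w' t) \<in> S" using d[OF t] riesz_mem by auto
  have "nm (\<lambda>x. (riesz (w s) x - riesz (w t) x) / (s - t) - riesz (w' t) x)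
      = dnorm (\<lambda>\<phi>. (w s \<phi> - w t \<phi>) / (s - t) - w' t \<phi>)" if "s \<in> {0..T}" for s
    using d[OF t] d[OF that]
    by (intro dnorm_eq_nm[symmetric]) (auto simp: riesz quotient_mem B_quotient)
  then show "((\<lambda>s. nm (\<lambda>x. (riesz (w s) x - riesz (w t) x) / (s - t) - riesz (w' t) x)) \<longlongrightarrow> 0) (at t within {0..T})"
    using w t unfolding has_C1_deriv_def
    by (subst tendsto_cong[OF eventually_at_filter[THEN iffD2]]) (auto intro!: always_eventually)
  have "nm (\<lambda>x. riesz (w' s) x - riesz (w' t) x) = dnorm (\<lambda>\<phi>. w' s \<phi> - w' t \<phi>)" if "s \<in> {0..T}" for s
    using d[OF t] d[OF that] by (intro nm_riesz_diff)
  then show "((\<lambda>s. nm (\<lambda>x. riesz (w' s) x - riesz (w' t) x)) \<longlongrightarrow> 0) (at t within {0..T})"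
    using w t unfolding has_C1_deriv_def
    by (subst tendsto_cong[OF eventually_at_filter[THEN iffD2]]) (auto intro!: always_eventually)
qed

end

section \<open>The linear evolution equation\<close>

text \<open>Coefficients growing at most geometrically give an entire function whose derivative is obtained by
  shifting the coefficient sequence.\<close>

lemma exp_type_series:
  fixes a :: "nat \<Rightarrow> real"
  assumes a: "\<And>k. \<bar>a k\<bar> \<le> M * L ^ k"
  defines "p \<equiv> \<lambda>b t. (\<Sum>k. b k / fact k * t ^ k)"
  shows exp_type_summable: "summable (\<lambda>k. a k / fact k * t ^ k)"
    and exp_type_bound: "\<bar>p a t\<bar> \<le> M * exp (L * \<bar>t\<bar>)"
    and exp_type_deriv: "(p a has_real_derivative p (\<lambda>k. a (Suc k)) t) (at t)"
proof -
  have sums: "(\<lambda>k. M * ((L * \<bar>t\<bar>) ^ k / fact k)) sums (M * exp (L * \<bar>t\<bar>))" for t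
    using sums_mult[OF exp_converges[of "L * \<bar>t\<bar>"], of M] by (simp add: scaleR_conv_of_real field_simps)
  have le: "norm (a k / fact k * t ^ k) \<le> M * ((L * \<bar>t\<bar>) ^ k / fact k)" for k t
    using mult_right_mono[OF a[of k], of "\<bar>t\<bar> ^ k / fact k"]
    by (simp add: abs_mult power_abs power_mult_distrib field_simps)
  have summ: "summable (\<lambda>k. a k / fact k * t ^ k)" for t
    by (rule summable_comparison_test'[OF sums_summable[OF sums[of t]]]) (rule le)
  then show "summable (\<lambda>k. a k / fact k * t ^ k)" .
  have "norm (p a t) \<le> (\<Sum>k. M * ((L * \<bar>t\<bar>) ^ k / fact k))"
    unfolding p_def by (rule norm_suminf_le[OF le sums_summable[OF sums]])
  then show "\<bar>p a t\<bar> \<le> M * exp (L * \<bar>t\<bar>)" using sums_unique[OF sums[of t]] by simp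
  have "diffs (\<lambda>k. a k / fact k) = (\<lambda>k. a (Suc k) / fact k)"
    by (rule ext) (simp add: diffs_def field_simps del: of_nat_Suc)
  then show "(p a has_real_derivative p (\<lambda>k. a (Suc k)) t) (at t)"
    using termdiffs_strong_converges_everywhere[OF summ, of t] by (simp add: p_def)
qed

context semi_inner_space
begin

text \<open>With \<open>D = u s - u t\<close> and \<open>r\<close> the error of the difference quotient, \<open>D = (s - t) * (r + u' t)\<close> and hence
  the error of the difference quotient of \<open>B (u s) (u s)\<close> is \<open>2 B r (u t) + B r D + B (u' t) D\<close>, where
  each term has a factor that tends to zero.\<close>

lemma C1_deriv_B_square:
  assumes u: "has_C1_deriv T S nm u u'" and t: "t \<in> {0..T}"
  shows "((\<lambda>s. B (u s) (u s)) has_real_derivative 2 * B (u' t) (u t)) (at t within {0..T})"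
  unfolding has_field_derivative_iff
proof (rule LIM_zero_cancel, rule Lim_null_comparison)
  define e where "e s = nm (\<lambda>x. (u s x - u t x) / (s - t) - u' t x)" for s
  define n where "n = nm (u' t)"
  define d where "d s = \<bar>s - t\<bar> * (e s + n)" for s
  have m: "u s \<in> S" "u' s \<in> S" if "s \<in> {0..T}" for s
    using u that unfolding has_C1_deriv_def by auto
  have "norm ((B (u s) (u s) - B (u t) (u t)) / (s - t) - 2 * B (u' t) (u t))
      \<le> e s * (2 * nm (u t) + d s) + n * d s" if s: "s \<in> {0..T}" "s \<noteq> t" for s
  proof -
    define r where "r = (\<lambda>x. (u s x - u t x) / (s - t) - u' t x)"
    define D where "D = (\<lambda>x. u s x - u t x)"
    have DS: "D \<in> S" unfolding D_def by (intro diff_mem m s t)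
    have rS: "r \<in> S"
      using lincomb[OF DS m(2)[OF t], of "1/(s-t)" "-1"] unfolding r_def D_def by simp
    have ne: "s - t \<noteq> 0" using s by simp
    have D: "D = (\<lambda>x. (s - t) * r x + (s - t) * u' t x)"
      using ne by (auto simp: D_def r_def fun_eq_iff field_simps)
    have "nm D \<le> \<bar>s - t\<bar> * nm r + \<bar>s - t\<bar> * n" unfolding n_def
      by (subst D) (rule nm_lincomb_le[OF rS m(2)[OF t]])
    then have nD: "nm D \<le> d s" by (simp add: d_def e_def r_def algebra_simps)
    have us: "u s = (\<lambda>x. u t x + D x)" by (auto simp: D_def)
    have "B (u s) (u s) = B (u t) (u t) + 2 * B D (u t) + B D D"
      using B_square[OF m(1)[OF t] DS, of 1 1] B_sym[OF m(1)[OF t] DS] unfolding us by simp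
    moreover have DB: "B D v = (s - t) * B r v + (s - t) * B (u' t) v" if "v \<in> S" for v
      by (subst D) (rule B_lincomb[OF rS m(2)[OF t] that])
    ultimately have "B (u s) (u s) - B (u t) (u t)
        = (s - t) * (2 * B r (u t) + 2 * B (u' t) (u t) + B r D + B (u' t) D)"
      using DB[OF DS] DB[OF m(1)[OF t]] by (simp add: algebra_simps)
    then have "(B (u s) (u s) - B (u t) (u t)) / (s - t) - 2 * B (u' t) (u t)
        = 2 * B r (u t) + B r D + B (u' t) D"
      using ne by simp
    moreover have "\<bar>B r (u t)\<bar> \<le> e s * nm (u t)"
      using Cauchy_Schwarz[OF rS m(1)[OF t]] by (simp add: e_def r_def)
    moreover have "\<bar>B r D\<bar> \<le> e s * d s"
      using Cauchy_Schwarz[OF rS DS] mult_left_mono[OF nD nm_nonneg[OF rS]] by (simp add: e_def r_def)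
    moreover have "\<bar>B (u' t) D\<bar> \<le> n * d s"
      using Cauchy_Schwarz[OF m(2)[OF t] DS] mult_left_mono[OF nD nm_nonneg[OF m(2)[OF t]]] by (simp add: n_def)
    ultimately show ?thesis by (simp add: algebra_simps)
  qed
  then show "\<forall>\<^sub>F s in at t within {0..T}.
      norm ((B (u s) (u s) - B (u t) (u t)) / (s - t) - 2 * B (u' t) (u t)) \<le> e s * (2 * nm (u t) + d s) + n * d s"
    unfolding eventually_at_filter by (intro always_eventually) simp
  have e: "(e \<longlongrightarrow> 0) (at t within {0..T})"
    using u t unfolding has_C1_deriv_def e_def by blast
  have "((\<lambda>s. \<bar>s - t\<bar>) \<longlongrightarrow> \<bar>t - t\<bar>) (at t within {0..T})" by (intro tendsto_intros)
  then have "(d \<longlongrightarrow> \<bar>t - t\<bar> * (0 + n)) (at t within {0..T})"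
    unfolding d_def by (intro tendsto_mult tendsto_add e tendsto_const)
  then have d: "(d \<longlongrightarrow> 0) (at t within {0..T})" by simp
  have "((\<lambda>s. e s * (2 * nm (u t) + d s) + n * d s) \<longlongrightarrow> 0 * (2 * nm (u t) + 0) + n * 0) (at t within {0..T})"
    by (intro tendsto_intros e d)
  then show "((\<lambda>s. e s * (2 * nm (u t) + d s) + n * d s) \<longlongrightarrow> 0) (at t within {0..T})" by simp
qed

end

context semi_hilbert
begin

lemma dnorm_cong: "(\<And>\<phi>. \<phi> \<in> S \<Longrightarrow> \<zeta> \<phi> = \<eta> \<phi>) \<Longrightarrow> dnorm \<zeta> = dnorm \<eta>"
  unfolding dnorm_def by (auto intro!: SUP_cong)

lemma dual_cong: "\<eta> \<in> dual \<Longrightarrow> (\<And>\<phi>. \<phi> \<in> S \<Longrightarrow> \<zeta> \<phi> = \<eta> \<phi>) \<Longrightarrow> \<zeta> \<in> dual"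
  unfolding dual_def by (auto simp: lincomb)

lemma C1_dual_eval:
  assumes w: "has_C1_deriv T dual dnorm w w'" and t: "t \<in> {0..T}" and \<phi>: "\<phi> \<in> S"
  shows "((\<lambda>s. w s \<phi>) has_real_derivative w' t \<phi>) (at t within {0..T})"
  unfolding has_field_derivative_iff
proof (rule LIM_zero_cancel, rule Lim_null_comparison)
  have d: "w s \<in> dual" "w' s \<in> dual" if "s \<in> {0..T}" for s
    using w that unfolding has_C1_deriv_def by auto
  show "\<forall>\<^sub>F s in at t within {0..T}. norm ((w s \<phi> - w t \<phi>) / (s - t) - w' t \<phi>)
      \<le> dnorm (\<lambda>\<phi>. (w s \<phi> - w t \<phi>) / (s - t) - w' t \<phi>) * nm \<phi>"
    unfolding eventually_at_filter
    using dual_le_dnorm[OF dual_quotient[OF d(1) d(1)[OF t] d(2)[OF t]] \<phi>]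
    by (intro always_eventually) simp
  show "((\<lambda>s. dnorm (\<lambda>\<phi>. (w s \<phi> - w t \<phi>) / (s - t) - w' t \<phi>) * nm \<phi>) \<longlongrightarrow> 0) (at t within {0..T})"
    using w t unfolding has_C1_deriv_def by (intro tendsto_mult_left_zero) blast
qed

text \<open>The scalar mean value inequality, uniformly over the test elements.\<close>

lemma C1_dual_growth:
  assumes w: "has_C1_deriv T dual dnorm w w'" and t: "t \<in> {0..T}"
    and D: "\<And>s. s \<in> {0..T} \<Longrightarrow> dnorm (w' s) \<le> D"
  shows "dnorm (w t) \<le> dnorm (w 0) + D * t"
proof (rule dnorm_le)
  have d: "w s \<in> dual" "w' s \<in> dual" if "s \<in> {0..T}" for s
    using w that unfolding has_C1_deriv_def by auto
  have t0: "0 \<in> {0..T}" using t by simp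
  have D0: "D \<ge> 0" using D[OF t0] dnorm_nonneg[OF d(2)[OF t0]] by linarith
  show "0 \<le> dnorm (w 0) + D * t" using D0 t dnorm_nonneg[OF d(1)[OF t0]] by simp
  fix \<phi> assume \<phi>: "\<phi> \<in> S"
  have "norm (w t \<phi> - w 0 \<phi>) \<le> (D * nm \<phi>) * norm (t - 0)"
  proof (rule field_differentiable_bound[where S = "{0..T}" and f' = "\<lambda>s. w' s \<phi>"])
    fix s assume s: "s \<in> {0..T}"
    show "norm (w' s \<phi>) \<le> D * nm \<phi>"
      using dual_le_dnorm[OF d(2)[OF s] \<phi>] mult_right_mono[OF D[OF s] nm_nonneg[OF \<phi>]] by simp
  qed (use t in \<open>auto intro!: C1_dual_eval[OF w _ \<phi>]\<close>)
  then have "\<bar>w t \<phi>\<bar> \<le> \<bar>w 0 \<phi>\<bar> + D * nm \<phi> * t" using t by simp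
  then show "\<bar>w t \<phi>\<bar> \<le> (dnorm (w 0) + D * t) * nm \<phi>"
    using dual_le_dnorm[OF d(1)[OF t0] \<phi>] by (simp add: algebra_simps)
qed

text \<open>Summing the series separately at each argument reduces its analysis to scalar power series.\<close>

definition exp_curve :: "(nat \<Rightarrow> ('a \<Rightarrow> real) \<Rightarrow> real) \<Rightarrow> real \<Rightarrow> ('a \<Rightarrow> real) \<Rightarrow> real" where
  "exp_curve c t \<phi> = (\<Sum>k. c k \<phi> / fact k * t ^ k)"

lemma exp_curve_0: "exp_curve c 0 = c 0"
proof
  fix \<phi> show "exp_curve c 0 \<phi> = c 0 \<phi>"
    using powser_zero[of "\<lambda>k. c k \<phi> / fact k"] by (simp add: exp_curve_def)
qed

text \<open>On \<open>[0,T]\<close> the second derivative at \<open>\<phi>\<close> is bounded by \<open>D * nm \<phi>\<close>. Applying the mean value inequality twice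
  bounds the errors of the difference quotients by \<open>D * \<bar>s - t\<bar> * nm \<phi>\<close>, that is, uniformly over the unit ball.\<close>

lemma exp_curve_C1:
  assumes c: "\<And>k. c k \<in> dual" and cb: "\<And>k \<phi>. \<phi> \<in> S \<Longrightarrow> \<bar>c k \<phi>\<bar> \<le> M * L ^ k * nm \<phi>"
    and nn: "M \<ge> 0" "L \<ge> 0"
  shows "has_C1_deriv T dual dnorm (exp_curve c) (exp_curve (\<lambda>k. c (Suc k)))"
proof -
  have shift: "\<bar>c (k + j) \<phi>\<bar> \<le> (M * L ^ j * nm \<phi>) * L ^ k" if "\<phi> \<in> S" for k j \<phi>
    using cb[OF that, of "k + j"] by (simp add: power_add algebra_simps)
  have bound: "\<bar>exp_curve (\<lambda>k. c (k + j)) t \<phi>\<bar> \<le> M * L ^ j * exp (L * \<bar>t\<bar>) * nm \<phi>" if "\<phi> \<in> S" for j t \<phi>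
    using exp_type_bound[OF shift[OF that], of j t] by (simp add: exp_curve_def algebra_simps)
  have deriv: "((\<lambda>t. exp_curve (\<lambda>k. c (k + j)) t \<phi>) has_real_derivative exp_curve (\<lambda>k. c (k + Suc j)) t \<phi>) (at t)"
    if "\<phi> \<in> S" for j t \<phi>
    using exp_type_deriv[OF shift[OF that], of j t] by (simp add: exp_curve_def)
  have memb: "exp_curve (\<lambda>k. c (k + j)) t \<in> dual" for j t
  proof (rule dualI[OF _ bound])
    fix u v a b assume uv: "u \<in> S" "v \<in> S"
    have "exp_curve (\<lambda>k. c (k + j)) t (\<lambda>x. a * u x + b * v x)
       = (\<Sum>k. a * (c (k + j) u / fact k * t ^ k) + b * (c (k + j) v / fact k * t ^ k))"
      unfolding exp_curve_def by (intro suminf_cong) (simp add: dual_lincomb_arg[OF c uv] field_simps)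
    also have "\<dots> = a * exp_curve (\<lambda>k. c (k + j)) t u + b * exp_curve (\<lambda>k. c (k + j)) t v"
      unfolding exp_curve_def
      by (rule sums_unique[symmetric], intro sums_add sums_mult summable_sums exp_type_summable[OF shift] uv)
    finally show "exp_curve (\<lambda>k. c (k + j)) t (\<lambda>x. a * u x + b * v x)
       = a * exp_curve (\<lambda>k. c (k + j)) t u + b * exp_curve (\<lambda>k. c (k + j)) t v" .
  qed
  define D where "D = M * L ^ 2 * exp (L * T)"
  have D0: "D \<ge> 0" using nn by (simp add: D_def)
  have D: "\<bar>exp_curve (\<lambda>k. c (k + 2)) t \<phi>\<bar> \<le> D * nm \<phi>" if "\<phi> \<in> S" "t \<in> {0..T}" for t \<phi>
  proof -
    have "exp (L * \<bar>t\<bar>) \<le> exp (L * T)" using that nn by (simp add: mult_left_mono)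
    then have "M * L ^ 2 * exp (L * \<bar>t\<bar>) * nm \<phi> \<le> D * nm \<phi>"
      unfolding D_def using nn that nm_nonneg by (intro mult_right_mono mult_left_mono) auto
    then show ?thesis using bound[OF that(1), of 2 t] by simp
  qed
  have diff1: "\<bar>exp_curve (\<lambda>k. c (k + 1)) s \<phi> - exp_curve (\<lambda>k. c (k + 1)) t \<phi>\<bar> \<le> D * nm \<phi> * \<bar>s - t\<bar>"
    if "\<phi> \<in> S" "s \<in> {0..T}" "t \<in> {0..T}" for s t \<phi>
    using field_differentiable_bound[where S = "{0..T}" and B = "D * nm \<phi>" and x = s and y = t
        and f = "\<lambda>t. exp_curve (\<lambda>k. c (k + 1)) t \<phi>" and f' = "\<lambda>t. exp_curve (\<lambda>k. c (k + 2)) t \<phi>"]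
      D[OF that(1)] deriv[OF that(1), of 1] that
    by (force intro: DERIV_subset)
  have diff2: "\<bar>(exp_curve (\<lambda>k. c (k + 0)) s \<phi> - exp_curve (\<lambda>k. c (k + 0)) t \<phi>) / (s - t) - exp_curve (\<lambda>k. c (k + 1)) t \<phi>\<bar>
      \<le> D * \<bar>s - t\<bar> * nm \<phi>" if \<phi>: "\<phi> \<in> S" and st: "s \<in> {0..T}" "t \<in> {0..T}" "s \<noteq> t" for s t \<phi>
  proof -
    let ?f = "\<lambda>t. exp_curve (\<lambda>k. c (k + 0)) t \<phi>" and ?g = "\<lambda>t. exp_curve (\<lambda>k. c (k + 1)) t \<phi>"
    have "norm ((?f s - s * ?g t) - (?f t - t * ?g t)) \<le> (D * nm \<phi> * \<bar>s - t\<bar>) * norm (s - t)"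
    proof (rule field_differentiable_bound[where S = "closed_segment s t" and f' = "\<lambda>r. ?g r - ?g t"])
      fix r assume r: "r \<in> closed_segment s t"
      have "((\<lambda>r. ?f r - r * ?g t) has_real_derivative ?g r - 1 * ?g t) (at r)"
        using DERIV_diff[OF deriv[OF \<phi>, of 0 r] DERIV_cmult_right[OF DERIV_ident, of "?g t"]] by simp
      then show "((\<lambda>r. ?f r - r * ?g t) has_real_derivative ?g r - ?g t) (at r within closed_segment s t)"
        by (simp add: DERIV_subset[OF _ subset_UNIV])
      have rT: "r \<in> {0..T}" using r st by (auto simp: closed_segment_eq_real_ivl split: if_splits)
      have "\<bar>r - t\<bar> \<le> \<bar>s - t\<bar>" using r by (auto simp: closed_segment_eq_real_ivl split: if_splits)
      then have "D * nm \<phi> * \<bar>r - t\<bar> \<le> D * nm \<phi> * \<bar>s - t\<bar>"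
        using D0 nm_nonneg[OF \<phi>] by (intro mult_left_mono) auto
      then show "norm (?g r - ?g t) \<le> D * nm \<phi> * \<bar>s - t\<bar>"
        using diff1[OF \<phi> rT st(2)] by simp
    qed auto
    moreover have "?f s - s * ?g t - (?f t - t * ?g t) = ((?f s - ?f t) / (s - t) - ?g t) * (s - t)"
      using st(3) by (simp add: field_simps)
    ultimately have "\<bar>(?f s - ?f t) / (s - t) - ?g t\<bar> * \<bar>s - t\<bar> \<le> (D * nm \<phi> * \<bar>s - t\<bar>) * \<bar>s - t\<bar>"
      by (simp add: abs_mult)
    then have "\<bar>(?f s - ?f t) / (s - t) - ?g t\<bar> \<le> D * nm \<phi> * \<bar>s - t\<bar>"
      by (rule mult_right_le_imp_le) (use st(3) in simp)
    then show ?thesis by (simp add: algebra_simps)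
  qed
  have lim0: "((\<lambda>s. D * \<bar>s - t\<bar>) \<longlongrightarrow> 0) (at t within {0..T})" for t
  proof -
    have "((\<lambda>s. D * \<bar>s - t\<bar>) \<longlongrightarrow> D * \<bar>t - t\<bar>) (at t within {0..T})" by (intro tendsto_intros)
    then show ?thesis by simp
  qed
  have "has_C1_deriv T dual dnorm (exp_curve (\<lambda>k. c (k + 0))) (exp_curve (\<lambda>k. c (k + 1)))"
    unfolding has_C1_deriv_def
  proof (intro ballI conjI)
    fix t assume t: "t \<in> {0..T}"
    show "exp_curve (\<lambda>k. c (k + 0)) t \<in> dual" "exp_curve (\<lambda>k. c (k + 1)) t \<in> dual" by (rule memb)+
    show "((\<lambda>s. dnorm (\<lambda>\<phi>. (exp_curve (\<lambda>k. c (k + 0)) s \<phi> - exp_curve (\<lambda>k. c (k + 0)) t \<phi>) / (s - t)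
        - exp_curve (\<lambda>k. c (k + 1)) t \<phi>)) \<longlongrightarrow> 0) (at t within {0..T})"
    proof (rule Lim_null_comparison[OF _ lim0])
      have "norm (dnorm (\<lambda>\<phi>. (exp_curve (\<lambda>k. c (k + 0)) s \<phi> - exp_curve (\<lambda>k. c (k + 0)) t \<phi>) / (s - t)
        - exp_curve (\<lambda>k. c (k + 1)) t \<phi>)) \<le> D * \<bar>s - t\<bar>" if "s \<in> {0..T}" "s \<noteq> t" for s
        unfolding real_norm_def abs_of_nonneg[OF dnorm_nonneg[OF dual_quotient[OF memb memb memb]]]
        by (rule dnorm_le) (use diff2 that t D0 in auto)
      then show "\<forall>\<^sub>F s in at t within {0..T}. norm (dnorm (\<lambda>\<phi>. (exp_curve (\<lambda>k. c (k + 0)) s \<phi> - exp_curve (\<lambda>k. c (k + 0)) t \<phi>) / (s - t)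
        - exp_curve (\<lambda>k. c (k + 1)) t \<phi>)) \<le> D * \<bar>s - t\<bar>"
        unfolding eventually_at_filter by (intro always_eventually) blast
    qed
    show "((\<lambda>s. dnorm (\<lambda>\<phi>. exp_curve (\<lambda>k. c (k + 1)) s \<phi> - exp_curve (\<lambda>k. c (k + 1)) t \<phi>)) \<longlongrightarrow> 0) (at t within {0..T})"
    proof (rule Lim_null_comparison[OF _ lim0])
      have "norm (dnorm (\<lambda>\<phi>. exp_curve (\<lambda>k. c (k + 1)) s \<phi> - exp_curve (\<lambda>k. c (k + 1)) t \<phi>)) \<le> D * \<bar>s - t\<bar>" if "s \<in> {0..T}" for s
        unfolding real_norm_def abs_of_nonneg[OF dnorm_nonneg[OF dual_diff[OF memb memb]]]
        by (rule dnorm_le) (use diff1[OF _ that t] D0 in \<open>auto simp: algebra_simps\<close>)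
      then show "\<forall>\<^sub>F s in at t within {0..T}. norm (dnorm (\<lambda>\<phi>. exp_curve (\<lambda>k. c (k + 1)) s \<phi> - exp_curve (\<lambda>k. c (k + 1)) t \<phi>)) \<le> D * \<bar>s - t\<bar>"
        unfolding eventually_at_filter by (intro always_eventually) blast
    qed
  qed
  then show ?thesis by simp
qed

end

text \<open>The abstract equation \<open>w' + b (riesz w) = F\<close> in the dual space, for a bounded positive symmetric form \<open>b\<close>.
  The bound is a square so that \<open>K\<close> itself compares the two seminorms.\<close>

locale evolution = semi_hilbert S B for S :: "('a \<Rightarrow> real) set" and B +
  fixes b :: "('a \<Rightarrow> real) \<Rightarrow> ('a \<Rightarrow> real) \<Rightarrow> real" and K :: real
  assumes b_form: "semi_inner_space S b"
    and b_le: "u \<in> S \<Longrightarrow> b u u \<le> K\<^sup>2 * B u u"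
    and K_nonneg: "K \<ge> 0"
begin

sublocale b: semi_inner_space S b by (rule b_form)

lemma b_nm_le: "u \<in> S \<Longrightarrow> b.nm u \<le> K * nm u"
  using real_sqrt_le_mono[OF b_le[of u]] K_nonneg by (simp add: b.nm_def nm_def real_sqrt_mult)

lemma b_bound: "u \<in> S \<Longrightarrow> v \<in> S \<Longrightarrow> \<bar>b u v\<bar> \<le> K\<^sup>2 * nm u * nm v"
  using b.Cauchy_Schwarz[of u v] mult_mono[OF b_nm_le[of u] b_nm_le[of v]] K_nonneg nm_nonneg[of u] b.nm_nonneg[of v]
  by (simp add: power2_eq_square mult.assoc mult.left_commute)

lemma b_dual: "u \<in> S \<Longrightarrow> b u \<in> dual"
  by (rule dualI[of _ "K\<^sup>2 * nm u"]) (auto simp: b.B_lincomb_right b_bound)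

text \<open>The bounded self-adjoint operator that represents the form \<open>b\<close>.\<close>

definition oper :: "('a \<Rightarrow> real) \<Rightarrow> 'a \<Rightarrow> real" where
  "oper \<phi> = riesz (b \<phi>)"

lemma oper_mem: "\<phi> \<in> S \<Longrightarrow> oper \<phi> \<in> S"
  by (simp add: oper_def riesz_mem b_dual)

lemma nm_oper_le: "\<phi> \<in> S \<Longrightarrow> nm (oper \<phi>) \<le> K\<^sup>2 * nm \<phi>"
  unfolding oper_def by (subst dnorm_riesz[symmetric]) (auto simp: b_dual b_bound nm_nonneg intro!: dnorm_le)

text \<open>This is the self-adjointness of \<open>oper\<close>: under the Riesz map the evolution equation reads
  \<open>w' t \<phi> + w t (oper \<phi>) = F \<phi>\<close>, where the operator acts on the test element only.\<close>

lemma dual_oper: "\<zeta> \<in> dual \<Longrightarrow> \<phi> \<in> S \<Longrightarrow> \<zeta> (oper \<phi>) = b (riesz \<zeta>) \<phi>"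
  using B_riesz[of \<zeta> "oper \<phi>"] B_riesz[OF b_dual, of \<phi> "riesz \<zeta>"]
  by (simp add: oper_def oper_mem[unfolded oper_def] riesz_mem b.B_sym[of \<phi>] B_sym[of "riesz \<zeta>"] b_dual)

lemma dual_comp_oper: "\<zeta> \<in> dual \<Longrightarrow> (\<lambda>\<phi>. \<zeta> (oper \<phi>)) \<in> dual"
  by (rule dual_cong[OF b_dual[OF riesz_mem]]) (auto simp: dual_oper)

text \<open>The squared norm has derivative \<open>2 * w' (riesz w) = - 2 * b (riesz w) (riesz w)\<close>.\<close>

lemma energy_decreases:
  assumes w: "has_C1_deriv T dual dnorm w w'" and t: "t \<in> {0..T}"
    and eq: "\<And>s \<phi>. s \<in> {0..T} \<Longrightarrow> \<phi> \<in> S \<Longrightarrow> w' s \<phi> + b (riesz (w s)) \<phi> = 0"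
  shows "dnorm (w t) \<le> dnorm (w 0)"
proof -
  have d: "w s \<in> dual" "w' s \<in> dual" if "s \<in> {0..T}" for s
    using w that unfolding has_C1_deriv_def by auto
  define E where "E s = B (riesz (w s)) (riesz (w s))" for s
  have der: "(E has_real_derivative 2 * B (riesz (w' s)) (riesz (w s))) (at s within {0..T})" if "s \<in> {0..T}" for s
    unfolding E_def by (rule C1_deriv_B_square[OF riesz_C1[OF w] that])
  have neg: "2 * B (riesz (w' s)) (riesz (w s)) \<le> 0" if s: "s \<in> {0..T}" for s
    using eq[OF s riesz_mem[OF d(1)[OF s]]] B_riesz[OF d(2)[OF s] riesz_mem[OF d(1)[OF s]]]
      b.B_nonneg[OF riesz_mem[OF d(1)[OF s]]] by linarith
  have "E t \<le> E 0"
  proof (rule DERIV_nonpos_imp_decreasing_open[where f = E])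
    show "0 \<le> t" using t by simp
    show "continuous_on {0..t} E"
      by (rule continuous_on_subset[OF DERIV_continuous_on[OF der]]) (use t in auto)
    fix s assume s: "0 < s" "s < t"
    then have "s \<in> interior {0..T}" using t by simp
    then have "(E has_real_derivative 2 * B (riesz (w' s)) (riesz (w s))) (at s)"
      using der[of s] at_within_interior[of s "{0..T}"] s t by simp
    then show "\<exists>y. (E has_real_derivative y) (at s) \<and> y \<le> 0" using neg[of s] s t by auto
  qed
  then have "nm (riesz (w t)) \<le> nm (riesz (w 0))" by (simp add: E_def nm_def)
  then show ?thesis using d t by (simp add: dnorm_riesz)
qed

text \<open>The difference of two solutions solves the homogeneous equation with initial value zero.\<close>

lemma evolution_unique:
  assumes w: "has_C1_deriv T dual dnorm w w'" and z: "has_C1_deriv T dual dnorm z z'"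
    and weq: "\<And>s \<phi>. s \<in> {0..T} \<Longrightarrow> \<phi> \<in> S \<Longrightarrow> w' s \<phi> + b (riesz (w s)) \<phi> = F \<phi>"
    and zeq: "\<And>s \<phi>. s \<in> {0..T} \<Longrightarrow> \<phi> \<in> S \<Longrightarrow> z' s \<phi> + b (riesz (z s)) \<phi> = F \<phi>"
    and init: "\<And>\<phi>. \<phi> \<in> S \<Longrightarrow> w 0 \<phi> = z 0 \<phi>" and t: "t \<in> {0..T}" and \<phi>: "\<phi> \<in> S"
  shows "w t \<phi> = z t \<phi>"
proof -
  have d: "w s \<in> dual" "w' s \<in> dual" "z s \<in> dual" "z' s \<in> dual" if "s \<in> {0..T}" for s
    using w z that unfolding has_C1_deriv_def by auto
  let ?v = "\<lambda>t \<phi>. w t \<phi> - z t \<phi>" and ?v' = "\<lambda>t \<phi>. w' t \<phi> - z' t \<phi>"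
  have "has_C1_deriv T dual dnorm ?v ?v'"
    unfolding has_C1_deriv_def
  proof (intro ballI conjI)
    fix t assume t: "t \<in> {0..T}"
    show "?v t \<in> dual" "?v' t \<in> dual" using d[OF t] by (auto intro: dual_diff)
    have sub: "dnorm (\<lambda>\<phi>. \<zeta> \<phi> - \<eta> \<phi>) \<le> dnorm \<zeta> + dnorm \<eta>" if "\<zeta> \<in> dual" "\<eta> \<in> dual" for \<zeta> \<eta>
      using nm_diff_le[OF riesz_mem[OF that(1)] riesz_mem[OF that(2)]] that by (simp add: nm_riesz_diff dnorm_riesz)
    show "((\<lambda>s. dnorm (\<lambda>\<phi>. (?v s \<phi> - ?v t \<phi>) / (s - t) - ?v' t \<phi>)) \<longlongrightarrow> 0) (at t within {0..T})"
    proof (rule Lim_null_comparison)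
      show "((\<lambda>s. dnorm (\<lambda>\<phi>. (w s \<phi> - w t \<phi>) / (s - t) - w' t \<phi>) + dnorm (\<lambda>\<phi>. (z s \<phi> - z t \<phi>) / (s - t) - z' t \<phi>)) \<longlongrightarrow> 0) (at t within {0..T})"
        using w z t unfolding has_C1_deriv_def by (intro tendsto_add_zero) blast+
      have "norm (dnorm (\<lambda>\<phi>. (?v s \<phi> - ?v t \<phi>) / (s - t) - ?v' t \<phi>))
          \<le> dnorm (\<lambda>\<phi>. (w s \<phi> - w t \<phi>) / (s - t) - w' t \<phi>) + dnorm (\<lambda>\<phi>. (z s \<phi> - z t \<phi>) / (s - t) - z' t \<phi>)"
        if s: "s \<in> {0..T}" for s
      proof -
        have "(\<lambda>\<phi>. (?v s \<phi> - ?v t \<phi>) / (s - t) - ?v' t \<phi>)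
           = (\<lambda>\<phi>. ((w s \<phi> - w t \<phi>) / (s - t) - w' t \<phi>) - ((z s \<phi> - z t \<phi>) / (s - t) - z' t \<phi>))"
          by (auto simp: fun_eq_iff diff_divide_distrib)
        then show ?thesis
          using d[OF t] d[OF s] by (simp add: sub dual_quotient dnorm_nonneg dual_diff)
      qed
      then show "\<forall>\<^sub>F s in at t within {0..T}. norm (dnorm (\<lambda>\<phi>. (?v s \<phi> - ?v t \<phi>) / (s - t) - ?v' t \<phi>))
          \<le> dnorm (\<lambda>\<phi>. (w s \<phi> - w t \<phi>) / (s - t) - w' t \<phi>) + dnorm (\<lambda>\<phi>. (z s \<phi> - z t \<phi>) / (s - t) - z' t \<phi>)"
        unfolding eventually_at_filter by (intro always_eventually) blast
    qed
    show "((\<lambda>s. dnorm (\<lambda>\<phi>. ?v' s \<phi> - ?v' t \<phi>)) \<longlongrightarrow> 0) (at t within {0..T})"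
    proof (rule Lim_null_comparison)
      show "((\<lambda>s. dnorm (\<lambda>\<phi>. w' s \<phi> - w' t \<phi>) + dnorm (\<lambda>\<phi>. z' s \<phi> - z' t \<phi>)) \<longlongrightarrow> 0) (at t within {0..T})"
        using w z t unfolding has_C1_deriv_def by (intro tendsto_add_zero) blast+
      have "norm (dnorm (\<lambda>\<phi>. ?v' s \<phi> - ?v' t \<phi>)) \<le> dnorm (\<lambda>\<phi>. w' s \<phi> - w' t \<phi>) + dnorm (\<lambda>\<phi>. z' s \<phi> - z' t \<phi>)"
        if s: "s \<in> {0..T}" for s
      proof -
        have "(\<lambda>\<phi>. ?v' s \<phi> - ?v' t \<phi>) = (\<lambda>\<phi>. (w' s \<phi> - w' t \<phi>) - (z' s \<phi> - z' t \<phi>))"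
          by (auto simp: fun_eq_iff)
        then show ?thesis
          using d[OF t] d[OF s] by (simp add: sub dual_diff dnorm_nonneg)
      qed
      then show "\<forall>\<^sub>F s in at t within {0..T}. norm (dnorm (\<lambda>\<phi>. ?v' s \<phi> - ?v' t \<phi>))
          \<le> dnorm (\<lambda>\<phi>. w' s \<phi> - w' t \<phi>) + dnorm (\<lambda>\<phi>. z' s \<phi> - z' t \<phi>)"
        unfolding eventually_at_filter by (intro always_eventually) blast
    qed
  qed
  then have "dnorm (?v t) \<le> dnorm (?v 0)"
  proof (rule energy_decreases[OF _ t])
    fix s \<phi> assume s: "s \<in> {0..T}" and \<phi>: "\<phi> \<in> S"
    have "b (riesz (?v s)) \<phi> = b (riesz (w s)) \<phi> - b (riesz (z s)) \<phi>"
      using d[OF s] \<phi> by (simp add: dual_oper[symmetric] dual_diff)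
    then show "?v' s \<phi> + b (riesz (?v s)) \<phi> = 0"
      using weq[OF s \<phi>] zeq[OF s \<phi>] by simp
  qed
  also have "dnorm (?v 0) = dnorm (\<lambda>\<phi>. 0)" by (rule dnorm_cong) (simp add: init)
  also have "\<dots> \<le> 0" by (rule dnorm_le) auto
  finally have "dnorm (?v t) * nm \<phi> \<le> 0 * nm \<phi>"
    by (intro mult_right_mono nm_nonneg \<phi>)
  then have "\<bar>?v t \<phi>\<bar> \<le> 0" using dual_le_dnorm[OF dual_diff[OF d(1)[OF t] d(3)[OF t]] \<phi>] by simp
  then show ?thesis by simp
qed

text \<open>The Taylor coefficients at \<open>t = 0\<close> that the equation \<open>w' t \<phi> + w t (oper \<phi>) = F \<phi>\<close> and the initial value
  \<open>\<zeta>\<close> force upon a solution; the constant \<open>F\<close> enters only the first-order one.\<close>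

primrec coeff :: "(('a \<Rightarrow> real) \<Rightarrow> real) \<Rightarrow> (('a \<Rightarrow> real) \<Rightarrow> real) \<Rightarrow> nat \<Rightarrow> ('a \<Rightarrow> real) \<Rightarrow> real" where
  "coeff F \<zeta> 0 = \<zeta>"
| "coeff F \<zeta> (Suc k) = (\<lambda>\<phi>. (if k = 0 then F \<phi> else 0) - coeff F \<zeta> k (oper \<phi>))"

lemma coeff_dual: "F \<in> dual \<Longrightarrow> \<zeta> \<in> dual \<Longrightarrow> coeff F \<zeta> k \<in> dual"
proof (induction k)
  case (Suc k)
  then have "coeff F \<zeta> k \<in> dual" by simp
  from dual_lincomb[OF Suc.prems(1) dual_comp_oper[OF this], of "if k = 0 then 1 else 0" "-1"]
  show ?case by (cases "k = 0") simp_all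
qed simp

lemma coeff_bound:
  assumes "F \<in> dual" "\<zeta> \<in> dual" "\<phi> \<in> S"
  shows "\<bar>coeff F \<zeta> k \<phi>\<bar> \<le> (dnorm F + dnorm \<zeta>) * (1 + K\<^sup>2) ^ k * nm \<phi>"
  using assms(3)
proof (induction k arbitrary: \<phi>)
  case 0
  have "dnorm \<zeta> * nm \<phi> \<le> (dnorm F + dnorm \<zeta>) * nm \<phi>"
    using assms 0 by (intro mult_right_mono) (auto simp: nm_nonneg dnorm_nonneg)
  then show ?case using dual_le_dnorm[OF assms(2) 0] by simp
next
  case (Suc k)
  let ?M = "dnorm F + dnorm \<zeta>"
  have M: "?M \<ge> 0" using assms by (simp add: dnorm_nonneg)
  have 1: "\<bar>coeff F \<zeta> k (oper \<phi>)\<bar> \<le> ?M * (1 + K\<^sup>2) ^ k * (K\<^sup>2 * nm \<phi>)"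
    using Suc.IH[OF oper_mem[OF Suc.prems]] mult_left_mono[OF nm_oper_le[OF Suc.prems], of "?M * (1 + K\<^sup>2) ^ k"] M
    by simp
  have 2: "\<bar>if k = 0 then F \<phi> else 0\<bar> \<le> ?M * (1 + K\<^sup>2) ^ k * nm \<phi>"
  proof (cases "k = 0")
    case True
    have "dnorm F * nm \<phi> \<le> ?M * nm \<phi>"
      using assms Suc.prems by (intro mult_right_mono) (auto simp: nm_nonneg dnorm_nonneg)
    then show ?thesis using dual_le_dnorm[OF assms(1) Suc.prems] True by simp
  next
    case False
    then show ?thesis using M nm_nonneg[OF Suc.prems] by simp
  qed
  have "\<bar>coeff F \<zeta> (Suc k) \<phi>\<bar> \<le> \<bar>if k = 0 then F \<phi> else 0\<bar> + \<bar>coeff F \<zeta> k (oper \<phi>)\<bar>"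
    by (simp del: abs_le_iff)
  also have "\<dots> \<le> ?M * (1 + K\<^sup>2) ^ k * nm \<phi> + ?M * (1 + K\<^sup>2) ^ k * (K\<^sup>2 * nm \<phi>)" by (rule add_mono[OF 2 1])
  finally show ?case by (simp add: algebra_simps)
qed

text \<open>Differentiating the series once more shows that \<open>w'\<close> solves the homogeneous equation, so that its norm is
  at most that of \<open>w' 0 = F - \<zeta> \<circ> oper\<close>.\<close>

lemma evolution_exists:
  assumes F: "F \<in> dual" and \<zeta>: "\<zeta> \<in> dual" and T: "T > 0"
  obtains w w' where "has_C1_deriv T dual dnorm w w'" "w 0 = \<zeta>"
    "\<And>t \<phi>. t \<in> {0..T} \<Longrightarrow> \<phi> \<in> S \<Longrightarrow> w' t \<phi> + b (riesz (w t)) \<phi> = F \<phi>"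
    "\<And>t. t \<in> {0..T} \<Longrightarrow> dnorm (w' t) \<le> dnorm (\<lambda>\<phi>. F \<phi> - b (riesz \<zeta>) \<phi>)"
proof -
  let ?c = "coeff F \<zeta>"
  let ?w = "exp_curve ?c" and ?w' = "exp_curve (\<lambda>k. ?c (Suc k))" and ?w'' = "exp_curve (\<lambda>k. ?c (Suc (Suc k)))"
  have M: "dnorm F + dnorm \<zeta> \<ge> 0" using F \<zeta> by (simp add: dnorm_nonneg)
  have C1: "has_C1_deriv T dual dnorm ?w ?w'"
    by (rule exp_curve_C1[where c = ?c, OF coeff_dual[OF F \<zeta>] coeff_bound[OF F \<zeta>] M]) simp_all
  have cb': "\<bar>?c (Suc k) \<phi>\<bar> \<le> ((dnorm F + dnorm \<zeta>) * (1 + K\<^sup>2)) * (1 + K\<^sup>2) ^ k * nm \<phi>" if "\<phi> \<in> S" for k \<phi>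
    using coeff_bound[OF F \<zeta> that, of "Suc k"] by (simp add: algebra_simps)
  have C2: "has_C1_deriv T dual dnorm ?w' ?w''"
    by (rule exp_curve_C1[where c = "\<lambda>k. ?c (Suc k)", OF coeff_dual[OF F \<zeta>] cb']) (use M in simp_all)
  have summ: "summable (\<lambda>k. ?c k \<phi> / fact k * t ^ k)" if "\<phi> \<in> S" for \<phi> t
    by (rule exp_type_summable[where M = "(dnorm F + dnorm \<zeta>) * nm \<phi>" and L = "1 + K\<^sup>2"])
       (use coeff_bound[OF F \<zeta> that] in \<open>simp add: algebra_simps\<close>)
  have summ': "summable (\<lambda>k. ?c (Suc k) \<phi> / fact k * t ^ k)" if "\<phi> \<in> S" for \<phi> t
    by (rule exp_type_summable[where M = "(dnorm F + dnorm \<zeta>) * (1 + K\<^sup>2) * nm \<phi>" and L = "1 + K\<^sup>2"])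
       (use cb'[OF that] in \<open>simp add: algebra_simps\<close>)
  have eq: "?w' t \<phi> + b (riesz (?w t)) \<phi> = F \<phi>" if t: "t \<in> {0..T}" and \<phi>: "\<phi> \<in> S" for t \<phi>
  proof -
    have d: "?w t \<in> dual" using C1 t unfolding has_C1_deriv_def by blast
    have "?w' t \<phi> + ?w t (oper \<phi>) = (\<Sum>k. ?c (Suc k) \<phi> / fact k * t ^ k + ?c k (oper \<phi>) / fact k * t ^ k)"
      unfolding exp_curve_def by (rule suminf_add[OF summ'[OF \<phi>] summ[OF oper_mem[OF \<phi>]]])
    also have "\<dots> = (\<Sum>k. if k = 0 then F \<phi> else 0)"
      by (intro suminf_cong) (auto simp: field_simps)
    also have "\<dots> = F \<phi>"
      using sums_unique[OF sums_single[of 0 "\<lambda>_. F \<phi>"]] by simp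
    finally show ?thesis by (simp add: dual_oper[OF d \<phi>])
  qed
  have dec: "dnorm (?w' t) \<le> dnorm (?w' 0)" if t: "t \<in> {0..T}" for t
  proof (rule energy_decreases[OF C2 t])
    fix s \<phi> assume s: "s \<in> {0..T}" and \<phi>: "\<phi> \<in> S"
    have d: "?w' s \<in> dual" using C1 s unfolding has_C1_deriv_def by blast
    have "?w'' s \<phi> = (\<Sum>k. - (?c (Suc k) (oper \<phi>) / fact k * s ^ k))"
      unfolding exp_curve_def by (intro suminf_cong) simp
    also have "\<dots> = - ?w' s (oper \<phi>)"
      unfolding exp_curve_def by (rule suminf_minus[OF summ'[OF oper_mem[OF \<phi>]]])
    finally show "?w'' s \<phi> + b (riesz (?w' s)) \<phi> = 0" using dual_oper[OF d \<phi>] by linarith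
  qed
  have "dnorm (?w' 0) = dnorm (\<lambda>\<phi>. F \<phi> - b (riesz \<zeta>) \<phi>)"
    unfolding exp_curve_0 by (rule dnorm_cong) (simp add: dual_oper[OF \<zeta>])
  with that[OF C1 exp_curve_0[of ?c, simplified] eq] dec show ?thesis by simp
qed

end

section \<open>Smooth bump functions\<close>

text \<open>For \<open>P = 1\<close> this is the classical function that is smooth but not analytic at \<open>0\<close>; admitting a polynomial
  factor makes the family closed under differentiation, so smoothness follows by induction.\<close>

definition flat :: "real poly \<Rightarrow> real \<Rightarrow> real" where
  "flat P t = (if t > 0 then poly P (1 / t) * exp (- (1 / t)) else 0)"

lemma poly_over_exp_tendsto_0: "((\<lambda>y. poly P y / exp y) \<longlongrightarrow> (0::real)) at_top"
proof -
  have "((\<lambda>y. \<Sum>i\<le>degree P. coeff P i * (y ^ i / exp y)) \<longlongrightarrow> (\<Sum>i\<le>degree P. coeff P i * 0)) at_top"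
    by (intro tendsto_intros tendsto_power_div_exp_0)
  then show ?thesis by (simp add: poly_altdef sum_divide_distrib)
qed

lemma flat_tendsto_0: "((\<lambda>t. flat P t) \<longlongrightarrow> 0) (at 0)"
proof (rule filterlim_split_at)
  show "((\<lambda>t. flat P t) \<longlongrightarrow> 0) (at_left 0)"
    by (rule tendsto_eventually) (auto simp: flat_def eventually_at_filter)
  have "((\<lambda>t. poly P (inverse t) / exp (inverse t)) \<longlongrightarrow> (0::real)) (at_right 0)"
    by (rule filterlim_compose[OF poly_over_exp_tendsto_0 filterlim_inverse_at_top_right])
  moreover have "\<forall>\<^sub>F t in at_right 0. poly P (inverse t) / exp (inverse t) = flat P t"
    by (auto simp: flat_def eventually_at_filter exp_minus field_simps)
  ultimately show "((\<lambda>t. flat P t) \<longlongrightarrow> 0) (at_right 0)"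
    by (rule Lim_transform_eventually)
qed

lemma flat_deriv: "(flat P has_real_derivative flat ([:0,0,1:] * (P - pderiv P)) t) (at t)"
proof -
  consider "t > 0" | "t < 0" | "t = 0" by linarith
  then show ?thesis
  proof cases
    case 1
    have "((\<lambda>t. poly P (1 / t) * exp (- (1 / t))) has_real_derivative
        poly (pderiv P) (1 / t) * (- (1 / t\<^sup>2)) * exp (- (1 / t)) + poly P (1 / t) * (exp (- (1 / t)) * (1 / t\<^sup>2))) (at t)"
      using 1 by (auto intro!: derivative_eq_intros poly_DERIV[THEN DERIV_chain2] simp: power2_eq_square field_simps)
    moreover have "poly (pderiv P) (1 / t) * (- (1 / t\<^sup>2)) * exp (- (1 / t)) + poly P (1 / t) * (exp (- (1 / t)) * (1 / t\<^sup>2))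
        = flat ([:0,0,1:] * (P - pderiv P)) t"
      using 1 by (simp add: flat_def power2_eq_square field_simps)
    ultimately have "((\<lambda>t. poly P (1 / t) * exp (- (1 / t))) has_real_derivative flat ([:0,0,1:] * (P - pderiv P)) t) (at t)"
      by simp
    then show ?thesis
      by (rule has_field_derivative_transform_within_open[where S = "{0<..}"]) (use 1 in \<open>auto simp: flat_def\<close>)
  next
    case 2
    have "((\<lambda>t. 0) has_real_derivative flat ([:0,0,1:] * (P - pderiv P)) t) (at t)"
      using 2 by (simp add: flat_def)
    then show ?thesis
      by (rule has_field_derivative_transform_within_open[where S = "{..<0}"]) (use 2 in \<open>auto simp: flat_def\<close>)
  next
    case 3
    have "(\<lambda>s. (flat P s - flat P 0) / (s - 0)) = flat ([:0,1:] * P)"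
      by (auto simp: flat_def fun_eq_iff field_simps)
    moreover have "flat ([:0,0,1:] * (P - pderiv P)) 0 = 0" by (simp add: flat_def)
    ultimately show ?thesis
      using flat_tendsto_0[of "[:0,1:] * P"] unfolding 3 has_field_derivative_iff by (simp only:)
  qed
qed

lemma Ck_on_const: "Ck_on k (\<lambda>x::real^'n. c::real) UNIV"
  by (induction k arbitrary: c) (auto simp: frechet_derivative_const)

lemma Ck_on_lower: "Ck_on (Suc k) f S \<Longrightarrow> Ck_on k f S"
proof (induction k arbitrary: f)
  case 0 then show ?case by (auto intro: differentiable_imp_continuous_on)
qed simp

lemma frechet_derivative_add_mult:
  fixes f g :: "real^'n \<Rightarrow> real"
  assumes "f differentiable (at x)" "g differentiable (at x)"
  shows "frechet_derivative (\<lambda>x. f x + g x) (at x) v = frechet_derivative f (at x) v + frechet_derivative g (at x) v"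
    and "frechet_derivative (\<lambda>x. f x * g x) (at x) v = f x * frechet_derivative g (at x) v + frechet_derivative f (at x) v * g x"
proof -
  note d = assms[unfolded frechet_derivative_works]
  show "frechet_derivative (\<lambda>x. f x + g x) (at x) v = frechet_derivative f (at x) v + frechet_derivative g (at x) v"
    by (subst frechet_derivative_at[OF has_derivative_add[OF d], symmetric]) simp
  show "frechet_derivative (\<lambda>x. f x * g x) (at x) v = f x * frechet_derivative g (at x) v + frechet_derivative f (at x) v * g x"
    by (subst frechet_derivative_at[OF has_derivative_mult[OF d], symmetric]) simp
qed

lemma Ck_on_add:
  fixes f g :: "real^'n \<Rightarrow> real"
  shows "Ck_on k f UNIV \<Longrightarrow> Ck_on k g UNIV \<Longrightarrow> Ck_on k (\<lambda>x. f x + g x) UNIV"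
proof (induction k arbitrary: f g)
  case 0 then show ?case by (auto intro: continuous_on_add)
next
  case (Suc k)
  then have d: "f differentiable (at x)" "g differentiable (at x)" for x by (auto simp: differentiable_on_def)
  show ?case using Suc by (simp add: frechet_derivative_add_mult[OF d] differentiable_on_add)
qed

lemma Ck_on_mult:
  fixes f g :: "real^'n \<Rightarrow> real"
  shows "Ck_on k f UNIV \<Longrightarrow> Ck_on k g UNIV \<Longrightarrow> Ck_on k (\<lambda>x. f x * g x) UNIV"
proof (induction k arbitrary: f g)
  case 0 then show ?case by (auto intro: continuous_on_mult)
next
  case (Suc k)
  then have d: "f differentiable (at x)" "g differentiable (at x)" for x by (auto simp: differentiable_on_def)
  show ?case using Suc Ck_on_lower[OF Suc.prems(1)] Ck_on_lower[OF Suc.prems(2)]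
    by (simp add: frechet_derivative_add_mult[OF d] differentiable_on_mult Ck_on_add)
qed

lemma Ck_on_prod:
  fixes f :: "'i \<Rightarrow> real^'n \<Rightarrow> real"
  shows "finite I \<Longrightarrow> (\<And>i. Ck_on k (f i) UNIV) \<Longrightarrow> Ck_on k (\<lambda>x. \<Prod>i\<in>I. f i x) UNIV"
  by (induction I rule: finite_induct) (auto simp: Ck_on_const Ck_on_mult)

lemma Ck_on_flat: "Ck_on k (\<lambda>x::real^'n. flat P (c * x $ i + d)) UNIV"
proof (induction k arbitrary: P)
  case 0
  have "continuous_on UNIV (flat P)" for P
    by (meson DERIV_continuous_on DERIV_subset flat_deriv subset_UNIV)
  then show ?case
    by (simp, rule continuous_on_compose2[of UNIV "flat P"]) (auto intro!: continuous_intros)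
next
  case (Suc k)
  let ?Q = "[:0,0,1:] * (P - pderiv P)"
  have hd: "((\<lambda>x::real^'n. flat P (c * x $ i + d)) has_derivative (\<lambda>v. (c * v $ i) * flat ?Q (c * x $ i + d))) (at x)" for x
  proof -
    have "((\<lambda>x::real^'n. c * x $ i + d) has_derivative (\<lambda>v. c * v $ i)) (at x)"
      using has_derivative_add[OF has_derivative_mult_right[OF bounded_linear_imp_has_derivative[OF bounded_linear_vec_nth]] has_derivative_const]
      by simp
    from has_derivative_compose[OF this flat_deriv[unfolded has_field_derivative_def]] show ?thesis
      by (simp add: mult.commute)
  qed
  have fd: "frechet_derivative (\<lambda>x::real^'n. flat P (c * x $ i + d)) (at x) v = (c * v $ i) * flat ?Q (c * x $ i + d)" for x v
    using frechet_derivative_at[OF hd] by metis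
  have "(\<lambda>x::real^'n. flat P (c * x $ i + d)) differentiable_on UNIV"
    using hd unfolding differentiable_on_def differentiable_def by blast
  then show ?case
    by (simp add: fd Ck_on_mult[OF Ck_on_const Suc.IH] del: mult_pCons_left)
qed

text \<open>As \<open>m\<close> grows, \<open>flat 1 (m * t) = exp (- 1 / (m * t))\<close> tends to \<open>1\<close> for positive \<open>t\<close>, so the bumps increase to
  the indicator function of the open box.\<close>

definition bump :: "real^'n \<Rightarrow> real^'n \<Rightarrow> nat \<Rightarrow> real^'n \<Rightarrow> real" where
  "bump a b m x = (\<Prod>i\<in>UNIV. flat 1 (real m * x $ i + (- real m * a $ i)) * flat 1 (- real m * x $ i + real m * b $ i))"

lemma bump_smooth: "smooth (bump a b m)"
  unfolding smooth_def bump_def by (intro allI Ck_on_prod Ck_on_mult Ck_on_flat finite)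

lemma flat_1: "0 \<le> flat 1 t" "flat 1 t \<le> 1" by (auto simp: flat_def)

lemma bump_range: "0 \<le> bump a b m x" "bump a b m x \<le> 1"
  unfolding bump_def by (intro prod_nonneg prod_le_1 conjI ballI mult_nonneg_nonneg mult_le_one flat_1)+

lemma bump_outside: "bump a b m x = 0" if "x \<notin> box a b"
proof -
  have "\<exists>i. x $ i \<le> a $ i \<or> b $ i \<le> x $ i" using that unfolding mem_box_cart by (auto simp: not_less)
  then obtain i where "x $ i \<le> a $ i \<or> b $ i \<le> x $ i" by blast
  then have "real m * x $ i + (- real m * a $ i) \<le> 0 \<or> - real m * x $ i + real m * b $ i \<le> 0"
    by (auto simp: mult_left_mono)
  then have "flat 1 (real m * x $ i + (- real m * a $ i)) * flat 1 (- real m * x $ i + real m * b $ i) = 0"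
    by (auto simp: flat_def)
  then show ?thesis unfolding bump_def by (intro prod_zero) auto
qed

lemma flat_1_tendsto: "t > 0 \<Longrightarrow> (\<lambda>m. flat 1 (real m * t)) \<longlonglongrightarrow> 1"
proof -
  assume t: "t > 0"
  have "(\<lambda>m. exp (- ((1 / t) * inverse (real m)))) \<longlonglongrightarrow> exp (- ((1 / t) * 0))"
    by (intro tendsto_intros lim_inverse_n)
  moreover have "\<forall>\<^sub>F m in sequentially. exp (- ((1 / t) * inverse (real m))) = flat 1 (real m * t)"
    using eventually_gt_at_top[of "0::nat"] by eventually_elim (use t in \<open>simp add: flat_def field_simps\<close>)
  ultimately show ?thesis by (simp add: Lim_transform_eventually)
qed

lemma bump_tendsto:
  fixes a b x :: "real^'n"
  shows "(\<lambda>m. bump a b m x) \<longlonglongrightarrow> indicator (box a b) x"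
proof (cases "x \<in> box a b")
  case True
  then have ab: "a $ i < x $ i" "x $ i < b $ i" for i by (auto simp: mem_box_cart)
  have "(\<lambda>m. \<Prod>i\<in>UNIV. flat 1 (real m * (x $ i - a $ i)) * flat 1 (real m * (b $ i - x $ i))) \<longlonglongrightarrow> (\<Prod>i\<in>(UNIV::'n set). 1 * 1)"
    using ab by (intro tendsto_prod tendsto_mult flat_1_tendsto) simp_all
  then show ?thesis using True by (simp add: bump_def algebra_simps)
next
  case False
  then show ?thesis by (simp add: bump_outside)
qed

lemma bump_test_function: "bump a b m \<in> test_functions \<Omega>" if "cbox a b \<subseteq> \<Omega>"
  unfolding test_functions_def
  using bump_smooth that
  by (auto intro!: exI[of _ "cbox a b"] compact_cbox bump_outside dest: subsetD[OF box_subset_cbox])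

section \<open>The fundamental lemma of the calculus of variations\<close>

lemma test_function_continuous: "\<phi> \<in> test_functions \<Omega> \<Longrightarrow> continuous_on UNIV \<phi>"
  unfolding test_functions_def smooth_def by (auto dest: spec[of _ 0])

lemma continuous_measurable_lebesgue_on:
  fixes f :: "real^'n \<Rightarrow> 'b::euclidean_space"
  assumes "continuous_on UNIV f" "\<Omega> \<in> sets lebesgue"
  shows "f \<in> borel_measurable (lebesgue_on \<Omega>)"
  by (rule continuous_imp_measurable_on_sets_lebesgue) (use assms in \<open>auto intro: continuous_on_subset\<close>)

text \<open>Boxes form a generator of the Borel sets that is stable under intersections, so the sets over which the
  integral vanishes, which form a Dynkin system containing the boxes, include all Borel sets.\<close>

lemma box_integrals_zero_imp_AE_zero:
  fixes g :: "real^'n \<Rightarrow> real"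
  assumes g: "integrable lborel g" and box: "\<And>a b. (LINT x:box a b|lborel. g x) = 0"
    and all: "(LINT x|lborel. g x) = 0"
  shows "AE x in lborel. g x = 0"
proof (rule sigma_finite_measure.density_zero[OF lborel.sigma_finite_measure_axioms g])
  have si: "set_integrable lborel A g" if "A \<in> sets borel" for A
    unfolding set_integrable_def using that g by (intro integrable_mult_indicator) auto
  let ?G = "range (\<lambda>(a, b). box a b :: (real^'n) set)"
  fix A :: "(real^'n) set" assume "A \<in> sets lborel"
  then have A: "A \<in> sigma_sets UNIV ?G" by (simp add: borel_eq_box)
  have "Int_stable ?G" by (rule Int_stableI) (force simp: box_Int_box)
  moreover have "?G \<subseteq> Pow UNIV" by simp
  ultimately show "(LINT x:A|lborel. g x) = 0"
    using A
  proof (induction rule: sigma_sets_induct_disjoint)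
    case (basic A) then show ?case using box by auto
  next
    case empty then show ?case by (simp add: set_lebesgue_integral_def)
  next
    case (compl A)
    then have A: "A \<in> sets borel" by (simp add: borel_eq_box)
    have "(LINT x:A \<union> (UNIV - A)|lborel. g x) = (LINT x:A|lborel. g x) + (LINT x:UNIV - A|lborel. g x)"
      by (rule set_integral_Un) (use A in \<open>auto intro!: si\<close>)
    then show ?case using compl all by (simp add: set_lebesgue_integral_def)
  next
    case (union A)
    then have A: "A i \<in> sets borel" for i by (auto simp: borel_eq_box)
    have "(LINT x:(\<Union>i. A i)|lborel. g x) = (\<Sum>i. LINT x:A i|lborel. g x)"
      by (rule lebesgue_integral_countable_add) (use A union in \<open>auto intro!: si simp: disjoint_family_on_def\<close>)
    then show ?case using union by simp
  qed
qed

text \<open>The bumps approximate the indicator function of their box, so by dominated convergence a function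
  orthogonal to all test functions has vanishing integral over every box whose closure lies in \<open>\<Omega>\<close>.
  Countably many closed boxes cover \<open>\<Omega>\<close>, and within each of them the criterion above applies.\<close>

theorem fundamental_lemma_variations:
  fixes g :: "real^'n \<Rightarrow> real"
  assumes \<Omega>: "open \<Omega>" and g: "integrable (lebesgue_on \<Omega>) g"
    and orth: "\<And>\<phi>. \<phi> \<in> test_functions \<Omega> \<Longrightarrow> (LINT x|lebesgue_on \<Omega>. g x * \<phi> x) = 0"
  shows "AE x in lebesgue_on \<Omega>. g x = 0"
proof -
  have \<Omega>s: "\<Omega> \<in> sets lebesgue" using \<Omega> by (intro sets_completionI_sets) (simp add: borel_open)
  have box0: "(LINT x|lebesgue_on \<Omega>. g x * indicator (box a b) x) = 0" if "cbox a b \<subseteq> \<Omega>" for a b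
  proof -
    have "(\<lambda>m. LINT x|lebesgue_on \<Omega>. g x * bump a b m x) \<longlonglongrightarrow> (LINT x|lebesgue_on \<Omega>. g x * indicator (box a b) x)"
    proof (rule integral_dominated_convergence[where w = "\<lambda>x. \<bar>g x\<bar>"])
      show "(\<lambda>x. g x * indicator (box a b) x) \<in> borel_measurable (lebesgue_on \<Omega>)"
        using g \<Omega>s that box_subset_cbox[of a b]
        by (intro borel_measurable_times borel_measurable_indicator) (auto simp: sets_restrict_space_iff)
      show "(\<lambda>x. g x * bump a b m x) \<in> borel_measurable (lebesgue_on \<Omega>)" for m
        using borel_measurable_times[OF borel_measurable_integrable[OF g] continuous_measurable_lebesgue_on[OF
          test_function_continuous[OF bump_test_function[OF that]] \<Omega>s]] .
      show "AE x in lebesgue_on \<Omega>. norm (g x * bump a b m x) \<le> \<bar>g x\<bar>" for m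
        using bump_range[of a b m] by (auto simp: abs_mult intro!: mult_left_le)
      show "AE x in lebesgue_on \<Omega>. (\<lambda>m. g x * bump a b m x) \<longlonglongrightarrow> g x * indicator (box a b) x"
        by (intro AE_I2 tendsto_intros bump_tendsto)
    qed (use g in auto)
    then show ?thesis using orth[OF bump_test_function[OF that]] by (simp add: LIMSEQ_const_iff)
  qed
  have AE_box: "AE x in lebesgue. x \<in> cbox p q \<longrightarrow> g x = 0" if pq: "cbox p q \<subseteq> \<Omega>" for p q
  proof -
    define h where "h x = indicator (box p q) x * (indicator \<Omega> x *\<^sub>R g x)" for x
    have h: "integrable lebesgue h"
      using integrable_mult_indicator[of "box p q" lebesgue "\<lambda>x. indicator \<Omega> x *\<^sub>R g x"] g \<Omega>s
      by (simp add: h_def[abs_def] integrable_restrict_space)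
    then have "h \<in> borel_measurable (completion lborel)" by auto
    \<comment> \<open>Pass to a Borel function, because the boxes generate only the Borel sets.\<close>
    then obtain h' where h': "h' \<in> borel_measurable lborel" "AE x in lborel. h x = h' x"
      using completion_ex_borel_measurable_real by blast
    have AE_h': "AE x in lebesgue. h x = h' x" using h'(2) by (rule AE_completion)
    have h'm: "h' \<in> borel_measurable lebesgue" using h'(1) by (simp add: measurable_completion)
    have ih': "integrable lborel h'"
      using integrable_cong_AE_imp[OF h h'm] AE_h' integrable_completion[OF h'(1)] by (auto simp: eq_commute)
    have eq: "(LINT x:A|lborel. h' x) = (LINT x|lebesgue_on \<Omega>. g x * indicator (box p q \<inter> A) x)" if "A \<in> sets borel" for A
    proof -
      have "(LINT x:A|lborel. h' x) = (LINT x|lebesgue. indicator A x *\<^sub>R h' x)"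
        unfolding set_lebesgue_integral_def using h'(1) that by (intro integral_completion[symmetric]) auto
      also have "\<dots> = (LINT x|lebesgue. indicator A x *\<^sub>R h x)"
        using that h'm h AE_h' by (intro integral_cong_AE borel_measurable_scaleR borel_measurable_indicator) auto
      also have "\<dots> = (LINT x|lebesgue. indicator \<Omega> x *\<^sub>R (g x * indicator (box p q \<inter> A) x))"
        by (intro Bochner_Integration.integral_cong) (auto simp: h_def indicator_def)
      also have "\<dots> = (LINT x|lebesgue_on \<Omega>. g x * indicator (box p q \<inter> A) x)"
        using \<Omega>s by (subst integral_restrict_space) auto
      finally show ?thesis .
    qed
    have "AE x in lborel. h' x = 0"
    proof (rule box_integrals_zero_imp_AE_zero[OF ih'])
      fix a b :: "real^'n"
      have "cbox p q \<inter> cbox a b \<subseteq> \<Omega>" using pq by auto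
      then show "(LINT x:box a b|lborel. h' x) = 0"
        by (subst eq) (simp_all add: box_Int_box Int_interval box0)
    next
      show "(LINT x|lborel. h' x) = 0"
        using eq[of UNIV] box0[OF pq] by (simp add: set_lebesgue_integral_def)
    qed
    then have "AE x in lebesgue. h' x = 0" by (rule AE_completion)
    moreover have "AE x in lebesgue. x \<notin> cbox p q - box p q"
      using negligible_frontier_interval[of p q] by (intro AE_not_in) (simp add: negligible_iff_null_sets)
    ultimately show ?thesis using AE_h'
    proof eventually_elim
      case (elim x)
      then show ?case using pq by (auto simp: h_def indicator_def split: if_splits)
    qed
  qed
  obtain \<D> where D: "countable \<D>" "\<And>X. X \<in> \<D> \<Longrightarrow> X \<subseteq> \<Omega>" "\<And>X. X \<in> \<D> \<Longrightarrow> \<exists>a b. X = cbox a b" "\<Union>\<D> = \<Omega>"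
    by (rule open_countable_Union_open_cbox[OF \<Omega>]) blast
  have "AE x in lebesgue. x \<in> X \<longrightarrow> g x = 0" if X: "X \<in> \<D>" for X
  proof -
    obtain a b where "X = cbox a b" using D(3)[OF X] by blast
    then show ?thesis using AE_box[of a b] D(2)[OF X] by simp
  qed
  then have "AE x in lebesgue. \<forall>X\<in>\<D>. x \<in> X \<longrightarrow> g x = 0"
    unfolding AE_ball_countable[OF D(1)] by blast
  then have "AE x in lebesgue. x \<in> \<Omega> \<longrightarrow> g x = 0"
    by eventually_elim (use D(4) in blast)
  then show ?thesis using \<Omega>s by (simp add: AE_restrict_space_iff)
qed

section \<open>Square-integrable functions\<close>

lemma L2_measurable: "f \<in> L2 M \<Longrightarrow> f \<in> borel_measurable M"
  by (simp add: L2_def)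

lemma norm_lincomb_square_le:
  fixes u v :: "'b::real_normed_vector"
  shows "(norm (a *\<^sub>R u + b *\<^sub>R v))\<^sup>2 \<le> 2 * a\<^sup>2 * (norm u)\<^sup>2 + 2 * b\<^sup>2 * (norm v)\<^sup>2"
proof -
  have "norm (a *\<^sub>R u + b *\<^sub>R v) \<le> \<bar>a\<bar> * norm u + \<bar>b\<bar> * norm v"
    by (metis norm_scaleR norm_triangle_ineq)
  then have "(norm (a *\<^sub>R u + b *\<^sub>R v))\<^sup>2 \<le> (\<bar>a\<bar> * norm u + \<bar>b\<bar> * norm v)\<^sup>2"
    by (intro power_mono) auto
  also have "\<dots> \<le> 2 * (\<bar>a\<bar> * norm u)\<^sup>2 + 2 * (\<bar>b\<bar> * norm v)\<^sup>2"
    using sum_squares_bound[of "\<bar>a\<bar> * norm u" "\<bar>b\<bar> * norm v"] by (simp add: power2_sum)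
  finally show ?thesis by (simp add: power_mult_distrib)
qed

lemma L2_lincomb_scaleR:
  assumes f: "f \<in> L2 M" and g: "g \<in> L2 M"
  shows "(\<lambda>x. a *\<^sub>R f x + b *\<^sub>R g x) \<in> L2 M"
proof -
  have m: "(\<lambda>x. a *\<^sub>R f x + b *\<^sub>R g x) \<in> borel_measurable M"
    using f g by (auto simp: L2_def)
  have "integrable M (\<lambda>x. 2 * a\<^sup>2 * (norm (f x))\<^sup>2 + 2 * b\<^sup>2 * (norm (g x))\<^sup>2)"
    using f g by (auto simp: L2_def)
  then have "integrable M (\<lambda>x. (norm (a *\<^sub>R f x + b *\<^sub>R g x))\<^sup>2)"
    by (rule Bochner_Integration.integrable_bound)
       (use m in \<open>auto intro!: borel_measurable_power borel_measurable_norm AE_I2 norm_lincomb_square_le order_trans[OF _ abs_ge_self]\<close>)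
  then show ?thesis using m by (simp add: L2_def)
qed

lemma L2_lincomb:
  fixes f g :: "'a \<Rightarrow> real"
  shows "f \<in> L2 M \<Longrightarrow> g \<in> L2 M \<Longrightarrow> (\<lambda>x. a * f x + b * g x) \<in> L2 M"
  using L2_lincomb_scaleR[of f M g a b] by simp

lemma L2_diff: "f \<in> L2 M \<Longrightarrow> g \<in> L2 M \<Longrightarrow> (\<lambda>x. f x - g x) \<in> L2 M"
  using L2_lincomb_scaleR[of f M g 1 "-1"] by simp

lemma L2_inner_integrable:
  assumes f: "f \<in> L2 M" and g: "g \<in> L2 M"
  shows "integrable M (\<lambda>x. f x \<bullet> g x)"
proof (rule Bochner_Integration.integrable_bound)
  show "integrable M (\<lambda>x. (norm (f x))\<^sup>2 + (norm (g x))\<^sup>2)" using f g by (auto simp: L2_def)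
  show "(\<lambda>x. f x \<bullet> g x) \<in> borel_measurable M" using f g by (auto simp: L2_def)
  have "norm (u \<bullet> v) \<le> norm ((norm u)\<^sup>2 + (norm v)\<^sup>2)" for u v :: 'b
  proof -
    have "\<bar>u \<bullet> v\<bar> \<le> norm u * norm v" by (rule Cauchy_Schwarz_ineq2)
    moreover have "2 * norm u * norm v \<le> (norm u)\<^sup>2 + (norm v)\<^sup>2" by (rule sum_squares_bound)
    moreover have "0 \<le> norm u * norm v" by simp
    ultimately show ?thesis by (simp only: real_norm_def abs_of_nonneg zero_le_power2 add_nonneg_nonneg)
  qed
  then show "AE x in M. norm (f x \<bullet> g x) \<le> norm ((norm (f x))\<^sup>2 + (norm (g x))\<^sup>2)" by simp
qed

lemma L2_weighted_integrable:
  assumes f: "f \<in> L2 M" and g: "g \<in> L2 M" and \<rho>: "\<rho> \<in> borel_measurable M" "AE x in M. \<bar>\<rho> x\<bar> \<le> R"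
  shows "integrable M (\<lambda>x. \<rho> x * (f x \<bullet> g x))"
proof (rule Bochner_Integration.integrable_bound)
  show "integrable M (\<lambda>x. R * (f x \<bullet> g x))" by (intro integrable_mult_right L2_inner_integrable f g)
  show "(\<lambda>x. \<rho> x * (f x \<bullet> g x)) \<in> borel_measurable M"
    using \<rho>(1) borel_measurable_integrable[OF L2_inner_integrable[OF f g]] by (rule borel_measurable_times)
  show "AE x in M. norm (\<rho> x * (f x \<bullet> g x)) \<le> norm (R * (f x \<bullet> g x))"
    using \<rho>(2) by eventually_elim (auto simp: abs_mult intro!: mult_right_mono)
qed

lemma (in finite_measure) L2_bounded:
  assumes "f \<in> borel_measurable M" "\<And>x. norm (f x) \<le> C"
  shows "f \<in> L2 M"
proof -
  have "integrable M (\<lambda>x. (norm (f x))\<^sup>2)"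
    by (rule integrable_const_bound[where B = "C\<^sup>2"]) (use assms in \<open>auto intro!: power_mono\<close>)
  then show ?thesis using assms by (simp add: L2_def)
qed

lemma L2_inner_self: "L2_inner M f f = (LINT x|M. (norm (f x))\<^sup>2)"
  by (simp add: L2_inner_def power2_norm_eq_inner)

lemma L2_norm_square: "(L2_norm M f)\<^sup>2 = L2_inner M f f"
  by (simp add: L2_norm_def L2_inner_self)

lemma L2_semi_inner: "semi_inner_space (L2 M) (L2_inner M :: ('a \<Rightarrow> real) \<Rightarrow> _)"
proof
  show "L2 M \<noteq> {}" by (auto simp: L2_def intro!: exI[of _ "\<lambda>x. 0"])
next
  fix u v w :: "'a \<Rightarrow> real" and a b :: real
  assume m: "u \<in> L2 M" "v \<in> L2 M"
  show "(\<lambda>x. a * u x + b * v x) \<in> L2 M" using m by (rule L2_lincomb)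
  assume w: "w \<in> L2 M"
  have "L2_inner M (\<lambda>x. a * u x + b * v x) w = (LINT x|M. a * (u x \<bullet> w x) + b * (v x \<bullet> w x))"
    by (simp add: L2_inner_def algebra_simps)
  also have "\<dots> = a * L2_inner M u w + b * L2_inner M v w"
    using L2_inner_integrable[OF m(1) w] L2_inner_integrable[OF m(2) w] by (simp add: L2_inner_def)
  finally show "L2_inner M (\<lambda>x. a * u x + b * v x) w = a * L2_inner M u w + b * L2_inner M v w" .
qed (auto simp: L2_inner_def mult.commute)

text \<open>The Riesz--Fischer theorem. A rapidly converging subsequence converges almost everywhere because
  the \<open>L\<^sup>1\<close> norms of its increments are summable; Fatou's lemma then identifies the limit.\<close>

theorem (in finite_measure) L2_complete:
  fixes F :: "nat \<Rightarrow> 'a \<Rightarrow> 'b::euclidean_space"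
  assumes F: "\<And>n. F n \<in> L2 M"
    and cauchy: "\<And>e. e > 0 \<Longrightarrow> \<exists>N. \<forall>m\<ge>N. \<forall>n\<ge>N. (LINT x|M. (norm (F m x - F n x))\<^sup>2) < e"
  shows "\<exists>f\<in>L2 M. (\<lambda>n. LINT x|M. (norm (F n x - f x))\<^sup>2) \<longlonglongrightarrow> 0"
proof -
  have int: "integrable M (\<lambda>x. (norm (F m x - F n x))\<^sup>2)" for m n
    using L2_diff[OF F F] by (simp add: L2_def)
  have Fm[measurable]: "F n \<in> borel_measurable M" for n using F by (rule L2_measurable)
  have "\<exists>N. \<forall>k. \<forall>m\<ge>N k. \<forall>n\<ge>N k. (LINT x|M. (norm (F m x - F n x))\<^sup>2) < (1/4)^k"
    using cauchy by (intro choice) simp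
  then obtain N where N: "\<And>k m n. m \<ge> N k \<Longrightarrow> n \<ge> N k \<Longrightarrow> (LINT x|M. (norm (F m x - F n x))\<^sup>2) < (1/4)^k"
    by blast
  define r where "r k = (\<Sum>j\<le>k. N j)" for k
  have rN: "N k \<le> r k" for k unfolding r_def by (rule member_le_sum) auto
  have rS: "N k \<le> r (Suc k)" for k using rN[of k] by (simp add: r_def)
  have r_ge: "N k \<le> r j" if "k \<le> j" for k j unfolding r_def by (rule member_le_sum) (use that in auto)
  define G where "G k = F (r k)" for k
  have Gm[measurable]: "G k \<in> borel_measurable M" for k by (simp add: G_def)
  have step: "(\<integral>\<^sup>+x. ennreal (norm (G (Suc k) x - G k x)) \<partial>M) \<le> ennreal ((1/2)^k * (1 + measure M (space M)))" for k
  proof -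
    let ?y = "\<lambda>x. norm (G (Suc k) x - G k x)"
    have i2: "integrable M (\<lambda>x. (?y x)\<^sup>2)" unfolding G_def by (rule int)
    \<comment> \<open>After integration both terms are of order \<open>(1/2)^k\<close>, since the squared \<open>L\<^sup>2\<close> norm is at most \<open>(1/4)^k\<close>.\<close>
    have pt: "?y x \<le> 2^k * (?y x)\<^sup>2 + (1/2)^k" for x
    proof -
      have "0 \<le> (2^k * ?y x - 1)\<^sup>2" by simp
      then have "2 * (2^k * ?y x) \<le> (2^k * ?y x)\<^sup>2 + 1" by (simp add: power2_diff)
      moreover have "0 \<le> 2^k * ?y x" by simp
      ultimately have "2^k * ?y x \<le> (2^k * ?y x)\<^sup>2 + 1" by linarith
      then have "2^k * ?y x \<le> 2^k * (2^k * (?y x)\<^sup>2 + (1/2)^k)"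
        by (simp add: power_mult_distrib power2_eq_square algebra_simps power_one_over)
      then show ?thesis by simp
    qed
    have iy: "integrable M ?y"
      by (rule Bochner_Integration.integrable_bound[where f = "\<lambda>x. 2^k * (?y x)\<^sup>2 + (1/2)^k"])
         (use i2 pt in \<open>auto intro!: order_trans[OF pt abs_ge_self]\<close>)
    have "(LINT x|M. ?y x) \<le> (LINT x|M. 2^k * (?y x)\<^sup>2 + (1/2)^k)"
      using iy i2 pt by (intro integral_mono) auto
    also have "\<dots> = 2^k * (LINT x|M. (?y x)\<^sup>2) + (1/2)^k * measure M (space M)"
      using i2 by simp
    also have "(LINT x|M. (?y x)\<^sup>2) \<le> (1/4)^k"
      unfolding G_def using N[OF rS rN, of k] by simp
    also have "2^k * (1/4)^k = ((1/2)^k :: real)" by (simp add: power_mult_distrib[symmetric])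
    finally have "(LINT x|M. ?y x) \<le> (1/2)^k * (1 + measure M (space M))" by (simp add: algebra_simps)
    then show ?thesis
      using iy by (subst nn_integral_eq_integral) (auto intro: ennreal_leI)
  qed
  have "(\<integral>\<^sup>+x. (\<Sum>k. ennreal (norm (G (Suc k) x - G k x))) \<partial>M) = (\<Sum>k. \<integral>\<^sup>+x. ennreal (norm (G (Suc k) x - G k x)) \<partial>M)"
    by (rule nn_integral_suminf) simp
  also have "\<dots> \<le> (\<Sum>k. ennreal ((1/2)^k * (1 + measure M (space M))))"
    by (intro suminf_le step) auto
  also have "\<dots> < \<infinity>"
    by (subst suminf_ennreal2) (auto intro!: summable_mult2 summable_geometric)
  finally have "AE x in M. (\<Sum>k. ennreal (norm (G (Suc k) x - G k x))) \<noteq> \<infinity>"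
    by (intro nn_integral_noteq_infinite) auto
  then have conv: "AE x in M. convergent (\<lambda>k. G k x)"
  proof eventually_elim
    case (elim x)
    then have "summable (\<lambda>k. norm (G (Suc k) x - G k x))"
      by (intro summable_suminf_not_top) auto
    then have "summable (\<lambda>k. G (Suc k) x - G k x)" by (rule summable_norm_cancel)
    then have "convergent (\<lambda>n. \<Sum>k<n. G (Suc k) x - G k x)" by (simp add: summable_iff_convergent)
    then have "convergent (\<lambda>n. G n x - G 0 x)" by (simp add: sum_lessThan_telescope[of "\<lambda>k. G k x"])
    then show ?case using convergent_add[OF _ convergent_const[of "G 0 x"]] by fastforce
  qed
  define f where "f x = lim (\<lambda>k. G k x)" for x
  have fm[measurable]: "f \<in> borel_measurable M" unfolding f_def by (rule borel_measurable_lim_metric) simp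
  have fatou: "(\<integral>\<^sup>+x. ennreal ((norm (F n x - f x))\<^sup>2) \<partial>M) \<le> ennreal e"
    if e: "\<And>m. m \<ge> K \<Longrightarrow> (LINT x|M. (norm (F n x - G m x))\<^sup>2) \<le> e" for n K e
  proof -
    have "(\<integral>\<^sup>+x. ennreal ((norm (F n x - f x))\<^sup>2) \<partial>M) = (\<integral>\<^sup>+x. liminf (\<lambda>m. ennreal ((norm (F n x - G m x))\<^sup>2)) \<partial>M)"
      using conv
    proof (intro nn_integral_cong_AE, eventually_elim)
      case (elim x)
      then have "(\<lambda>m. G m x) \<longlonglongrightarrow> f x" by (simp add: f_def convergent_LIMSEQ_iff)
      then have "(\<lambda>m. ennreal ((norm (F n x - G m x))\<^sup>2)) \<longlonglongrightarrow> ennreal ((norm (F n x - f x))\<^sup>2)"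
        by (intro tendsto_ennrealI tendsto_intros)
      then show ?case by (rule lim_imp_Liminf[OF sequentially_bot, symmetric])
    qed
    also have "\<dots> \<le> liminf (\<lambda>m. \<integral>\<^sup>+x. ennreal ((norm (F n x - G m x))\<^sup>2) \<partial>M)"
      by (rule nn_integral_liminf) simp
    also have "\<dots> = liminf (\<lambda>m. ennreal (LINT x|M. (norm (F n x - G m x))\<^sup>2))"
      using int by (simp add: nn_integral_eq_integral G_def)
    also have "\<dots> \<le> limsup (\<lambda>m. ennreal (LINT x|M. (norm (F n x - G m x))\<^sup>2))"
      by (rule Liminf_le_Limsup) simp
    also have "\<dots> \<le> ennreal e"
      by (rule Limsup_bounded) (use e in \<open>auto simp: eventually_sequentially intro!: ennreal_leI\<close>)
    finally show ?thesis .
  qed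
  have small: "\<exists>K. \<forall>n\<ge>K. (\<integral>\<^sup>+x. ennreal ((norm (F n x - f x))\<^sup>2) \<partial>M) \<le> ennreal e" if "e > 0" for e
  proof -
    obtain k :: nat where k: "(1/4)^k < e" using real_arch_pow_inv[OF \<open>e > 0\<close>, of "1/4"] by auto
    have "(\<integral>\<^sup>+x. ennreal ((norm (F n x - f x))\<^sup>2) \<partial>M) \<le> ennreal e" if n: "n \<ge> N k" for n
    proof (rule fatou[of k])
      fix m assume "m \<ge> k"
      then show "(LINT x|M. (norm (F n x - G m x))\<^sup>2) \<le> e"
        using N[OF n r_ge, of m] k by (simp add: G_def)
    qed
    then show ?thesis by blast
  qed
  have diffL2: "(\<lambda>x. F n x - f x) \<in> L2 M" if "(\<integral>\<^sup>+x. ennreal ((norm (F n x - f x))\<^sup>2) \<partial>M) \<le> ennreal e" for n e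
    using that unfolding L2_def
    by (auto intro!: integrableI_bounded order.strict_trans1[OF _ ennreal_less_top, of _ e])
  obtain K where K: "\<And>n. n \<ge> K \<Longrightarrow> (\<integral>\<^sup>+x. ennreal ((norm (F n x - f x))\<^sup>2) \<partial>M) \<le> ennreal 1"
    using small[of 1] by auto
  have "f \<in> L2 M" using L2_diff[OF F[of K] diffL2[OF K[of K]]] by simp
  moreover have "(\<lambda>n. LINT x|M. (norm (F n x - f x))\<^sup>2) \<longlonglongrightarrow> 0"
  proof (rule LIMSEQ_I)
    fix e :: real assume "e > 0"
    then obtain K where K: "\<And>n. n \<ge> K \<Longrightarrow> (\<integral>\<^sup>+x. ennreal ((norm (F n x - f x))\<^sup>2) \<partial>M) \<le> ennreal (e/2)"
      using small[of "e/2"] by auto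
    have "(LINT x|M. (norm (F n x - f x))\<^sup>2) \<le> e/2" if "n \<ge> K" for n
      using K[OF that] diffL2[OF K[OF that]] \<open>e > 0\<close> by (simp add: L2_def nn_integral_eq_integral)
    then show "\<exists>K. \<forall>n\<ge>K. norm ((LINT x|M. (norm (F n x - f x))\<^sup>2) - 0) < e"
      using \<open>e > 0\<close> by (intro exI[of _ K]) fastforce
  qed
  ultimately show ?thesis by blast
qed

section \<open>Weak gradients and \<open>H\<^sup>1\<close>\<close>

lemma compact_support_bounded:
  fixes f :: "real^'n \<Rightarrow> real"
  assumes "continuous_on UNIV f" "compact K" "\<And>x. x \<notin> K \<Longrightarrow> f x = 0"
  shows "\<exists>C. \<forall>x. norm (f x) \<le> C"
proof -
  have "bounded (f ` K)"
    using assms(1,2) by (intro compact_imp_bounded compact_continuous_image continuous_on_subset[OF assms(1)]) auto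
  then obtain C where C: "\<And>x. x \<in> K \<Longrightarrow> norm (f x) \<le> C" unfolding bounded_iff by blast
  have "norm (f x) \<le> max C 0" for x
    using C[of x] assms(3)[of x] by (cases "x \<in> K") auto
  then show ?thesis by blast
qed

locale bounded_domain =
  fixes \<Omega> :: "(real^'n) set"
  assumes open_dom: "open \<Omega>" and bounded_dom: "bounded \<Omega>"
begin

abbreviation M :: "(real^'n) measure" where "M \<equiv> lebesgue_on \<Omega>"

lemma dom_sets: "\<Omega> \<in> sets lebesgue"
  using open_dom by (intro sets_completionI_sets) (simp add: borel_open)

sublocale finite_measure M
  by (intro finite_measure_lebesgue_on bounded_set_imp_lmeasurable bounded_dom dom_sets)

lemma test_function_L2:
  assumes "\<phi> \<in> test_functions \<Omega>" shows "\<phi> \<in> L2 M"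
proof -
  obtain K where K: "compact K" "\<And>x. x \<notin> K \<Longrightarrow> \<phi> x = 0" using assms unfolding test_functions_def by blast
  have c: "continuous_on UNIV \<phi>" using assms by (rule test_function_continuous)
  obtain C where "\<And>x. norm (\<phi> x) \<le> C" using compact_support_bounded[OF c K] by blast
  then show ?thesis by (rule L2_bounded[OF continuous_measurable_lebesgue_on[OF c dom_sets]])
qed

lemma test_function_deriv_L2:
  assumes "\<phi> \<in> test_functions \<Omega>" shows "partial_deriv i \<phi> \<in> L2 M"
proof -
  obtain K where K: "compact K" "\<And>x. x \<notin> K \<Longrightarrow> \<phi> x = 0" using assms unfolding test_functions_def by blast
  have "Ck_on (Suc 0) \<phi> UNIV" using assms unfolding test_functions_def smooth_def by blast
  then have c: "continuous_on UNIV (partial_deriv i \<phi>)" by (simp add: partial_deriv_def[abs_def])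
  have z: "partial_deriv i \<phi> x = 0" if "x \<notin> K" for x
  proof -
    have "((\<lambda>x. 0::real) has_derivative (\<lambda>v. 0)) (at x)" by simp
    then have "(\<phi> has_derivative (\<lambda>v. 0)) (at x)"
      by (rule has_derivative_transform_within_open[where s = "- K"])
         (use K that compact_imp_closed[OF K(1)] in auto)
    then show ?thesis by (simp add: partial_deriv_def frechet_derivative_at[symmetric])
  qed
  obtain C where "\<And>x. norm (partial_deriv i \<phi> x) \<le> C" using compact_support_bounded[OF c K(1) z] by blast
  then show ?thesis by (rule L2_bounded[OF continuous_measurable_lebesgue_on[OF c dom_sets]])
qed

lemma L2_component: "G \<in> L2 M \<Longrightarrow> (\<lambda>x. G x $ i) \<in> L2 M" for G :: "real^'n \<Rightarrow> real^'n"
proof -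
  assume G: "G \<in> L2 M"
  have m: "(\<lambda>x. G x $ i) \<in> borel_measurable M"
    using L2_measurable[OF G] by (rule measurable_compose) (simp add: borel_measurable_continuous_onI continuous_on_component)
  have le: "norm ((norm (G x $ i))\<^sup>2) \<le> norm ((norm (G x))\<^sup>2)" for x
    using component_le_norm_cart[of "G x" i] abs_le_square_iff[of "G x $ i" "norm (G x)"] by simp
  have "integrable M (\<lambda>x. (norm (G x $ i))\<^sup>2)"
    by (rule Bochner_Integration.integrable_bound[where f = "\<lambda>x. (norm (G x))\<^sup>2"])
       (use G m le in \<open>auto simp: L2_def intro!: borel_measurable_power\<close>)
  then show ?thesis using m by (simp add: L2_def)
qed

lemma L2_mult_integrable: "f \<in> L2 M \<Longrightarrow> g \<in> L2 M \<Longrightarrow> integrable M (\<lambda>x. f x * g x)" for f g :: "real^'n \<Rightarrow> real"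
  using L2_inner_integrable[of f M g] by simp

text \<open>Each component of the difference is orthogonal to all test functions.\<close>

lemma weak_grad_unique:
  assumes G: "G \<in> L2 M" "has_weak_grad \<Omega> u G" and H: "H \<in> L2 M" "has_weak_grad \<Omega> u H"
  shows "AE x in M. G x = H x"
proof -
  have "AE x in M. G x $ i - H x $ i = 0" for i
  proof (rule fundamental_lemma_variations[OF open_dom])
    have 1: "(\<lambda>x. 1::real) \<in> L2 M" by (rule L2_bounded[of _ 1]) auto
    have d: "(\<lambda>x. G x $ i - H x $ i) \<in> L2 M" by (intro L2_diff L2_component G H)
    show "integrable M (\<lambda>x. G x $ i - H x $ i)" using L2_mult_integrable[OF d 1] by simp
    fix \<phi> assume \<phi>: "\<phi> \<in> test_functions \<Omega>"
    have "(LINT x|M. (G x $ i - H x $ i) * \<phi> x) = (LINT x|M. G x $ i * \<phi> x) - (LINT x|M. H x $ i * \<phi> x)"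
      using L2_mult_integrable[OF L2_component test_function_L2[OF \<phi>]] G H by (simp add: left_diff_distrib)
    then show "(LINT x|M. (G x $ i - H x $ i) * \<phi> x) = 0"
      using G(2)[unfolded has_weak_grad_def, rule_format, OF \<phi>, of i]
        H(2)[unfolded has_weak_grad_def, rule_format, OF \<phi>, of i] by linarith
  qed
  then have "AE x in M. \<forall>i. G x $ i - H x $ i = 0"
    by (subst AE_all_countable) auto
  then show ?thesis by eventually_elim (simp add: vec_eq_iff)
qed

lemma wgrad:
  assumes "u \<in> H1 \<Omega>"
  shows wgrad_L2: "wgrad \<Omega> u \<in> L2 M" and has_weak_grad_wgrad: "has_weak_grad \<Omega> u (wgrad \<Omega> u)"
proof -
  have "\<exists>G. G \<in> L2 M \<and> has_weak_grad \<Omega> u G" using assms unfolding H1_def by blast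
  from someI_ex[OF this] show "wgrad \<Omega> u \<in> L2 M" "has_weak_grad \<Omega> u (wgrad \<Omega> u)"
    unfolding wgrad_def by blast+
qed

lemma H1_L2: "u \<in> H1 \<Omega> \<Longrightarrow> u \<in> L2 M"
  by (simp add: H1_def)

lemma has_weak_grad_lincomb:
  assumes u: "u \<in> L2 M" "G \<in> L2 M" "has_weak_grad \<Omega> u G"
    and v: "v \<in> L2 M" "H \<in> L2 M" "has_weak_grad \<Omega> v H"
  shows "has_weak_grad \<Omega> (\<lambda>x. a * u x + b * v x) (\<lambda>x. a *\<^sub>R G x + b *\<^sub>R H x)"
  unfolding has_weak_grad_def
proof (intro allI ballI)
  fix i and \<phi> assume \<phi>: "\<phi> \<in> test_functions \<Omega>"
  note i1 = L2_mult_integrable[OF u(1) test_function_deriv_L2[OF \<phi>]] L2_mult_integrable[OF v(1) test_function_deriv_L2[OF \<phi>]]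
  note i2 = L2_mult_integrable[OF L2_component[OF u(2)] test_function_L2[OF \<phi>]] L2_mult_integrable[OF L2_component[OF v(2)] test_function_L2[OF \<phi>]]
  have "(LINT x|M. (a * u x + b * v x) * partial_deriv i \<phi> x)
      = (LINT x|M. a * (u x * partial_deriv i \<phi> x) + b * (v x * partial_deriv i \<phi> x))"
    by (simp add: algebra_simps)
  also have "\<dots> = a * (LINT x|M. u x * partial_deriv i \<phi> x) + b * (LINT x|M. v x * partial_deriv i \<phi> x)"
    using i1 by simp
  also have "\<dots> = - (a * (LINT x|M. G x $ i * \<phi> x) + b * (LINT x|M. H x $ i * \<phi> x))"
    using u(3) v(3) \<phi> by (simp add: has_weak_grad_def)
  also have "a * (LINT x|M. G x $ i * \<phi> x) + b * (LINT x|M. H x $ i * \<phi> x)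
      = (LINT x|M. a * (G x $ i * \<phi> x) + b * (H x $ i * \<phi> x))"
    using i2 by simp
  also have "\<dots> = (LINT x|M. (a *\<^sub>R G x + b *\<^sub>R H x) $ i * \<phi> x)"
    by (simp add: algebra_simps)
  finally show "(LINT x|M. (a * u x + b * v x) * partial_deriv i \<phi> x) = - (LINT x|M. (a *\<^sub>R G x + b *\<^sub>R H x) $ i * \<phi> x)" .
qed

lemma H1_I: "u \<in> L2 M \<Longrightarrow> G \<in> L2 M \<Longrightarrow> has_weak_grad \<Omega> u G \<Longrightarrow> u \<in> H1 \<Omega>"
  unfolding H1_def by blast

lemma H1_lincomb: "u \<in> H1 \<Omega> \<Longrightarrow> v \<in> H1 \<Omega> \<Longrightarrow> (\<lambda>x. a * u x + b * v x) \<in> H1 \<Omega>"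
  by (rule H1_I[OF L2_lincomb[OF H1_L2 H1_L2] L2_lincomb_scaleR[OF wgrad_L2 wgrad_L2]
      has_weak_grad_lincomb[OF H1_L2 wgrad_L2 has_weak_grad_wgrad H1_L2 wgrad_L2 has_weak_grad_wgrad]])

lemma wgrad_eqI:
  assumes "u \<in> L2 M" "G \<in> L2 M" "has_weak_grad \<Omega> u G"
  shows "AE x in M. wgrad \<Omega> u x = G x"
proof -
  have u: "u \<in> H1 \<Omega>" using assms by (rule H1_I)
  show ?thesis by (rule weak_grad_unique[OF wgrad[OF u] assms(2,3)])
qed

lemma wgrad_lincomb:
  "u \<in> H1 \<Omega> \<Longrightarrow> v \<in> H1 \<Omega> \<Longrightarrow> AE x in M. wgrad \<Omega> (\<lambda>x. a * u x + b * v x) x = a *\<^sub>R wgrad \<Omega> u x + b *\<^sub>R wgrad \<Omega> v x"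
  by (rule wgrad_eqI[OF L2_lincomb[OF H1_L2 H1_L2] L2_lincomb_scaleR[OF wgrad_L2 wgrad_L2]
      has_weak_grad_lincomb[OF H1_L2 wgrad_L2 has_weak_grad_wgrad H1_L2 wgrad_L2 has_weak_grad_wgrad]])

lemma wgrad_diff:
  "u \<in> H1 \<Omega> \<Longrightarrow> v \<in> H1 \<Omega> \<Longrightarrow> AE x in M. wgrad \<Omega> (\<lambda>x. u x - v x) x = wgrad \<Omega> u x - wgrad \<Omega> v x"
  using wgrad_lincomb[of u v 1 "-1"] by simp

text \<open>The two gradients are equal everywhere: they are chosen by the same rule from the same set of candidates.\<close>

lemma wgrad_cong_AE:
  assumes "u \<in> L2 M" "v \<in> L2 M" "AE x in M. u x = v x"
  shows "wgrad \<Omega> u = wgrad \<Omega> v"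
proof -
  have "(LINT x|M. u x * partial_deriv i \<phi> x) = (LINT x|M. v x * partial_deriv i \<phi> x)"
    if \<phi>: "\<phi> \<in> test_functions \<Omega>" for i \<phi>
  proof (rule integral_cong_AE)
    show "AE x in M. u x * partial_deriv i \<phi> x = v x * partial_deriv i \<phi> x"
      using assms(3) by eventually_elim simp
  qed (use L2_mult_integrable[OF assms(1) test_function_deriv_L2[OF \<phi>]]
      L2_mult_integrable[OF assms(2) test_function_deriv_L2[OF \<phi>]] in auto)
  then have "has_weak_grad \<Omega> u G = has_weak_grad \<Omega> v G" for G
    unfolding has_weak_grad_def by auto
  then show ?thesis unfolding wgrad_def by simp
qed

text \<open>The Dirichlet form with weight \<open>\<rho>\<close>.\<close>

definition wform :: "(real^'n \<Rightarrow> real) \<Rightarrow> (real^'n \<Rightarrow> real) \<Rightarrow> (real^'n \<Rightarrow> real) \<Rightarrow> real" where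
  "wform \<rho> u v = (LINT x|M. \<rho> x * (wgrad \<Omega> u x \<bullet> wgrad \<Omega> v x))"

definition H1_inner :: "(real^'n \<Rightarrow> real) \<Rightarrow> (real^'n \<Rightarrow> real) \<Rightarrow> real" where
  "H1_inner u v = L2_inner M u v + L2_inner M (wgrad \<Omega> u) (wgrad \<Omega> v)"

lemma wform_one: "wform (\<lambda>x. 1) u v = L2_inner M (wgrad \<Omega> u) (wgrad \<Omega> v)"
  by (simp add: wform_def L2_inner_def)

definition weight :: "(real^'n \<Rightarrow> real) \<Rightarrow> real \<Rightarrow> bool" where
  "weight \<rho> R \<longleftrightarrow> \<rho> \<in> borel_measurable M \<and> (AE x in M. 0 \<le> \<rho> x) \<and> (AE x in M. \<rho> x \<le> R)"

lemma weight_one: "weight (\<lambda>x. 1) 1"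
  by (simp add: weight_def)

lemma weighted_integrable:
  assumes "weight \<rho> R" "G \<in> L2 M" "H \<in> L2 M"
  shows "integrable M (\<lambda>x. \<rho> x * (G x \<bullet> H x))"
proof (rule L2_weighted_integrable[where R = R])
  have "AE x in M. 0 \<le> \<rho> x" "AE x in M. \<rho> x \<le> R" using assms(1) by (auto simp: weight_def)
  then show "AE x in M. \<bar>\<rho> x\<bar> \<le> R" by eventually_elim simp
qed (use assms in \<open>auto simp: weight_def\<close>)

lemma wform_integrable:
  "weight \<rho> R \<Longrightarrow> u \<in> H1 \<Omega> \<Longrightarrow> v \<in> H1 \<Omega> \<Longrightarrow> integrable M (\<lambda>x. \<rho> x * (wgrad \<Omega> u x \<bullet> wgrad \<Omega> v x))"
  by (intro weighted_integrable wgrad_L2)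

lemma wform_cong_grad:
  assumes \<rho>: "weight \<rho> R" and L: "G \<in> L2 M" "G' \<in> L2 M" "H \<in> L2 M" "H' \<in> L2 M"
    and eq: "AE x in M. G x = G' x" "AE x in M. H x = H' x"
  shows "(LINT x|M. \<rho> x * (G x \<bullet> H x)) = (LINT x|M. \<rho> x * (G' x \<bullet> H' x))"
proof (rule integral_cong_AE)
  show "AE x in M. \<rho> x * (G x \<bullet> H x) = \<rho> x * (G' x \<bullet> H' x)" using eq by eventually_elim simp
qed (use weighted_integrable[OF \<rho> L(1,3)] weighted_integrable[OF \<rho> L(2,4)] in auto)

lemma wform_semi_inner:
  assumes \<rho>: "weight \<rho> R"
  shows "semi_inner_space (H1 \<Omega>) (wform \<rho>)"
proof
  have "(\<lambda>x. 0) \<in> H1 \<Omega>"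
  proof (rule H1_I)
    show "(\<lambda>x. 0) \<in> L2 M" "(\<lambda>x. 0::real^'n) \<in> L2 M" by (auto simp: L2_def)
    show "has_weak_grad \<Omega> (\<lambda>x. 0) (\<lambda>x. 0)" by (simp add: has_weak_grad_def)
  qed
  then show "H1 \<Omega> \<noteq> {}" by blast
next
  fix u v w :: "real^'n \<Rightarrow> real" and a b :: real
  assume u: "u \<in> H1 \<Omega>" and v: "v \<in> H1 \<Omega>"
  show "(\<lambda>x. a * u x + b * v x) \<in> H1 \<Omega>" by (rule H1_lincomb[OF u v])
  assume w: "w \<in> H1 \<Omega>"
  have "wform \<rho> (\<lambda>x. a * u x + b * v x) w
      = (LINT x|M. \<rho> x * ((a *\<^sub>R wgrad \<Omega> u x + b *\<^sub>R wgrad \<Omega> v x) \<bullet> wgrad \<Omega> w x))"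
    unfolding wform_def
    by (rule wform_cong_grad[OF \<rho>]) (auto intro!: wgrad_L2 H1_lincomb L2_lincomb_scaleR wgrad_lincomb u v w)
  also have "\<dots> = (LINT x|M. a * (\<rho> x * (wgrad \<Omega> u x \<bullet> wgrad \<Omega> w x)) + b * (\<rho> x * (wgrad \<Omega> v x \<bullet> wgrad \<Omega> w x)))"
    by (simp add: inner_add_left algebra_simps)
  also have "\<dots> = a * wform \<rho> u w + b * wform \<rho> v w"
    using wform_integrable[OF \<rho> u w] wform_integrable[OF \<rho> v w] by (simp add: wform_def)
  finally show "wform \<rho> (\<lambda>x. a * u x + b * v x) w = a * wform \<rho> u w + b * wform \<rho> v w" .
next
  fix u assume "u \<in> H1 \<Omega>"
  have "AE x in M. 0 \<le> \<rho> x" using \<rho> by (simp add: weight_def)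
  then show "wform \<rho> u u \<ge> 0"
    unfolding wform_def by (intro integral_nonneg_AE) (auto elim!: eventually_mono)
qed (simp add: wform_def inner_commute)

lemma wform_le:
  assumes \<rho>: "weight \<rho> R" and u: "u \<in> H1 \<Omega>"
  shows "wform \<rho> u u \<le> R * wform (\<lambda>x. 1) u u"
proof -
  have "AE x in M. \<rho> x \<le> R" using \<rho> by (simp add: weight_def)
  then have "wform \<rho> u u \<le> (LINT x|M. R * (1 * (wgrad \<Omega> u x \<bullet> wgrad \<Omega> u x)))"
    unfolding wform_def
    by (intro integral_mono_AE[OF wform_integrable[OF \<rho> u u] integrable_mult_right[OF wform_integrable[OF weight_one u u]]])
       (auto elim!: eventually_mono intro: mult_right_mono)
  then show ?thesis by (simp add: wform_def)
qed

lemma H1_semi_inner: "semi_inner_space (H1 \<Omega>) H1_inner"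
proof -
  interpret D: semi_inner_space "H1 \<Omega>" "wform (\<lambda>x. 1)" by (rule wform_semi_inner[OF weight_one])
  interpret L: semi_inner_space "L2 M" "L2_inner M :: (real^'n \<Rightarrow> real) \<Rightarrow> _" by (rule L2_semi_inner)
  show ?thesis
    unfolding H1_inner_def wform_one[symmetric]
    using D.nonempty by unfold_locales
      (auto simp: D.lincomb D.B_lincomb L.B_lincomb H1_L2 D.B_sym L.B_sym algebra_simps D.B_nonneg L.B_nonneg)
qed

lemma H1_norm_eq: "H1_norm \<Omega> u = sqrt (H1_inner u u)"
  by (simp add: H1_norm_def H1_inner_def L2_norm_square)

text \<open>The functions and their gradients converge separately in \<open>L\<^sup>2\<close>; testing against a fixed test function shows
  that the limit of the gradients is the weak gradient of the limit.\<close>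

lemma H1_complete: "semi_hilbert (H1 \<Omega>) H1_inner"
proof -
  interpret H: semi_inner_space "H1 \<Omega>" H1_inner by (rule H1_semi_inner)
  interpret L: semi_inner_space "L2 M" "L2_inner M :: (real^'n \<Rightarrow> real) \<Rightarrow> _" by (rule L2_semi_inner)
  show ?thesis
  proof unfold_locales
    fix F :: "nat \<Rightarrow> real^'n \<Rightarrow> real"
    assume F: "\<And>n. F n \<in> H1 \<Omega>"
      and cauchy: "\<And>e. e > 0 \<Longrightarrow> \<exists>N. \<forall>m\<ge>N. \<forall>n\<ge>N. H1_inner (\<lambda>x. F m x - F n x) (\<lambda>x. F m x - F n x) < e"
    have grad_diff: "L2_inner M (wgrad \<Omega> (\<lambda>x. u x - v x)) (wgrad \<Omega> (\<lambda>x. u x - v x)) = (LINT x|M. (norm (wgrad \<Omega> u x - G x))\<^sup>2)"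
      if u: "u \<in> H1 \<Omega>" and v: "v \<in> H1 \<Omega>" and G: "G \<in> L2 M" "AE x in M. wgrad \<Omega> v x = G x" for u v G
    proof -
      have "AE x in M. wgrad \<Omega> (\<lambda>x. u x - v x) x = wgrad \<Omega> u x - G x"
        using wgrad_diff[OF u v] G(2) by eventually_elim simp
      then show ?thesis unfolding L2_inner_self
        using L2_measurable[OF wgrad_L2[OF H.diff_mem[OF u v]]] L2_measurable[OF L2_diff[OF wgrad_L2[OF u] G(1)]]
        by (intro integral_cong_AE borel_measurable_power borel_measurable_norm) (auto elim!: eventually_mono)
    qed
    have split: "H1_inner (\<lambda>x. F m x - F n x) (\<lambda>x. F m x - F n x)
       = (LINT x|M. (norm (F m x - F n x))\<^sup>2) + (LINT x|M. (norm (wgrad \<Omega> (F m) x - wgrad \<Omega> (F n) x))\<^sup>2)" for m n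
      using grad_diff[OF F[of m] F[of n] wgrad_L2[OF F[of n]]] by (simp add: H1_inner_def L2_inner_self)
    have nn: "0 \<le> (LINT x|M. (norm (F m x - F n x))\<^sup>2)" "0 \<le> (LINT x|M. (norm (wgrad \<Omega> (F m) x - wgrad \<Omega> (F n) x))\<^sup>2)" for m n
      by simp_all
    have "\<exists>f\<in>L2 M. (\<lambda>n. LINT x|M. (norm (F n x - f x))\<^sup>2) \<longlonglongrightarrow> 0"
    proof (rule L2_complete[OF H1_L2[OF F]])
      fix e :: real assume "e > 0"
      from cauchy[OF this] obtain N where N: "\<And>m n. m \<ge> N \<Longrightarrow> n \<ge> N \<Longrightarrow> H1_inner (\<lambda>x. F m x - F n x) (\<lambda>x. F m x - F n x) < e" by blast
      have "(LINT x|M. (norm (F m x - F n x))\<^sup>2) < e" if "m \<ge> N" "n \<ge> N" for m n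
        using N[OF that] nn(2)[of m n] unfolding split by linarith
      then show "\<exists>N. \<forall>m\<ge>N. \<forall>n\<ge>N. (LINT x|M. (norm (F m x - F n x))\<^sup>2) < e" by blast
    qed
    then obtain f where f: "f \<in> L2 M" "(\<lambda>n. LINT x|M. (norm (F n x - f x))\<^sup>2) \<longlonglongrightarrow> 0" by blast
    have "\<exists>G\<in>L2 M. (\<lambda>n. LINT x|M. (norm (wgrad \<Omega> (F n) x - G x))\<^sup>2) \<longlonglongrightarrow> 0"
    proof (rule L2_complete[OF wgrad_L2[OF F]])
      fix e :: real assume "e > 0"
      from cauchy[OF this] obtain N where N: "\<And>m n. m \<ge> N \<Longrightarrow> n \<ge> N \<Longrightarrow> H1_inner (\<lambda>x. F m x - F n x) (\<lambda>x. F m x - F n x) < e" by blast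
      have "(LINT x|M. (norm (wgrad \<Omega> (F m) x - wgrad \<Omega> (F n) x))\<^sup>2) < e" if "m \<ge> N" "n \<ge> N" for m n
        using N[OF that] nn(1)[of m n] unfolding split by linarith
      then show "\<exists>N. \<forall>m\<ge>N. \<forall>n\<ge>N. (LINT x|M. (norm (wgrad \<Omega> (F m) x - wgrad \<Omega> (F n) x))\<^sup>2) < e" by blast
    qed
    then obtain G where G: "G \<in> L2 M" "(\<lambda>n. LINT x|M. (norm (wgrad \<Omega> (F n) x - G x))\<^sup>2) \<longlonglongrightarrow> 0" by blast
    \<comment> \<open>The rate is a separate sequence \<open>e\<close> because components of the gradients are dominated by the whole gradients.\<close>
    have lim: "(\<lambda>n. LINT x|M. h n x * \<psi> x) \<longlonglongrightarrow> (LINT x|M. k x * \<psi> x)"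
      if h: "\<And>n. h n \<in> L2 M" and k: "k \<in> L2 M" and \<psi>: "\<psi> \<in> L2 M" and e: "e \<longlonglongrightarrow> 0"
        and le: "\<And>n. (LINT x|M. (norm (h n x - k x))\<^sup>2) \<le> e n" for h and k \<psi> :: "real^'n \<Rightarrow> real" and e
    proof (rule LIM_zero_cancel, rule Lim_null_comparison)
      show "\<forall>\<^sub>F n in sequentially. norm ((LINT x|M. h n x * \<psi> x) - (LINT x|M. k x * \<psi> x)) \<le> sqrt (e n) * L.nm \<psi>"
      proof (intro always_eventually allI)
        fix n
        have "L2_inner M (\<lambda>x. h n x - k x) \<psi> = (LINT x|M. h n x * \<psi> x) - (LINT x|M. k x * \<psi> x)"
          using L2_mult_integrable[OF h \<psi>] L2_mult_integrable[OF k \<psi>] by (simp add: L2_inner_def left_diff_distrib)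
        moreover have "L.nm (\<lambda>x. h n x - k x) \<le> sqrt (e n)"
          unfolding L.nm_def L2_inner_self by (intro real_sqrt_le_mono le)
        ultimately show "norm ((LINT x|M. h n x * \<psi> x) - (LINT x|M. k x * \<psi> x)) \<le> sqrt (e n) * L.nm \<psi>"
          using L.Cauchy_Schwarz[OF L.diff_mem[OF h k] \<psi>, of n] mult_right_mono[OF _ L.nm_nonneg[OF \<psi>]] by fastforce
      qed
      show "(\<lambda>n. sqrt (e n) * L.nm \<psi>) \<longlonglongrightarrow> 0"
        using tendsto_mult[OF tendsto_real_sqrt[OF e] tendsto_const] by simp
    qed
    have comp: "(LINT x|M. (norm (wgrad \<Omega> (F n) x $ i - G x $ i))\<^sup>2) \<le> (LINT x|M. (norm (wgrad \<Omega> (F n) x - G x))\<^sup>2)" for n i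
    proof (rule integral_mono)
      show "integrable M (\<lambda>x. (norm (wgrad \<Omega> (F n) x $ i - G x $ i))\<^sup>2)"
        using L2_component[OF L2_diff[OF wgrad_L2[OF F] G(1)]] by (simp add: L2_def)
      show "integrable M (\<lambda>x. (norm (wgrad \<Omega> (F n) x - G x))\<^sup>2)"
        using L2_diff[OF wgrad_L2[OF F] G(1)] by (simp add: L2_def)
      show "(norm (wgrad \<Omega> (F n) x $ i - G x $ i))\<^sup>2 \<le> (norm (wgrad \<Omega> (F n) x - G x))\<^sup>2" for x
        using component_le_norm_cart[of "wgrad \<Omega> (F n) x - G x" i] by (intro power_mono) auto
    qed
    have weak: "has_weak_grad \<Omega> f G"
      unfolding has_weak_grad_def
    proof (intro allI ballI)
      fix i \<phi> assume \<phi>: "\<phi> \<in> test_functions \<Omega>"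
      have "(\<lambda>n. LINT x|M. F n x * partial_deriv i \<phi> x) \<longlonglongrightarrow> (LINT x|M. f x * partial_deriv i \<phi> x)"
        by (rule lim[OF H1_L2[OF F] f(1) test_function_deriv_L2[OF \<phi>] f(2)]) simp
      moreover have "(\<lambda>n. - (LINT x|M. wgrad \<Omega> (F n) x $ i * \<phi> x)) \<longlonglongrightarrow> - (LINT x|M. G x $ i * \<phi> x)"
        by (intro tendsto_minus lim[OF L2_component[OF wgrad_L2[OF F]] L2_component[OF G(1)] test_function_L2[OF \<phi>] G(2)] comp)
      moreover have "(LINT x|M. F n x * partial_deriv i \<phi> x) = - (LINT x|M. wgrad \<Omega> (F n) x $ i * \<phi> x)" for n
        using has_weak_grad_wgrad[OF F[of n]] \<phi> unfolding has_weak_grad_def by blast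
      ultimately show "(LINT x|M. f x * partial_deriv i \<phi> x) = - (LINT x|M. G x $ i * \<phi> x)"
        using LIMSEQ_unique by simp
    qed
    have fH: "f \<in> H1 \<Omega>" by (rule H1_I[OF f(1) G(1) weak])
    have "H1_inner (\<lambda>x. F n x - f x) (\<lambda>x. F n x - f x)
        = (LINT x|M. (norm (F n x - f x))\<^sup>2) + (LINT x|M. (norm (wgrad \<Omega> (F n) x - G x))\<^sup>2)" for n
      using grad_diff[OF F fH G(1) wgrad_eqI[OF f(1) G(1) weak], of n] by (simp add: H1_inner_def L2_inner_self)
    then have "(\<lambda>n. H1_inner (\<lambda>x. F n x - f x) (\<lambda>x. F n x - f x)) \<longlonglongrightarrow> 0"
      using tendsto_add[OF f(2) G(2)] by simp
    with fH show "\<exists>l\<in>H1 \<Omega>. (\<lambda>n. H1_inner (\<lambda>x. F n x - l x) (\<lambda>x. F n x - l x)) \<longlonglongrightarrow> 0" by blast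
  qed
qed

end

context bounded_domain
begin

lemma H1_zero: "(\<lambda>x. 0) \<in> H1 \<Omega>"
  by (rule semi_inner_space.zero_mem[OF H1_semi_inner])

lemma H1_norm_cong_AE:
  assumes u: "u \<in> L2 M" "v \<in> L2 M" "AE x in M. u x = v x"
  shows "H1_norm \<Omega> u = H1_norm \<Omega> v"
proof -
  have "(LINT x|M. (norm (u x))\<^sup>2) = (LINT x|M. (norm (v x))\<^sup>2)"
    using u L2_measurable[OF u(1)] L2_measurable[OF u(2)]
    by (intro integral_cong_AE borel_measurable_power borel_measurable_norm) (auto elim!: eventually_mono)
  then show ?thesis
    by (simp add: H1_norm_def L2_norm_square L2_inner_self wgrad_cong_AE[OF u])
qed

lemma H1_norm_eq_0_imp_AE:
  assumes u: "u \<in> H1 \<Omega>" "H1_norm \<Omega> u = 0"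
  shows "AE x in M. u x = 0"
proof -
  have i: "integrable M (\<lambda>x. (u x)\<^sup>2)" using H1_L2[OF u(1)] by (simp add: L2_def)
  have "H1_inner u u = 0" using u(2) by (simp add: H1_norm_eq)
  moreover have "H1_inner u u = (LINT x|M. (u x)\<^sup>2) + (LINT x|M. (norm (wgrad \<Omega> u x))\<^sup>2)"
    by (simp add: H1_inner_def L2_inner_self)
  moreover have "0 \<le> (LINT x|M. (u x)\<^sup>2)" "0 \<le> (LINT x|M. (norm (wgrad \<Omega> u x))\<^sup>2)" by simp_all
  ultimately have "(LINT x|M. (u x)\<^sup>2) = 0" by linarith
  then have "AE x in M. (u x)\<^sup>2 = 0" using integral_nonneg_eq_0_iff_AE[OF i] by simp
  then show ?thesis by eventually_elim simp
qed

end

section \<open>The space \<open>X\<close>\<close>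

locale mixed_problem = bounded_domain \<Omega> for \<Omega> :: "(real^'n) set" +
  fixes BD :: "(real^'n) set" and \<gamma>0 :: "(real^'n \<Rightarrow> real) \<Rightarrow> real^'n \<Rightarrow> real" and c :: real
  assumes trace: "trace_operator \<Omega> \<gamma>0"
    and c_pos: "c > 0"
    and poincare: "\<phi> \<in> X_space \<Omega> BD \<gamma>0 \<Longrightarrow> H1_norm \<Omega> \<phi> \<le> c * X_norm \<Omega> \<phi>"
begin

abbreviation X where "X \<equiv> X_space \<Omega> BD \<gamma>0"
abbreviation SM where "SM \<equiv> surface_measure \<Omega>"

lemma X_H1: "u \<in> X \<Longrightarrow> u \<in> H1 \<Omega>"
  by (simp add: X_space_def)

lemma trace_L2: "u \<in> H1 \<Omega> \<Longrightarrow> \<gamma>0 u \<in> L2 SM"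
  using trace by (simp add: trace_operator_def)

lemma trace_lincomb:
  "u \<in> H1 \<Omega> \<Longrightarrow> v \<in> H1 \<Omega> \<Longrightarrow> AE y in SM. \<gamma>0 (\<lambda>x. a * u x + b * v x) y = a * \<gamma>0 u y + b * \<gamma>0 v y"
  using trace by (simp add: trace_operator_def)

lemma X_lincomb:
  assumes "u \<in> X" "v \<in> X" shows "(\<lambda>x. a * u x + b * v x) \<in> X"
proof -
  have "AE y in SM. y \<in> BD \<longrightarrow> \<gamma>0 u y = 0" "AE y in SM. y \<in> BD \<longrightarrow> \<gamma>0 v y = 0"
    using assms by (auto simp: X_space_def)
  with trace_lincomb[OF X_H1[OF assms(1)] X_H1[OF assms(2)], of a b]
  have "AE y in SM. y \<in> BD \<longrightarrow> \<gamma>0 (\<lambda>x. a * u x + b * v x) y = 0"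
    by eventually_elim simp
  then show ?thesis using assms by (simp add: X_space_def H1_lincomb)
qed

lemma X_zero: "(\<lambda>x. 0) \<in> X"
proof -
  have "AE y in SM. \<gamma>0 (\<lambda>x. 0 * 0 + 0 * 0) y = 0 * \<gamma>0 (\<lambda>x. 0) y + 0 * \<gamma>0 (\<lambda>x. 0) y"
    by (rule trace_lincomb[OF H1_zero H1_zero])
  then show ?thesis using H1_zero by (auto simp: X_space_def elim!: eventually_mono)
qed

text \<open>Along a sequence converging in \<open>H\<^sup>1\<close> the traces converge in \<open>L\<^sup>2\<close> of the boundary, so by Fatou's
  lemma the trace of the limit vanishes wherever all the traces do.\<close>

lemma X_closed:
  assumes u: "u \<in> H1 \<Omega>" and F: "\<And>n. F n \<in> X" and lim: "(\<lambda>n. H1_norm \<Omega> (\<lambda>x. u x - F n x)) \<longlonglongrightarrow> 0"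
  shows "u \<in> X"
proof -
  define h where "h n y = \<gamma>0 u y - \<gamma>0 (F n) y" for n :: nat and y
  have hL: "h n \<in> L2 SM" for n unfolding h_def by (intro L2_diff trace_L2 u X_H1 F)
  obtain C where C: "\<And>v. v \<in> H1 \<Omega> \<Longrightarrow> L2_norm SM (\<gamma>0 v) \<le> C * H1_norm \<Omega> v"
    using trace unfolding trace_operator_def by blast
  define e where "e n = C * H1_norm \<Omega> (\<lambda>x. u x - F n x)" for n
  have bound: "(\<integral>\<^sup>+y. ennreal ((h n y)\<^sup>2) \<partial>SM) \<le> ennreal ((e n)\<^sup>2)" for n
  proof -
    have m: "(\<lambda>x. u x - F n x) \<in> H1 \<Omega>" using H1_lincomb[OF u X_H1[OF F[of n]], of 1 "-1"] by simp
    have "AE y in SM. \<gamma>0 (\<lambda>x. u x - F n x) y = h n y"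
      using trace_lincomb[OF u X_H1[OF F[of n]], of 1 "-1"] by (simp add: h_def)
    then have "(LINT y|SM. (h n y)\<^sup>2) = (LINT y|SM. (\<gamma>0 (\<lambda>x. u x - F n x) y)\<^sup>2)"
      using L2_measurable[OF hL[of n]] L2_measurable[OF trace_L2[OF m]]
      by (intro integral_cong_AE borel_measurable_power) (auto elim!: eventually_mono)
    also have "\<dots> = (L2_norm SM (\<gamma>0 (\<lambda>x. u x - F n x)))\<^sup>2" by (simp add: L2_norm_square L2_inner_self)
    also have "\<dots> \<le> (e n)\<^sup>2"
      using C[OF m] unfolding e_def by (intro power_mono) (auto simp: L2_norm_def L2_inner_self)
    finally show ?thesis
      using hL[of n] by (simp add: L2_def nn_integral_eq_integral ennreal_leI)
  qed
  have hm: "(\<lambda>y. ennreal ((h n y)\<^sup>2)) \<in> borel_measurable SM" for n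
    using L2_measurable[OF hL[of n]] by simp
  have "e \<longlonglongrightarrow> C * 0" unfolding e_def by (intro tendsto_mult tendsto_const lim)
  then have "(\<lambda>n. ennreal ((e n)\<^sup>2)) \<longlonglongrightarrow> ennreal ((C * 0)\<^sup>2)" by (intro tendsto_ennrealI tendsto_power)
  then have lime: "liminf (\<lambda>n. ennreal ((e n)\<^sup>2)) = 0"
    using lim_imp_Liminf[OF sequentially_bot] by fastforce
  have "(\<integral>\<^sup>+y. liminf (\<lambda>n. ennreal ((h n y)\<^sup>2)) \<partial>SM) \<le> liminf (\<lambda>n. \<integral>\<^sup>+y. ennreal ((h n y)\<^sup>2) \<partial>SM)"
    by (rule nn_integral_liminf[OF hm])
  also have "\<dots> \<le> liminf (\<lambda>n. ennreal ((e n)\<^sup>2))"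
    by (intro Liminf_mono always_eventually allI bound)
  finally have "(\<integral>\<^sup>+y. liminf (\<lambda>n. ennreal ((h n y)\<^sup>2)) \<partial>SM) = 0" using lime by simp
  then have "AE y in SM. liminf (\<lambda>n. ennreal ((h n y)\<^sup>2)) = 0"
    by (subst (asm) nn_integral_0_iff_AE) (auto intro: borel_measurable_liminf hm)
  moreover have "AE y in SM. \<forall>n. y \<in> BD \<longrightarrow> \<gamma>0 (F n) y = 0"
    by (subst AE_all_countable) (use F in \<open>auto simp: X_space_def\<close>)
  ultimately have "AE y in SM. y \<in> BD \<longrightarrow> \<gamma>0 u y = 0"
    by eventually_elim (auto simp: h_def Liminf_const)
  then show ?thesis using u by (simp add: X_space_def)
qed

text \<open>A constant sequence at distance zero from \<open>v\<close> is a special case of closedness.\<close>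

lemma X_cong_AE:
  assumes "u \<in> X" "v \<in> H1 \<Omega>" "AE x in M. v x = u x"
  shows "v \<in> X"
proof (rule X_closed[where F = "\<lambda>n. u"])
  have d: "(\<lambda>x. v x - u x) \<in> L2 M" using L2_diff[OF H1_L2[OF assms(2)] H1_L2[OF X_H1[OF assms(1)]]] .
  have "H1_norm \<Omega> (\<lambda>x. v x - u x) = H1_norm \<Omega> (\<lambda>x. 0)"
    by (rule H1_norm_cong_AE[OF d H1_L2[OF H1_zero]]) (use assms(3) in \<open>auto elim!: eventually_mono\<close>)
  also have "\<dots> = 0"
    using semi_inner_space.B_zero[OF H1_semi_inner H1_zero] by (simp add: H1_norm_eq)
  finally show "(\<lambda>n::nat. H1_norm \<Omega> (\<lambda>x. v x - u x)) \<longlonglongrightarrow> 0" by simp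
qed (use assms in auto)

lemma semi_inner_space_X:
  assumes "semi_inner_space (H1 \<Omega>) B" shows "semi_inner_space X B"
proof -
  interpret semi_inner_space "H1 \<Omega>" B by fact
  show ?thesis
    using X_zero by unfold_locales (auto intro: X_lincomb simp: X_H1 B_lincomb B_nonneg intro: B_sym)
qed

lemma grad_semi_inner: "semi_inner_space (H1 \<Omega>) (\<lambda>u v. L2_inner M (wgrad \<Omega> u) (wgrad \<Omega> v))"
proof -
  have "wform (\<lambda>x. 1) = (\<lambda>u v. L2_inner M (wgrad \<Omega> u) (wgrad \<Omega> v))" by (simp add: fun_eq_iff wform_one)
  then show ?thesis using wform_semi_inner[OF weight_one] by simp
qed

lemma X_norm_eq: "X_norm \<Omega> u = sqrt (L2_inner M (wgrad \<Omega> u) (wgrad \<Omega> u))"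
  by (simp add: X_norm_def L2_norm_def)

text \<open>By the Poincare inequality a Cauchy sequence for the gradient norm is Cauchy in \<open>H\<^sup>1\<close>.\<close>

lemma X_complete: "semi_hilbert X (\<lambda>u v. L2_inner M (wgrad \<Omega> u) (wgrad \<Omega> v))"
proof -
  let ?B = "\<lambda>u v. L2_inner M (wgrad \<Omega> u) (wgrad \<Omega> v)"
  interpret X: semi_inner_space X ?B by (rule semi_inner_space_X[OF grad_semi_inner])
  interpret H: semi_hilbert "H1 \<Omega>" H1_inner by (rule H1_complete)
  have le: "?B u u \<le> H1_inner u u" for u by (simp add: H1_inner_def L2_inner_self)
  have ge: "H1_inner u u \<le> c\<^sup>2 * ?B u u" if "u \<in> X" for u
  proof -
    have "(sqrt (H1_inner u u))\<^sup>2 \<le> (c * sqrt (?B u u))\<^sup>2"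
      using poincare[OF that] H.B_nonneg[OF X_H1[OF that]] by (intro power_mono) (auto simp: H1_norm_eq X_norm_eq)
    then show ?thesis using H.B_nonneg[OF X_H1[OF that]] X.B_nonneg[OF that] by (simp add: power_mult_distrib)
  qed
  show ?thesis
  proof unfold_locales
    fix F :: "nat \<Rightarrow> real^'n \<Rightarrow> real"
    assume F: "\<And>n. F n \<in> X"
      and cauchy: "\<And>e. e > 0 \<Longrightarrow> \<exists>N. \<forall>m\<ge>N. \<forall>n\<ge>N. ?B (\<lambda>x. F m x - F n x) (\<lambda>x. F m x - F n x) < e"
    have "\<exists>l\<in>H1 \<Omega>. (\<lambda>n. H1_inner (\<lambda>x. F n x - l x) (\<lambda>x. F n x - l x)) \<longlonglongrightarrow> 0"
    proof (rule H.complete[OF X_H1[OF F]])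
      fix e :: real assume "e > 0"
      then have "e / c\<^sup>2 > 0" using c_pos by simp
      from cauchy[OF this] obtain N where N: "\<And>m n. m \<ge> N \<Longrightarrow> n \<ge> N \<Longrightarrow> ?B (\<lambda>x. F m x - F n x) (\<lambda>x. F m x - F n x) < e / c\<^sup>2"
        by blast
      have "H1_inner (\<lambda>x. F m x - F n x) (\<lambda>x. F m x - F n x) < e" if "m \<ge> N" "n \<ge> N" for m n
        using N[OF that] ge[OF X.diff_mem[OF F F], of m n] c_pos by (simp add: field_simps)
      then show "\<exists>N. \<forall>m\<ge>N. \<forall>n\<ge>N. H1_inner (\<lambda>x. F m x - F n x) (\<lambda>x. F m x - F n x) < e" by blast
    qed
    then obtain l where l: "l \<in> H1 \<Omega>" "(\<lambda>n. H1_inner (\<lambda>x. F n x - l x) (\<lambda>x. F n x - l x)) \<longlonglongrightarrow> 0" by blast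
    have "(\<lambda>n. H1_norm \<Omega> (\<lambda>x. l x - F n x)) \<longlonglongrightarrow> 0"
      using tendsto_real_sqrt[OF l(2)] H.nm_minus_commute[OF l(1) X_H1[OF F]] by (simp add: H1_norm_eq H.nm_def)
    then have "l \<in> X" by (rule X_closed[OF l(1) F])
    moreover have "(\<lambda>n. ?B (\<lambda>x. F n x - l x) (\<lambda>x. F n x - l x)) \<longlonglongrightarrow> 0"
    proof (rule Lim_null_comparison[OF _ l(2)])
      show "\<forall>\<^sub>F n in sequentially. norm (?B (\<lambda>x. F n x - l x) (\<lambda>x. F n x - l x)) \<le> H1_inner (\<lambda>x. F n x - l x) (\<lambda>x. F n x - l x)"
        using le by (intro always_eventually allI) (simp add: L2_inner_self)
    qed
    ultimately show "\<exists>l\<in>X. (\<lambda>n. ?B (\<lambda>x. F n x - l x) (\<lambda>x. F n x - l x)) \<longlonglongrightarrow> 0" by blast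
  qed
qed

sublocale X: semi_hilbert X "\<lambda>u v. L2_inner M (wgrad \<Omega> u) (wgrad \<Omega> v)"
  by (rule X_complete)

sublocale H: semi_hilbert "H1 \<Omega>" H1_inner
  by (rule H1_complete)

sublocale G: semi_inner_space "H1 \<Omega>" "\<lambda>u v. L2_inner M (wgrad \<Omega> u) (wgrad \<Omega> v)"
  by (rule grad_semi_inner)

lemma nm_eqs: "X.nm = X_norm \<Omega>" "H.nm = H1_norm \<Omega>" "G.nm = X_norm \<Omega>"
  by (auto simp: fun_eq_iff X.nm_def G.nm_def X_norm_eq H.nm_def H1_norm_eq)

lemma dual_eqs: "X.dual = X_dual \<Omega> X" "X.dnorm = X_dual_norm \<Omega> X" "X.riesz = ND_inverse \<Omega> X"
  by (auto simp: fun_eq_iff X.dual_def X_dual_def X.dnorm_def X_dual_norm_def X.riesz_def ND_inverse_def nm_eqs)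

text \<open>The fixed function \<open>\<omega>\<close> cancels from all differences of values of \<open>W\<close>. The shift by \<open>\<omega>\<close> serves for \<open>V = \<omega> + u\<close>,
  and the shift by zero for passing to another representative of the same curve.\<close>

lemma C1_shift:
  assumes U: "has_C1_deriv T X (X_norm \<Omega>) U U'"
    and W: "\<And>t. t \<in> {0..T} \<Longrightarrow> W t \<in> H1 \<Omega>" "\<And>t. t \<in> {0..T} \<Longrightarrow> AE x in M. W t x = \<omega> x + U t x"
  shows "has_C1_deriv T (H1 \<Omega>) (H1_norm \<Omega>) W U'"
    and "(\<And>t. t \<in> {0..T} \<Longrightarrow> W t \<in> X) \<Longrightarrow> has_C1_deriv T X (X_norm \<Omega>) W U'"
proof -
  have m: "U s \<in> X" "U' s \<in> X" if "s \<in> {0..T}" for s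
    using U that unfolding has_C1_deriv_def by auto
  have ae: "AE x in M. (W s x - W t x) / (s - t) - U' t x = (U s x - U t x) / (s - t) - U' t x"
    if "s \<in> {0..T}" "t \<in> {0..T}" for s t
    using W(2)[OF that(1)] W(2)[OF that(2)] by eventually_elim simp
  have WL: "(\<lambda>x. (W s x - W t x) / (s - t) - U' t x) \<in> L2 M" if "s \<in> {0..T}" "t \<in> {0..T}" for s t
    using that by (intro H1_L2 H.quotient_mem W(1) X_H1 m)
  have UX: "(\<lambda>x. (U s x - U t x) / (s - t) - U' t x) \<in> X" if "s \<in> {0..T}" "t \<in> {0..T}" for s t
    using that by (intro X.quotient_mem m)
  have h: "H1_norm \<Omega> (\<lambda>x. (W s x - W t x) / (s - t) - U' t x) \<le> c * X_norm \<Omega> (\<lambda>x. (U s x - U t x) / (s - t) - U' t x)"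
    if "s \<in> {0..T}" "t \<in> {0..T}" for s t
    using poincare[OF UX[OF that]] H1_norm_cong_AE[OF WL[OF that] H1_L2[OF X_H1[OF UX[OF that]]] ae[OF that]] by simp
  have x: "X_norm \<Omega> (\<lambda>x. (W s x - W t x) / (s - t) - U' t x) = X_norm \<Omega> (\<lambda>x. (U s x - U t x) / (s - t) - U' t x)"
    if "s \<in> {0..T}" "t \<in> {0..T}" for s t
    unfolding X_norm_def wgrad_cong_AE[OF WL[OF that] H1_L2[OF X_H1[OF UX[OF that]]] ae[OF that]] ..
  have lim: "((\<lambda>s. X_norm \<Omega> (\<lambda>x. (U s x - U t x) / (s - t) - U' t x)) \<longlongrightarrow> 0) (at t within {0..T})"
    "((\<lambda>s. X_norm \<Omega> (\<lambda>x. U' s x - U' t x)) \<longlongrightarrow> 0) (at t within {0..T})" if "t \<in> {0..T}" for t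
    using U that unfolding has_C1_deriv_def by auto
  have H1nn: "H1_norm \<Omega> u \<ge> 0" for u by (simp add: H1_norm_def)
  show "has_C1_deriv T (H1 \<Omega>) (H1_norm \<Omega>) W U'"
    unfolding has_C1_deriv_def
  proof (intro ballI conjI)
    fix t assume t: "t \<in> {0..T}"
    show "W t \<in> H1 \<Omega>" "U' t \<in> H1 \<Omega>" using W(1)[OF t] X_H1[OF m(2)[OF t]] by auto
    show "((\<lambda>s. H1_norm \<Omega> (\<lambda>x. (W s x - W t x) / (s - t) - U' t x)) \<longlongrightarrow> 0) (at t within {0..T})"
    proof (rule Lim_null_comparison[OF _ tendsto_mult_right_zero[OF lim(1)[OF t], of c]])
      show "\<forall>\<^sub>F s in at t within {0..T}. norm (H1_norm \<Omega> (\<lambda>x. (W s x - W t x) / (s - t) - U' t x))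
          \<le> c * X_norm \<Omega> (\<lambda>x. (U s x - U t x) / (s - t) - U' t x)"
        unfolding eventually_at_filter using h[OF _ t] H1nn by (intro always_eventually) simp
    qed
    show "((\<lambda>s. H1_norm \<Omega> (\<lambda>x. U' s x - U' t x)) \<longlongrightarrow> 0) (at t within {0..T})"
    proof (rule Lim_null_comparison[OF _ tendsto_mult_right_zero[OF lim(2)[OF t], of c]])
      show "\<forall>\<^sub>F s in at t within {0..T}. norm (H1_norm \<Omega> (\<lambda>x. U' s x - U' t x)) \<le> c * X_norm \<Omega> (\<lambda>x. U' s x - U' t x)"
        unfolding eventually_at_filter using poincare[OF X.diff_mem[OF m(2) m(2)[OF t]]] H1nn
        by (intro always_eventually) simp
    qed
  qed
  assume WX: "\<And>t. t \<in> {0..T} \<Longrightarrow> W t \<in> X"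
  show "has_C1_deriv T X (X_norm \<Omega>) W U'"
    unfolding has_C1_deriv_def
  proof (intro ballI conjI)
    fix t assume t: "t \<in> {0..T}"
    show "W t \<in> X" "U' t \<in> X" using WX[OF t] m(2)[OF t] by auto
    show "((\<lambda>s. X_norm \<Omega> (\<lambda>x. (W s x - W t x) / (s - t) - U' t x)) \<longlongrightarrow> 0) (at t within {0..T})"
      using lim(1)[OF t]
    proof (rule Lim_transform_eventually)
      show "\<forall>\<^sub>F s in at t within {0..T}. X_norm \<Omega> (\<lambda>x. (U s x - U t x) / (s - t) - U' t x)
          = X_norm \<Omega> (\<lambda>x. (W s x - W t x) / (s - t) - U' t x)"
        unfolding eventually_at_filter using x[OF _ t] by (intro always_eventually) simp
    qed
    show "((\<lambda>s. X_norm \<Omega> (\<lambda>x. U' s x - U' t x)) \<longlongrightarrow> 0) (at t within {0..T})" by (rule lim(2)[OF t])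
  qed
qed

end

section \<open>The initial-boundary value problem\<close>

text \<open>The number \<open>S\<close> is an upper bound of \<open>\<sigma> / \<epsilon>\<close>; it is later taken to be \<open>\<parallel>\<sigma>\<parallel> / \<epsilon>\<close>.\<close>

locale mixed_evolution = mixed_problem \<Omega> BD \<gamma>0 c for \<Omega> :: "(real^'n) set" and BD \<gamma>0 c +
  fixes gt \<sigma> :: "real^'n \<Rightarrow> real" and \<epsilon> S T :: real
  assumes gt: "gt \<in> H1 \<Omega>"
    and weight_s: "weight (\<lambda>x. \<sigma> x / \<epsilon>) S"
    and S_nonneg: "S \<ge> 0"
    and T_pos: "T > 0"
begin

abbreviation s where "s \<equiv> \<lambda>x. \<sigma> x / \<epsilon>"
abbreviation a where "a \<equiv> \<lambda>x. \<sigma> x / \<epsilon> + 1"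
abbreviation D where "D \<equiv> \<lambda>u v. L2_inner M (wgrad \<Omega> u) (wgrad \<Omega> v)"

lemma weight_a: "weight a (1 + S)"
  using weight_s by (auto simp: weight_def elim!: eventually_mono)

lemma wform_a: "u \<in> H1 \<Omega> \<Longrightarrow> v \<in> H1 \<Omega> \<Longrightarrow> wform a u v = wform s u v + D u v"
  using wform_integrable[OF weight_s, of u v] wform_integrable[OF weight_one, of u v]
  by (simp add: wform_def L2_inner_def distrib_right)

sublocale Hs: semi_inner_space "H1 \<Omega>" "wform s" by (rule wform_semi_inner[OF weight_s])
sublocale Ha: semi_inner_space "H1 \<Omega>" "wform a" by (rule wform_semi_inner[OF weight_a])

lemma s_le: "u \<in> H1 \<Omega> \<Longrightarrow> wform s u u \<le> S * D u u"
  using wform_le[OF weight_s] by (simp add: wform_one)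

lemma a_le: "u \<in> H1 \<Omega> \<Longrightarrow> wform a u u \<le> (1 + S) * D u u"
  using wform_le[OF weight_a] by (simp add: wform_one)

lemma a_ge: "u \<in> H1 \<Omega> \<Longrightarrow> D u u \<le> wform a u u"
  using Hs.B_nonneg[of u] by (simp add: wform_a)

sublocale E: evolution X D "wform s" "sqrt S"
proof (intro evolution.intro evolution_axioms.intro)
  show "semi_inner_space X (wform s)" by (rule semi_inner_space_X[OF Hs.semi_inner_space_axioms])
qed (use s_le X_H1 S_nonneg X.semi_hilbert_axioms in auto)

text \<open>Since \<open>1 \<le> a \<le> 1 + S\<close>, the weighted inner product is equivalent to the unweighted one.\<close>

lemma A_hilbert: "semi_hilbert X (wform a)"
proof -
  interpret semi_inner_space X "wform a" by (rule semi_inner_space_X[OF Ha.semi_inner_space_axioms])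
  show ?thesis
  proof unfold_locales
    fix F :: "nat \<Rightarrow> real^'n \<Rightarrow> real"
    assume F: "\<And>n. F n \<in> X"
      and cauchy: "\<And>e. e > 0 \<Longrightarrow> \<exists>N. \<forall>m\<ge>N. \<forall>n\<ge>N. wform a (\<lambda>x. F m x - F n x) (\<lambda>x. F m x - F n x) < e"
    have "\<exists>l\<in>X. (\<lambda>n. D (\<lambda>x. F n x - l x) (\<lambda>x. F n x - l x)) \<longlonglongrightarrow> 0"
    proof (rule X.complete[OF F])
      fix e :: real assume "e > 0"
      from cauchy[OF this] show "\<exists>N. \<forall>m\<ge>N. \<forall>n\<ge>N. D (\<lambda>x. F m x - F n x) (\<lambda>x. F m x - F n x) < e"
        using a_ge[OF X_H1[OF diff_mem[OF F F]]] by (meson order_le_less_trans)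
    qed
    then obtain l where l: "l \<in> X" "(\<lambda>n. D (\<lambda>x. F n x - l x) (\<lambda>x. F n x - l x)) \<longlonglongrightarrow> 0" by blast
    have "(\<lambda>n. wform a (\<lambda>x. F n x - l x) (\<lambda>x. F n x - l x)) \<longlonglongrightarrow> 0"
    proof (rule Lim_null_comparison[OF _ tendsto_mult_right_zero[OF l(2), of "1 + S"]])
      show "\<forall>\<^sub>F n in sequentially. norm (wform a (\<lambda>x. F n x - l x) (\<lambda>x. F n x - l x)) \<le> (1 + S) * D (\<lambda>x. F n x - l x) (\<lambda>x. F n x - l x)"
        using a_le[OF X_H1[OF diff_mem[OF F l(1)]]] B_nonneg[OF diff_mem[OF F l(1)]]
        by (intro always_eventually allI) simp
    qed
    with l(1) show "\<exists>l\<in>X. (\<lambda>n. wform a (\<lambda>x. F n x - l x) (\<lambda>x. F n x - l x)) \<longlonglongrightarrow> 0" by blast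
  qed
qed

sublocale A: semi_hilbert X "wform a" by (rule A_hilbert)

text \<open>The conditions on the time-independent part of a weak solution.\<close>

definition stationary :: "(real^'n \<Rightarrow> real) \<Rightarrow> bool" where
  "stationary \<omega> \<longleftrightarrow> \<omega> \<in> H1 \<Omega> \<and> (\<lambda>x. \<omega> x - gt x) \<in> X \<and> (\<forall>\<phi>\<in>X. wform a \<omega> \<phi> = 0)"

text \<open>The correction \<open>\<omega> - gt\<close> represents the functional \<open>\<phi> \<mapsto> - \<integral> a \<nabla>gt \<bullet> \<nabla>\<phi>\<close> in the weighted inner product.\<close>

lemma stationary_exists: "\<exists>\<omega>. stationary \<omega>"
proof -
  have "(\<lambda>\<phi>. - wform a gt \<phi>) \<in> A.dual"
  proof (rule A.dualI[of _ "Ha.nm gt"])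
    fix u assume "u \<in> X"
    then show "\<bar>- wform a gt u\<bar> \<le> Ha.nm gt * A.nm u"
      using Ha.Cauchy_Schwarz[OF gt X_H1, of u] by (simp add: A.nm_def Ha.nm_def)
  qed (simp add: Ha.B_lincomb_right gt X_H1)
  from A.riesz_exists[OF this] obtain h where h: "h \<in> X" "\<And>\<phi>. \<phi> \<in> X \<Longrightarrow> wform a h \<phi> = - wform a gt \<phi>" by blast
  have "stationary (\<lambda>x. gt x + h x)"
    unfolding stationary_def
  proof (intro conjI ballI)
    show "(\<lambda>x. gt x + h x) \<in> H1 \<Omega>" by (intro Ha.add_mem gt X_H1 h)
    show "(\<lambda>x. gt x + h x - gt x) \<in> X" using h by simp
    show "wform a (\<lambda>x. gt x + h x) \<phi> = 0" if "\<phi> \<in> X" for \<phi>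
      using h(2)[OF that] Ha.B_add[OF gt X_H1[OF h(1)] X_H1[OF that]] by simp
  qed
  then show ?thesis by blast
qed

lemma stationary_unique:
  assumes "stationary \<omega>" "stationary \<eta>"
  shows "AE x in M. \<omega> x = \<eta> x"
proof -
  have m: "\<omega> \<in> H1 \<Omega>" "\<eta> \<in> H1 \<Omega>" using assms by (auto simp: stationary_def)
  have "(\<lambda>x. \<omega> x - gt x) \<in> X" "(\<lambda>x. \<eta> x - gt x) \<in> X"
    using assms by (auto simp: stationary_def)
  from X.diff_mem[OF this] have d: "(\<lambda>x. \<omega> x - \<eta> x) \<in> X" by simp
  have "wform a (\<lambda>x. \<omega> x - \<eta> x) (\<lambda>x. \<omega> x - \<eta> x) = 0"
    using assms d Ha.B_diff[OF m X_H1[OF d]] by (simp add: stationary_def)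
  then have "X_norm \<Omega> (\<lambda>x. \<omega> x - \<eta> x) = 0"
    using a_ge[OF X_H1[OF d]] X.B_nonneg[OF d] by (simp add: X_norm_eq)
  then have "H1_norm \<Omega> (\<lambda>x. \<omega> x - \<eta> x) = 0"
    using poincare[OF d] H.nm_nonneg[OF X_H1[OF d]] by (simp add: nm_eqs)
  from H1_norm_eq_0_imp_AE[OF X_H1[OF d] this] show ?thesis by eventually_elim simp
qed

lemma evolution_solution_iff:
  "evolution_solution \<Omega> X \<sigma> \<epsilon> T gt \<omega> w \<longleftrightarrow>
     (\<exists>w'. has_C1_deriv T X.dual X.dnorm w w' \<and>
       (\<forall>\<phi>\<in>X. \<forall>t\<in>{0..T}. w' t \<phi> + wform s (X.riesz (w t)) \<phi> = D \<omega> \<phi>)) \<and>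
     (\<forall>\<phi>\<in>X. w 0 \<phi> = - D (\<lambda>x. \<omega> x - gt x) \<phi>)"
  unfolding evolution_solution_def dual_eqs weak_laplacian_def wform_def by (simp add: L2_inner_def)

text \<open>The stationary parts may differ on a null set, as they do for two weak solutions that are being compared.\<close>

lemma evolution_solution_unique:
  assumes w: "evolution_solution \<Omega> X \<sigma> \<epsilon> T gt \<omega> w" and z: "evolution_solution \<Omega> X \<sigma> \<epsilon> T gt \<eta> z"
    and \<omega>: "\<omega> \<in> H1 \<Omega>" "\<eta> \<in> H1 \<Omega>" "AE x in M. \<omega> x = \<eta> x" and t: "t \<in> {0..T}" and \<phi>: "\<phi> \<in> X"
  shows "w t \<phi> = z t \<phi>"
proof -
  have g: "wgrad \<Omega> \<omega> = wgrad \<Omega> \<eta>" by (rule wgrad_cong_AE[OF H1_L2 H1_L2]) fact+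
  have "AE x in M. \<omega> x - gt x = \<eta> x - gt x" using \<omega>(3) by eventually_elim simp
  then have g2: "wgrad \<Omega> (\<lambda>x. \<omega> x - gt x) = wgrad \<Omega> (\<lambda>x. \<eta> x - gt x)"
    by (intro wgrad_cong_AE H1_L2 Ha.diff_mem \<omega> gt)
  from w obtain w' where w': "has_C1_deriv T X.dual X.dnorm w w'"
    "\<And>\<phi> t. \<phi> \<in> X \<Longrightarrow> t \<in> {0..T} \<Longrightarrow> w' t \<phi> + wform s (X.riesz (w t)) \<phi> = D \<omega> \<phi>"
    "\<And>\<phi>. \<phi> \<in> X \<Longrightarrow> w 0 \<phi> = - D (\<lambda>x. \<omega> x - gt x) \<phi>"
    unfolding evolution_solution_iff by blast
  from z obtain z' where z': "has_C1_deriv T X.dual X.dnorm z z'"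
    "\<And>\<phi> t. \<phi> \<in> X \<Longrightarrow> t \<in> {0..T} \<Longrightarrow> z' t \<phi> + wform s (X.riesz (z t)) \<phi> = D \<eta> \<phi>"
    "\<And>\<phi>. \<phi> \<in> X \<Longrightarrow> z 0 \<phi> = - D (\<lambda>x. \<eta> x - gt x) \<phi>"
    unfolding evolution_solution_iff by blast
  show ?thesis
    by (rule E.evolution_unique[OF w'(1) z'(1), where F = "D \<omega>", OF _ _ _ t \<phi>])
       (auto simp: w' z' g g2)
qed

text \<open>With \<open>h = \<omega> - gt\<close>, the initial velocity at \<open>\<phi>\<close> is \<open>(\<nabla>\<omega>, \<nabla>\<phi>) + \<integral> s \<nabla>h \<bullet> \<nabla>\<phi>\<close>, and the
  equation for \<open>\<omega>\<close> reduces it to \<open>- \<integral> s \<nabla>gt \<bullet> \<nabla>\<phi>\<close>. This is where the bounds of \<open>w'\<close> and \<open>w\<close> in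
  terms of \<open>gt\<close> come from.\<close>

lemma evolution_solution_exists:
  assumes \<omega>: "stationary \<omega>"
  obtains w w' where "evolution_solution \<Omega> X \<sigma> \<epsilon> T gt \<omega> w" "has_C1_deriv T X.dual X.dnorm w w'"
    "\<And>t. t \<in> {0..T} \<Longrightarrow> X.dnorm (w' t) \<le> S * X_norm \<Omega> gt"
    "\<And>t. t \<in> {0..T} \<Longrightarrow> X.dnorm (w t) \<le> X_norm \<Omega> (\<lambda>x. \<omega> x - gt x) + S * X_norm \<Omega> gt * T"
proof -
  let ?h = "\<lambda>x. \<omega> x - gt x"
  have w: "\<omega> \<in> H1 \<Omega>" and h: "?h \<in> X" and st: "\<And>\<phi>. \<phi> \<in> X \<Longrightarrow> wform a \<omega> \<phi> = 0"
    using \<omega> by (auto simp: stationary_def)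
  define \<zeta> where "\<zeta> \<phi> = - D ?h \<phi>" for \<phi>
  have F: "D \<omega> \<in> X.dual"
  proof (rule X.dualI[of _ "X_norm \<Omega> \<omega>"])
    fix u assume "u \<in> X"
    then show "\<bar>D \<omega> u\<bar> \<le> X_norm \<Omega> \<omega> * X.nm u"
      using G.Cauchy_Schwarz[OF w X_H1, of u] by (simp add: nm_eqs)
  qed (simp add: G.B_lincomb_right w X_H1)
  have \<zeta>: "\<zeta> \<in> X.dual"
    using X.dual_lincomb[OF X.dual_B[OF h] X.dual_B[OF h], of "-1" 0] by (simp add: \<zeta>_def[abs_def])
  obtain w w' where ev: "has_C1_deriv T X.dual X.dnorm w w'" "w 0 = \<zeta>"
    "\<And>t \<phi>. t \<in> {0..T} \<Longrightarrow> \<phi> \<in> X \<Longrightarrow> w' t \<phi> + wform s (X.riesz (w t)) \<phi> = D \<omega> \<phi>"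
    "\<And>t. t \<in> {0..T} \<Longrightarrow> X.dnorm (w' t) \<le> X.dnorm (\<lambda>\<phi>. D \<omega> \<phi> - wform s (X.riesz \<zeta>) \<phi>)"
    using E.evolution_exists[OF F \<zeta> T_pos] by blast
  have Snn: "S * X_norm \<Omega> gt \<ge> 0" using S_nonneg G.nm_nonneg[OF gt] by (simp add: nm_eqs)
  have init: "X.dnorm (\<lambda>\<phi>. D \<omega> \<phi> - wform s (X.riesz \<zeta>) \<phi>) \<le> S * X_norm \<Omega> gt"
  proof (rule X.dnorm_le[OF _ Snn])
    fix \<phi> assume \<phi>: "\<phi> \<in> X"
    have "wform s (X.riesz \<zeta>) \<phi> = - D ?h (E.oper \<phi>)"
      using E.dual_oper[OF \<zeta> \<phi>] by (simp add: \<zeta>_def)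
    also have "D ?h (E.oper \<phi>) = wform s \<phi> ?h"
      using X.B_sym[OF h E.oper_mem[OF \<phi>]] X.B_riesz[OF E.b_dual[OF \<phi>] h] by (simp add: E.oper_def)
    also have "\<dots> = wform s \<omega> \<phi> - wform s gt \<phi>"
      using Hs.B_sym[OF X_H1[OF \<phi>] X_H1[OF h]] Hs.B_diff[OF w gt X_H1[OF \<phi>]] by simp
    finally have "D \<omega> \<phi> - wform s (X.riesz \<zeta>) \<phi> = - wform s gt \<phi>"
      using wform_a[OF w X_H1[OF \<phi>]] st[OF \<phi>] by simp
    moreover have "\<bar>wform s gt \<phi>\<bar> \<le> Hs.nm gt * Hs.nm \<phi>" by (rule Hs.Cauchy_Schwarz[OF gt X_H1[OF \<phi>]])
    moreover have nm: "Hs.nm u \<le> sqrt S * X_norm \<Omega> u" if "u \<in> H1 \<Omega>" for u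
      using real_sqrt_le_mono[OF s_le[OF that]] by (simp add: Hs.nm_def X_norm_eq real_sqrt_mult)
    moreover have "Hs.nm gt * Hs.nm \<phi> \<le> (sqrt S * X_norm \<Omega> gt) * (sqrt S * X_norm \<Omega> \<phi>)"
      using Hs.nm_nonneg[OF gt] Hs.nm_nonneg[OF X_H1[OF \<phi>]] nm[OF gt] nm[OF X_H1[OF \<phi>]]
      by (intro mult_mono) auto
    moreover have "(sqrt S * X_norm \<Omega> gt) * (sqrt S * X_norm \<Omega> \<phi>) = S * X_norm \<Omega> gt * X_norm \<Omega> \<phi>"
      using S_nonneg by (simp add: algebra_simps)
    ultimately show "\<bar>D \<omega> \<phi> - wform s (X.riesz \<zeta>) \<phi>\<bar> \<le> S * X_norm \<Omega> gt * X.nm \<phi>"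
      by (simp add: nm_eqs)
  qed
  have b1: "X.dnorm (w' t) \<le> S * X_norm \<Omega> gt" if "t \<in> {0..T}" for t
    using ev(4)[OF that] init by linarith
  have "X.dnorm \<zeta> = X.nm (\<lambda>x. - ?h x)"
    by (rule X.dnorm_eq_nm) (use X.scale_mem[OF h, of "-1"] X.B_scale[OF h, of _ "-1"] in \<open>auto simp: \<zeta>_def\<close>)
  then have \<zeta>n: "X.dnorm \<zeta> = X_norm \<Omega> ?h" using X.nm_minus[OF h] by (simp only: nm_eqs)
  have b0: "X.dnorm (w t) \<le> X_norm \<Omega> ?h + S * X_norm \<Omega> gt * T" if t: "t \<in> {0..T}" for t
  proof -
    have "X.dnorm (w t) \<le> X.dnorm (w 0) + S * X_norm \<Omega> gt * t"
      by (rule X.C1_dual_growth[OF ev(1) t b1])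
    also have "S * X_norm \<Omega> gt * t \<le> S * X_norm \<Omega> gt * T"
      using t Snn by (intro mult_left_mono) auto
    finally show ?thesis by (simp add: ev(2) \<zeta>n)
  qed
  have "evolution_solution \<Omega> X \<sigma> \<epsilon> T gt \<omega> w"
    unfolding evolution_solution_iff using ev(1-3) by (auto simp: \<zeta>_def)
  from that[OF this ev(1) b1 b0] show ?thesis by blast
qed

text \<open>By uniqueness, the curve \<open>u\<close> of any decomposition is the one constructed above, up to null sets, and so
  inherits its bounds.\<close>

lemma decomp_curve:
  assumes dec: "weak_solution_decomp \<Omega> X \<sigma> \<epsilon> T gt V \<omega> u"
  obtains U U' where "stationary \<omega>" "has_C1_deriv T X (X_norm \<Omega>) U U'"
    "\<And>t. t \<in> {0..T} \<Longrightarrow> AE x in M. u t x = U t x"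
    "\<And>t. t \<in> {0..T} \<Longrightarrow> X_norm \<Omega> (U' t) \<le> S * X_norm \<Omega> gt"
    "\<And>t. t \<in> {0..T} \<Longrightarrow> X_norm \<Omega> (U t) \<le> X_norm \<Omega> (\<lambda>x. \<omega> x - gt x) + S * X_norm \<Omega> gt * T"
proof -
  have st: "stationary \<omega>" using dec by (simp add: weak_solution_decomp_def stationary_def wform_def)
  from dec obtain z where z: "evolution_solution \<Omega> X \<sigma> \<epsilon> T gt \<omega> z"
    "\<And>t. t \<in> {0..T} \<Longrightarrow> AE x in M. u t x = ND_inverse \<Omega> X (z t) x"
    unfolding weak_solution_decomp_def by blast
  obtain w w' where w: "evolution_solution \<Omega> X \<sigma> \<epsilon> T gt \<omega> w" "has_C1_deriv T X.dual X.dnorm w w'"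
    "\<And>t. t \<in> {0..T} \<Longrightarrow> X.dnorm (w' t) \<le> S * X_norm \<Omega> gt"
    "\<And>t. t \<in> {0..T} \<Longrightarrow> X.dnorm (w t) \<le> X_norm \<Omega> (\<lambda>x. \<omega> x - gt x) + S * X_norm \<Omega> gt * T"
    by (rule evolution_solution_exists[OF st]) blast
  have d: "w t \<in> X.dual" "w' t \<in> X.dual" if "t \<in> {0..T}" for t
    using w(2) that unfolding has_C1_deriv_def by auto
  have "\<omega> \<in> H1 \<Omega>" using st by (simp add: stationary_def)
  then have eq: "X.riesz (z t) = X.riesz (w t)" if "t \<in> {0..T}" for t
    by (intro X.riesz_cong evolution_solution_unique[OF z(1) w(1)] that) auto
  show ?thesis
  proof (rule that[OF st])
    show "has_C1_deriv T X (X_norm \<Omega>) (\<lambda>t. X.riesz (w t)) (\<lambda>t. X.riesz (w' t))"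
      using X.riesz_C1[OF w(2)] by (simp add: nm_eqs)
    fix t assume t: "t \<in> {0..T}"
    show "AE x in M. u t x = X.riesz (w t) x" using z(2)[OF t] eq[OF t] by (simp add: dual_eqs)
    show "X_norm \<Omega> (X.riesz (w' t)) \<le> S * X_norm \<Omega> gt"
      using w(3)[OF t] X.dnorm_riesz[OF d(2)[OF t]] by (simp add: nm_eqs)
    show "X_norm \<Omega> (X.riesz (w t)) \<le> X_norm \<Omega> (\<lambda>x. \<omega> x - gt x) + S * X_norm \<Omega> gt * T"
      using w(4)[OF t] X.dnorm_riesz[OF d(1)[OF t]] by (simp add: nm_eqs)
  qed
qed

lemma weak_solution_exists: "\<exists>V. weak_solution \<Omega> X \<sigma> \<epsilon> T gt V"
proof -
  obtain \<omega> where st: "stationary \<omega>" using stationary_exists by blast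
  then have w0: "\<omega> \<in> H1 \<Omega>" by (simp add: stationary_def)
  obtain w w' where w: "evolution_solution \<Omega> X \<sigma> \<epsilon> T gt \<omega> w" "has_C1_deriv T X.dual X.dnorm w w'"
    by (rule evolution_solution_exists[OF st]) blast
  define u where "u t = X.riesz (w t)" for t
  have C1: "has_C1_deriv T X (X_norm \<Omega>) u (\<lambda>t. X.riesz (w' t))"
    using X.riesz_C1[OF w(2)] by (simp add: nm_eqs u_def[abs_def])
  then have uX: "u t \<in> X" if "t \<in> {0..T}" for t using that unfolding has_C1_deriv_def by auto
  have "has_C1_deriv T (H1 \<Omega>) (H1_norm \<Omega>) u (\<lambda>t. X.riesz (w' t))"
    by (rule C1_shift(1)[OF C1, where \<omega> = "\<lambda>x. 0"]) (auto intro!: X_H1 uX)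
  moreover have "has_C1_deriv T (H1 \<Omega>) (H1_norm \<Omega>) (\<lambda>t x. \<omega> x + u t x) (\<lambda>t. X.riesz (w' t))"
    by (rule C1_shift(1)[OF C1, where \<omega> = \<omega>]) (auto intro!: Ha.add_mem[OF w0 X_H1[OF uX]])
  moreover have "\<forall>t\<in>{0..T}. \<forall>\<phi>\<in>X. z t \<phi> = w t \<phi>" if "evolution_solution \<Omega> X \<sigma> \<epsilon> T gt \<omega> z" for z
    using evolution_solution_unique[OF that w(1) w0 w0] by simp
  moreover have "\<forall>t\<in>{0..T}. AE x in M. u t x = ND_inverse \<Omega> X (w t) x"
    by (simp add: u_def dual_eqs)
  moreover have "(\<lambda>x. \<omega> x - gt x) \<in> X" "\<forall>\<phi>\<in>X. (LINT x|M. (\<sigma> x / \<epsilon> + 1) * (wgrad \<Omega> \<omega> x \<bullet> wgrad \<Omega> \<phi> x)) = 0"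
    using st unfolding stationary_def wform_def by blast+
  moreover have "\<forall>t\<in>{0..T}. AE x in M. \<omega> x + u t x = \<omega> x + u t x" by simp
  ultimately have "weak_solution_decomp \<Omega> X \<sigma> \<epsilon> T gt (\<lambda>t x. \<omega> x + u t x) \<omega> u"
    unfolding weak_solution_decomp_def C1_curves_def using w0 w(1) by blast
  then show ?thesis unfolding weak_solution_def by blast
qed

lemma weak_solution_unique:
  assumes "weak_solution \<Omega> X \<sigma> \<epsilon> T gt V" "weak_solution \<Omega> X \<sigma> \<epsilon> T gt W" "t \<in> {0..T}"
  shows "AE x in M. W t x = V t x"
proof -
  obtain \<omega> u where V: "weak_solution_decomp \<Omega> X \<sigma> \<epsilon> T gt V \<omega> u"
    using assms(1) unfolding weak_solution_def by blast
  obtain \<eta> v where W: "weak_solution_decomp \<Omega> X \<sigma> \<epsilon> T gt W \<eta> v"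
    using assms(2) unfolding weak_solution_def by blast
  have st: "stationary \<omega>" "stationary \<eta>"
    using V W by (auto simp: weak_solution_decomp_def stationary_def wform_def)
  have H: "\<omega> \<in> H1 \<Omega>" "\<eta> \<in> H1 \<Omega>" using st by (auto simp: stationary_def)
  from V obtain w where w: "evolution_solution \<Omega> X \<sigma> \<epsilon> T gt \<omega> w"
    "\<And>t. t \<in> {0..T} \<Longrightarrow> AE x in M. u t x = ND_inverse \<Omega> X (w t) x"
    unfolding weak_solution_decomp_def by blast
  from W obtain z where z: "evolution_solution \<Omega> X \<sigma> \<epsilon> T gt \<eta> z"
    "\<And>t. t \<in> {0..T} \<Longrightarrow> AE x in M. v t x = ND_inverse \<Omega> X (z t) x"
    unfolding weak_solution_decomp_def by blast
  have "X.riesz (w t) = X.riesz (z t)"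
    by (intro X.riesz_cong evolution_solution_unique[OF w(1) z(1) H stationary_unique[OF st] assms(3)])
  then have eq: "ND_inverse \<Omega> X (w t) = ND_inverse \<Omega> X (z t)" by (simp add: dual_eqs)
  have "AE x in M. V t x = \<omega> x + u t x" "AE x in M. W t x = \<eta> x + v t x"
    using V W assms(3) unfolding weak_solution_decomp_def by auto
  with w(2)[OF assms(3)] z(2)[OF assms(3)] stationary_unique[OF st]
  show ?thesis by eventually_elim (simp add: eq)
qed

end

section \<open>The norm estimates\<close>

text \<open>Any derivative may replace the one chosen in the definition of the norm.\<close>

lemma (in semi_inner_space) C1_norm_eq:
  assumes T: "T > 0" and v: "has_C1_deriv T S nm v v'"
  shows "C1_norm T S nm v = (SUP t\<in>{0..T}. nm (v t)) + (SUP t\<in>{0..T}. nm (v' t))"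
proof -
  have "has_C1_deriv T S nm v (SOME v'. has_C1_deriv T S nm v v')" using v by (rule someI[of "has_C1_deriv T S nm v"])
  then have "nm ((SOME v'. has_C1_deriv T S nm v v') t) = nm (v' t)" if "t \<in> {0..T}" for t
    by (rule C1_deriv_unique[OF T _ v that])
  then show ?thesis unfolding C1_norm_def by (auto intro: SUP_cong)
qed

context mixed_evolution
begin

lemma Sup_interval_le:
  fixes f :: "real \<Rightarrow> real"
  assumes "\<And>t. t \<in> {0..T} \<Longrightarrow> f t \<le> C"
  shows "(SUP t\<in>{0..T}. f t) \<le> C" "t \<in> {0..T} \<Longrightarrow> f t \<le> (SUP t\<in>{0..T}. f t)"
proof -
  show "(SUP t\<in>{0..T}. f t) \<le> C" using assms T_pos by (intro cSUP_least) auto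
  show "t \<in> {0..T} \<Longrightarrow> f t \<le> (SUP t\<in>{0..T}. f t)"
    by (rule cSUP_upper) (auto intro!: bdd_aboveI[of _ C] assms)
qed

lemma C1_estimates:
  assumes dec: "weak_solution_decomp \<Omega> X \<sigma> \<epsilon> T gt V \<omega> u"
  shows "C1_norm T (H1 \<Omega>) (H1_norm \<Omega>) V \<le> H1_norm \<Omega> \<omega> + c * C1_norm T X (X_norm \<Omega>) u"
    and "C1_norm T X (X_norm \<Omega>) u \<le> X_norm \<Omega> (\<lambda>x. \<omega> x - gt x) + S * X_norm \<Omega> gt * T + S * X_norm \<Omega> gt"
    and "0 \<le> C1_norm T X (X_norm \<Omega>) u"
    and "stationary \<omega>"
proof -
  obtain U U' where st: "stationary \<omega>" and C1: "has_C1_deriv T X (X_norm \<Omega>) U U'"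
    and uU: "\<And>t. t \<in> {0..T} \<Longrightarrow> AE x in M. u t x = U t x"
    and U': "\<And>t. t \<in> {0..T} \<Longrightarrow> X_norm \<Omega> (U' t) \<le> S * X_norm \<Omega> gt"
    and U: "\<And>t. t \<in> {0..T} \<Longrightarrow> X_norm \<Omega> (U t) \<le> X_norm \<Omega> (\<lambda>x. \<omega> x - gt x) + S * X_norm \<Omega> gt * T"
    by (rule decomp_curve[OF dec]) blast
  show "stationary \<omega>" by (rule st)
  have \<omega>: "\<omega> \<in> H1 \<Omega>" using st by (simp add: stationary_def)
  have uH: "u t \<in> H1 \<Omega>" and VH: "V t \<in> H1 \<Omega>" if "t \<in> {0..T}" for t
    using dec that unfolding weak_solution_decomp_def C1_curves_def has_C1_deriv_def by auto
  have UX: "U t \<in> X" "U' t \<in> X" if "t \<in> {0..T}" for t using C1 that unfolding has_C1_deriv_def by auto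
  have VU: "AE x in M. V t x = \<omega> x + U t x" if t: "t \<in> {0..T}" for t
  proof -
    have "AE x in M. V t x = \<omega> x + u t x" using dec t unfolding weak_solution_decomp_def by blast
    then show ?thesis using uU[OF t] by eventually_elim simp
  qed
  have uX: "u t \<in> X" if "t \<in> {0..T}" for t
    by (rule X_cong_AE[OF UX(1) uH uU]) fact+
  have Cu: "has_C1_deriv T X (X_norm \<Omega>) u U'"
    by (rule C1_shift(2)[OF C1 uH, where \<omega> = "\<lambda>x. 0"]) (auto simp: uU uX)
  have CV: "has_C1_deriv T (H1 \<Omega>) (H1_norm \<Omega>) V U'"
    by (rule C1_shift(1)[OF C1 VH VU])
  have un: "X_norm \<Omega> (u t) = X_norm \<Omega> (U t)" if "t \<in> {0..T}" for t
    unfolding X_norm_def wgrad_cong_AE[OF H1_L2[OF uH[OF that]] H1_L2[OF X_H1[OF UX(1)[OF that]]] uU[OF that]] ..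
  let ?N0 = "SUP t\<in>{0..T}. X_norm \<Omega> (u t)" and ?N1 = "SUP t\<in>{0..T}. X_norm \<Omega> (U' t)"
  have Nu: "C1_norm T X (X_norm \<Omega>) u = ?N0 + ?N1"
    using X.C1_norm_eq[OF T_pos] Cu by (simp add: nm_eqs)
  have u: "X_norm \<Omega> (u t) \<le> X_norm \<Omega> (\<lambda>x. \<omega> x - gt x) + S * X_norm \<Omega> gt * T" if "t \<in> {0..T}" for t
    using U[OF that] un[OF that] by simp
  note N0 = Sup_interval_le[of "\<lambda>t. X_norm \<Omega> (u t)", OF u]
  note N1 = Sup_interval_le[of "\<lambda>t. X_norm \<Omega> (U' t)", OF U']
  show "C1_norm T X (X_norm \<Omega>) u \<le> X_norm \<Omega> (\<lambda>x. \<omega> x - gt x) + S * X_norm \<Omega> gt * T + S * X_norm \<Omega> gt"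
    using N0(1) N1(1) by (simp add: Nu)
  have "0 \<in> {0..T}" using T_pos by simp
  then show "0 \<le> C1_norm T X (X_norm \<Omega>) u"
    using N0(2)[of 0] N1(2)[of 0] G.nm_nonneg[OF uH, of 0] G.nm_nonneg[OF X_H1[OF UX(2)], of 0]
    by (simp add: Nu nm_eqs)
  have "C1_norm T (H1 \<Omega>) (H1_norm \<Omega>) V = (SUP t\<in>{0..T}. H1_norm \<Omega> (V t)) + (SUP t\<in>{0..T}. H1_norm \<Omega> (U' t))"
    using H.C1_norm_eq[OF T_pos] CV by (simp add: nm_eqs)
  also have "\<dots> \<le> (H1_norm \<Omega> \<omega> + c * ?N0) + c * ?N1"
  proof (intro add_mono Sup_interval_le(1))
    fix t assume t: "t \<in> {0..T}"
    have "H1_norm \<Omega> (V t) = H1_norm \<Omega> (\<lambda>x. \<omega> x + U t x)"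
      by (rule H1_norm_cong_AE[OF H1_L2[OF VH] H1_L2[OF H.add_mem[OF \<omega> X_H1[OF UX(1)]]] VU]) fact+
    also have "\<dots> \<le> H1_norm \<Omega> \<omega> + H1_norm \<Omega> (U t)"
      using H.nm_add_le[OF \<omega> X_H1[OF UX(1)[OF t]]] by (simp add: nm_eqs)
    also have "H1_norm \<Omega> (U t) \<le> c * X_norm \<Omega> (U t)" by (rule poincare[OF UX(1)[OF t]])
    also have "\<dots> \<le> c * ?N0" using N0(2)[OF _ t] un[OF t] c_pos by (intro mult_left_mono) auto
    finally show "H1_norm \<Omega> (V t) \<le> H1_norm \<Omega> \<omega> + c * ?N0" by simp
    have "H1_norm \<Omega> (U' t) \<le> c * X_norm \<Omega> (U' t)" by (rule poincare[OF UX(2)[OF t]])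
    also have "\<dots> \<le> c * ?N1" using N1(2)[OF _ t] c_pos by (intro mult_left_mono) auto
    finally show "H1_norm \<Omega> (U' t) \<le> c * ?N1" .
  qed
  also have "\<dots> = H1_norm \<Omega> \<omega> + c * C1_norm T X (X_norm \<Omega>) u" by (simp add: Nu algebra_simps)
  finally show "C1_norm T (H1 \<Omega>) (H1_norm \<Omega>) V \<le> H1_norm \<Omega> \<omega> + c * C1_norm T X (X_norm \<Omega>) u" .
qed

text \<open>Let \<open>p\<close> and \<open>r\<close> be the \<open>L\<^sup>2\<close> norms of \<open>gt\<close> and \<open>h = \<omega> - gt\<close>, and \<open>y = \<parallel>\<nabla>h\<parallel>\<close>. Orthogonality in the weighted inner
  product gives \<open>\<parallel>\<nabla>\<omega>\<parallel>\<^sup>2 + y\<^sup>2 \<le> (1 + S) * \<parallel>\<nabla>gt\<parallel>\<^sup>2\<close>. The Poincare inequality gives \<open>r\<^sup>2 \<le> (m\<^sup>2 - 1) * y\<^sup>2\<close>,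
  and then \<open>(p + r)\<^sup>2 \<le> m\<^sup>2 * (p\<^sup>2 + y\<^sup>2)\<close> by Cauchy--Schwarz in the plane, so that the
  \<open>y\<^sup>2\<close> on the right can be absorbed into the first inequality.\<close>

lemma stationary_bounds:
  assumes st: "stationary \<omega>"
  defines "m \<equiv> max 1 c"
  shows "(X_norm \<Omega> (\<lambda>x. \<omega> x - gt x))\<^sup>2 \<le> (1 + S) * (H1_norm \<Omega> gt)\<^sup>2"
    and "(H1_norm \<Omega> \<omega>)\<^sup>2 \<le> m\<^sup>2 * ((1 + S) * (H1_norm \<Omega> gt)\<^sup>2)"
proof -
  define h where "h = (\<lambda>x. \<omega> x - gt x)"
  have \<omega>: "\<omega> \<in> H1 \<Omega>" and h: "h \<in> X" and orth: "wform a \<omega> h = 0"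
    using st by (auto simp: stationary_def h_def)
  note hH = X_H1[OF h]
  have m: "m \<ge> 1" "m \<ge> c" by (auto simp: m_def)
  have \<omega>h: "\<omega> = (\<lambda>x. 1 * gt x + 1 * h x)" and gth: "gt = (\<lambda>x. 1 * \<omega> x + (-1) * h x)"
    by (auto simp: h_def)
  have pyth: "wform a gt gt = wform a \<omega> \<omega> + wform a h h"
    using Ha.B_square[OF \<omega> hH, of 1 "-1"] orth gth by simp
  have energy: "D \<omega> \<omega> + D h h \<le> (1 + S) * D gt gt"
    using pyth a_ge[OF \<omega>] a_ge[OF hH] a_le[OF gt] by linarith
  have nn: "D \<omega> \<omega> \<ge> 0" "D h h \<ge> 0" "D gt gt \<ge> 0" using G.B_nonneg \<omega> hH gt by auto
  interpret L: semi_inner_space "L2 M" "L2_inner M :: (real^'n \<Rightarrow> real) \<Rightarrow> _" by (rule L2_semi_inner)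
  let ?p = "L.nm gt" and ?r = "L.nm h" and ?y = "X_norm \<Omega> h"
  have H1sq: "(H1_norm \<Omega> v)\<^sup>2 = (L.nm v)\<^sup>2 + D v v" if "v \<in> H1 \<Omega>" for v
    using H.nm_square[OF that] L.nm_square[OF H1_L2[OF that]] by (simp add: nm_eqs H1_inner_def)
  have ysq: "?y\<^sup>2 = D h h" using G.nm_square[OF hH] by (simp add: nm_eqs)
  have G2: "(H1_norm \<Omega> gt)\<^sup>2 = ?p\<^sup>2 + D gt gt" by (rule H1sq[OF gt])
  have S1: "(1 + S) * D gt gt \<le> (1 + S) * (H1_norm \<Omega> gt)\<^sup>2"
    using S_nonneg by (intro mult_left_mono) (auto simp: G2)
  show "(X_norm \<Omega> (\<lambda>x. \<omega> x - gt x))\<^sup>2 \<le> (1 + S) * (H1_norm \<Omega> gt)\<^sup>2"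
    using energy nn S1 ysq by (simp add: h_def[symmetric])
  have "H1_norm \<Omega> h \<le> m * ?y"
    using poincare[OF h] mult_right_mono[OF m(2), of ?y] G.nm_nonneg[OF hH] by (simp add: nm_eqs)
  then have "(H1_norm \<Omega> h)\<^sup>2 \<le> (m * ?y)\<^sup>2"
    using H.nm_nonneg[OF hH] by (intro power_mono) (auto simp: nm_eqs)
  then have r: "?r\<^sup>2 \<le> (m\<^sup>2 - 1) * ?y\<^sup>2"
    using H1sq[OF hH] ysq by (simp add: power_mult_distrib algebra_simps)
  have "L.nm \<omega> \<le> ?p + ?r" using L.nm_add_le[OF H1_L2[OF gt] H1_L2[OF hH]] \<omega>h by simp
  then have "(L.nm \<omega>)\<^sup>2 \<le> (?p + ?r)\<^sup>2" using L.nm_nonneg[OF H1_L2[OF \<omega>]] by (intro power_mono) auto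
  also have "\<dots> \<le> m\<^sup>2 * (?p\<^sup>2 + ?y\<^sup>2)"
  proof -
    define k where "k = sqrt (m\<^sup>2 - 1)"
    have k: "k \<ge> 0" "k\<^sup>2 = m\<^sup>2 - 1" using m(1) by (auto simp: k_def)
    have y0: "?y \<ge> 0" using G.nm_nonneg[OF hH] by (simp add: nm_eqs)
    have "?r\<^sup>2 \<le> (k * ?y)\<^sup>2" using r by (simp add: power_mult_distrib k)
    then have "?r \<le> k * ?y" by (rule power2_le_imp_le[OF _ mult_nonneg_nonneg[OF k(1) y0]])
    then have "(?p + ?r)\<^sup>2 \<le> (?p + k * ?y)\<^sup>2"
      using L.nm_nonneg[OF H1_L2[OF gt]] L.nm_nonneg[OF H1_L2[OF hH]] by (intro power_mono) auto
    also have "\<dots> = (1 + k\<^sup>2) * (?p\<^sup>2 + ?y\<^sup>2) - (k * ?p - ?y)\<^sup>2"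
      by (simp add: power2_eq_square algebra_simps)
    also have "\<dots> \<le> m\<^sup>2 * (?p\<^sup>2 + ?y\<^sup>2)" by (simp add: k)
    finally show ?thesis .
  qed
  finally have "(H1_norm \<Omega> \<omega>)\<^sup>2 \<le> m\<^sup>2 * (?p\<^sup>2 + D h h) + 1 * D \<omega> \<omega>" using H1sq[OF \<omega>] ysq by simp
  also have "\<dots> \<le> m\<^sup>2 * (?p\<^sup>2 + D h h) + m\<^sup>2 * D \<omega> \<omega>"
    using m nn by (intro add_left_mono mult_right_mono) (auto simp: one_le_power)
  also have "\<dots> = m\<^sup>2 * (?p\<^sup>2 + (D \<omega> \<omega> + D h h))" by (simp add: algebra_simps)
  also have "\<dots> \<le> m\<^sup>2 * ((1 + S) * ?p\<^sup>2 + (1 + S) * D gt gt)"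
    using energy S_nonneg by (intro mult_left_mono add_mono) (auto simp: mult_le_cancel_right1)
  also have "\<dots> = m\<^sup>2 * ((1 + S) * (H1_norm \<Omega> gt)\<^sup>2)" by (simp add: G2 algebra_simps)
  finally show "(H1_norm \<Omega> \<omega>)\<^sup>2 \<le> m\<^sup>2 * ((1 + S) * (H1_norm \<Omega> gt)\<^sup>2)" .
qed

text \<open>In units of \<open>g = \<parallel>gt\<parallel>\<close> and with \<open>r = sqrt (1 + S)\<close>, the stationary part contributes at most \<open>m r\<close> and the
  evolution part at most \<open>m (r + S T + S)\<close>; the claim then amounts to \<open>r + S \<le> r ^ 4\<close>. The constant \<open>m\<close>
  replaces \<open>c\<close> because the estimates of the stationary part require a Poincare constant of at least \<open>1\<close>; this
  accounts for the maximum in the final bound.\<close>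

lemma final_estimate:
  assumes dec: "weak_solution_decomp \<Omega> X \<sigma> \<epsilon> T gt V \<omega> u"
  shows "H1_norm \<Omega> \<omega> + c * C1_norm T X (X_norm \<Omega>) u
     \<le> 2 * max 1 (c\<^sup>2) * max 1 T * (1 + S)\<^sup>2 * H1_norm \<Omega> gt"
proof -
  define m where "m = max 1 c"
  define \<tau> where "\<tau> = max 1 T"
  define r where "r = sqrt (1 + S)"
  define g where "g = H1_norm \<Omega> gt"
  note est = C1_estimates[OF dec]
  have m: "m \<ge> 1" "m \<ge> c" and \<tau>: "\<tau> \<ge> 1" "\<tau> \<ge> T" by (auto simp: m_def \<tau>_def)
  have r: "r \<ge> 1" "r\<^sup>2 = 1 + S" using S_nonneg by (auto simp: r_def)
  have r0: "r \<ge> 0" and m0: "m \<ge> 0" using r m by auto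
  have g0: "g \<ge> 0" using H.nm_nonneg[OF gt] by (simp add: nm_eqs g_def)
  have q: "X_norm \<Omega> gt \<le> g" unfolding g_def X_norm_eq H1_norm_eq H1_inner_def
    by (intro real_sqrt_le_mono) (simp add: L2_inner_self)
  have "(X_norm \<Omega> (\<lambda>x. \<omega> x - gt x))\<^sup>2 \<le> (r * g)\<^sup>2"
    using stationary_bounds(1)[OF est(4)] by (simp add: power_mult_distrib r g_def)
  then have y: "X_norm \<Omega> (\<lambda>x. \<omega> x - gt x) \<le> r * g" by (rule power2_le_imp_le[OF _ mult_nonneg_nonneg[OF r0 g0]])
  have "(H1_norm \<Omega> \<omega>)\<^sup>2 \<le> (m * (r * g))\<^sup>2"
    using stationary_bounds(2)[OF est(4)] by (simp add: power_mult_distrib r g_def m_def)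
  then have \<omega>: "H1_norm \<Omega> \<omega> \<le> m * (r * g)" by (rule power2_le_imp_le[OF _ mult_nonneg_nonneg[OF m0 mult_nonneg_nonneg[OF r0 g0]]])
  have Sq: "S * X_norm \<Omega> gt \<le> S * g" using q S_nonneg by (rule mult_left_mono)
  have "S * X_norm \<Omega> gt * T \<le> S * g * \<tau>"
    by (rule mult_mono[OF Sq \<tau>(2)]) (use T_pos S_nonneg g0 in auto)
  moreover have "S * X_norm \<Omega> gt * 1 \<le> S * g * \<tau>"
    by (rule mult_mono[OF Sq \<tau>(1)]) (use S_nonneg g0 in auto)
  ultimately have C1: "C1_norm T X (X_norm \<Omega>) u \<le> r * g + 2 * (S * g * \<tau>)"
    using est(2) y by simp
  have "H1_norm \<Omega> \<omega> + c * C1_norm T X (X_norm \<Omega>) u \<le> m * (r * g) + m * (r * g + 2 * (S * g * \<tau>))"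
    by (rule add_mono[OF \<omega> mult_mono[OF m(2) C1 m0 est(3)]])
  also have "\<dots> = 2 * m * g * (r + S * \<tau>)" by (simp add: algebra_simps)
  also have "\<dots> \<le> 2 * m\<^sup>2 * g * (\<tau> * (r\<^sup>2)\<^sup>2)"
  proof (rule mult_mono)
    have "m \<le> m\<^sup>2" using m by (simp add: power2_eq_square)
    then show "2 * m * g \<le> 2 * m\<^sup>2 * g" using g0 by (simp add: mult_right_mono)
    have "r \<le> r\<^sup>2" using r(1) by (simp add: power2_eq_square)
    then have "r + S \<le> 2 * r\<^sup>2 - 1" using r(2) by linarith
    also have "\<dots> \<le> (r\<^sup>2)\<^sup>2" using sum_squares_bound[of "r\<^sup>2" 1] by simp
    finally have "\<tau> * (r + S) \<le> \<tau> * (r\<^sup>2)\<^sup>2" using \<tau> by (intro mult_left_mono) auto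
    moreover have "r \<le> \<tau> * r" using \<tau> r by simp
    ultimately show "r + S * \<tau> \<le> \<tau> * (r\<^sup>2)\<^sup>2" by (simp add: algebra_simps)
    show "0 \<le> 2 * m\<^sup>2 * g" using g0 by simp
    show "0 \<le> r + S * \<tau>" using r S_nonneg \<tau> by simp
  qed
  also have "2 * m\<^sup>2 * g * (\<tau> * (r\<^sup>2)\<^sup>2) = 2 * m\<^sup>2 * \<tau> * (1 + S)\<^sup>2 * g"
    unfolding r(2) by (simp only: mult_ac)
  also have "m\<^sup>2 = max 1 (c\<^sup>2)"
    using c_pos power_le_one[of c 2] one_le_power[of c 2] by (cases "c \<le> 1") (auto simp: m_def max_def)
  finally show ?thesis unfolding \<tau>_def g_def .
qed

end

lemma Linf_weight:
  assumes \<sigma>: "\<sigma> \<in> Linf M"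
  shows "AE x in M. \<bar>\<sigma> x\<bar> \<le> Linf_norm M \<sigma>"
proof -
  let ?e = "esssup M (\<lambda>x. ereal \<bar>\<sigma> x\<bar>)"
  have fin: "?e < \<infinity>" using \<sigma> by (simp add: Linf_def)
  have ae: "AE x in M. ereal \<bar>\<sigma> x\<bar> \<le> ?e" by (rule esssup_AE)
  show ?thesis
  proof (cases ?e)
    case (real r)
    then show ?thesis using ae by (simp add: Linf_norm_def)
  next
    case MInf
    then show ?thesis using ae by (auto elim!: eventually_mono)
  qed (use fin in auto)
qed

lemma Linf_norm_nonneg: "Linf_norm M \<sigma> \<ge> 0" if "\<sigma> \<in> Linf M"
proof (rule ccontr)
  assume neg: "\<not> ?thesis"
  have "AE x in M. False" using Linf_weight[OF that] by eventually_elim (use neg in auto)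
  then have "emeasure M (space M) = 0" by (simp add: AE_iff_measurable[OF _ refl])
  \<comment> \<open>On a null space the essential supremum is \<open>-\<infinity>\<close>, whose real value is \<open>0\<close> by convention.\<close>
  then have "esssup M (\<lambda>x. ereal \<bar>\<sigma> x\<bar>) = - \<infinity>"
    using that by (intro esssup_zero_space) (auto simp: Linf_def)
  then show False using neg by (simp add: Linf_norm_def)
qed

theorem theorem3p3:
  fixes \<Omega> BD BN :: "(real^'n) set"
    and \<nu> :: "real^'n \<Rightarrow> real^'n"
    and \<gamma>0 \<gamma>1 :: "(real^'n \<Rightarrow> real) \<Rightarrow> real^'n \<Rightarrow> real"
    and gt g \<sigma> :: "real^'n \<Rightarrow> real"
    and T \<epsilon> c\<Omega> :: real
    and d :: nat
  assumes T: "T > 0"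
    and \<Omega>: "open \<Omega>" "connected \<Omega>" "bounded \<Omega>"
    and reg: "d \<ge> 2" "uniform_Cd_regular d \<Omega>"
    and normal: "\<forall>x\<in>frontier \<Omega>. outward_unit_normal \<Omega> x (\<nu> x)"
    and BD: "BD \<noteq> {}" "regular_open_in (top_of_set (frontier \<Omega>)) BD"
    and BN: "BN \<noteq> {}" "regular_open_in (top_of_set (frontier \<Omega>)) BN"
    and BDN: "BD \<inter> BN = {}" "BN = frontier \<Omega> - closure BD"
    and trace: "trace_operator \<Omega> \<gamma>0"
    and normal_trace: "normal_trace_operator \<Omega> \<nu> \<gamma>1"
    and gt: "gt \<in> H2 \<Omega>" "AE y in surface_measure \<Omega>. y \<in> BN \<longrightarrow> \<gamma>1 gt y = 0"
    and g: "AE y in surface_measure \<Omega>. g y = \<gamma>0 gt y"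
    and \<sigma>: "\<sigma> \<in> Linf (lebesgue_on \<Omega>)" "AE x in lebesgue_on \<Omega>. \<sigma> x \<ge> 0"
    and \<epsilon>: "\<epsilon> > 0"
    and c\<Omega>: "c\<Omega> > 0"
      "\<forall>\<phi>\<in>X_space \<Omega> BD \<gamma>0.
         1 / c\<Omega> * H1_norm \<Omega> \<phi> \<le> L2_norm (lebesgue_on \<Omega>) (wgrad \<Omega> \<phi>) \<and>
         L2_norm (lebesgue_on \<Omega>) (wgrad \<Omega> \<phi>) \<le> c\<Omega> * H1_norm \<Omega> \<phi>"
  shows
    "(\<exists>V. weak_solution \<Omega> (X_space \<Omega> BD \<gamma>0) \<sigma> \<epsilon> T gt V \<and>
          (\<forall>V'. weak_solution \<Omega> (X_space \<Omega> BD \<gamma>0) \<sigma> \<epsilon> T gt V' \<longrightarrow>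
             (\<forall>t\<in>{0..T}. AE x in lebesgue_on \<Omega>. V' t x = V t x))) \<and>
     (\<forall>V \<omega> u. weak_solution_decomp \<Omega> (X_space \<Omega> BD \<gamma>0) \<sigma> \<epsilon> T gt V \<omega> u \<longrightarrow>
        C1_norm T (H1 \<Omega>) (H1_norm \<Omega>) V
          \<le> H1_norm \<Omega> \<omega> + c\<Omega> * C1_norm T (X_space \<Omega> BD \<gamma>0) (X_norm \<Omega>) u \<and>
        H1_norm \<Omega> \<omega> + c\<Omega> * C1_norm T (X_space \<Omega> BD \<gamma>0) (X_norm \<Omega>) u
          \<le> 2 * max 1 (c\<Omega>\<^sup>2) * max 1 T * (1 + Linf_norm (lebesgue_on \<Omega>) \<sigma> / \<epsilon>)\<^sup>2 * H1_norm \<Omega> gt)"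
proof -
  define S where "S = Linf_norm (lebesgue_on \<Omega>) \<sigma> / \<epsilon>"
  interpret bounded_domain \<Omega> by unfold_locales (use \<Omega> in auto)
  have bound: "AE x in M. \<bar>\<sigma> x\<bar> \<le> Linf_norm M \<sigma>" by (rule Linf_weight[OF \<sigma>(1)])
  interpret mixed_evolution \<Omega> BD \<gamma>0 c\<Omega> gt \<sigma> \<epsilon> S T
  proof
    show "trace_operator \<Omega> \<gamma>0" by (rule trace)
    show "c\<Omega> > 0" by (rule c\<Omega>(1))
    show "H1_norm \<Omega> \<phi> \<le> c\<Omega> * X_norm \<Omega> \<phi>" if "\<phi> \<in> X_space \<Omega> BD \<gamma>0" for \<phi>
    proof -
      have "1 / c\<Omega> * H1_norm \<Omega> \<phi> \<le> X_norm \<Omega> \<phi>" using c\<Omega>(2) that by (simp add: X_norm_def)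
      then show ?thesis using c\<Omega>(1) by (simp add: field_simps)
    qed
    show "gt \<in> H1 \<Omega>" using gt(1) by (simp add: H2_def)
    show "weight (\<lambda>x. \<sigma> x / \<epsilon>) S"
      unfolding weight_def
    proof (intro conjI)
      show "(\<lambda>x. \<sigma> x / \<epsilon>) \<in> borel_measurable M"
        using \<sigma>(1) by (intro borel_measurable_divide) (auto simp: Linf_def)
      show "AE x in M. 0 \<le> \<sigma> x / \<epsilon>" using \<sigma>(2) by eventually_elim (use \<epsilon> in auto)
      show "AE x in M. \<sigma> x / \<epsilon> \<le> S"
        using bound by eventually_elim (use \<epsilon> in \<open>auto simp: S_def intro!: divide_right_mono\<close>)
    qed
    show "S \<ge> 0" using Linf_norm_nonneg[OF \<sigma>(1)] \<epsilon> by (simp add: S_def)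
    show "T > 0" by (rule T)
  qed
  show ?thesis
  proof (intro conjI allI impI)
    show "\<exists>V. weak_solution \<Omega> (X_space \<Omega> BD \<gamma>0) \<sigma> \<epsilon> T gt V \<and>
        (\<forall>V'. weak_solution \<Omega> (X_space \<Omega> BD \<gamma>0) \<sigma> \<epsilon> T gt V' \<longrightarrow>
           (\<forall>t\<in>{0..T}. AE x in lebesgue_on \<Omega>. V' t x = V t x))"
      using weak_solution_exists weak_solution_unique by blast
  next
    fix V \<omega> u assume dec: "weak_solution_decomp \<Omega> (X_space \<Omega> BD \<gamma>0) \<sigma> \<epsilon> T gt V \<omega> u"
    show "C1_norm T (H1 \<Omega>) (H1_norm \<Omega>) V
        \<le> H1_norm \<Omega> \<omega> + c\<Omega> * C1_norm T (X_space \<Omega> BD \<gamma>0) (X_norm \<Omega>) u"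
      by (rule C1_estimates(1)[OF dec])
    show "H1_norm \<Omega> \<omega> + c\<Omega> * C1_norm T (X_space \<Omega> BD \<gamma>0) (X_norm \<Omega>) u
        \<le> 2 * max 1 (c\<Omega>\<^sup>2) * max 1 T * (1 + Linf_norm (lebesgue_on \<Omega>) \<sigma> / \<epsilon>)\<^sup>2 * H1_norm \<Omega> gt"
      using final_estimate[OF dec] by (simp add: S_def)
  qed
qed

end
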